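(* Let $k$ be an algebraically closed field of characteristic $0$. Suppose $\mathcal A$ and $\mathcal A'$ are fgc associative tori of nullity $n$ over $k$, $r\ge1$, and the Lie tori $\mathfrak{sl}_{r+1}(\mathcal A)$ and $\mathfrak{sl}_{r+1}(\mathcal A')$ satisfy Assumption (C). Then $\mathfrak{sl}_{r+1}(\mathcal A)$ and $\mathfrak{sl}_{r+1}(\mathcal A')$ are isomorphic if and only if $\mathcal A$ and $\mathcal A'$ are isomorphic.
   Context: For a finitely generated free abelian group $\Lambda$, an associative $\Lambda$-torus is a $\Lambda$-graded unital associative $k$-algebra $\mathcal A=\bigoplus_\lambda\mathcal A^\lambda$ with each $\mathcal A^\lambda$ spanned by an invertible element; its nullity is $\mathrm{rank}_{\mathbb Z}\Lambda$; it is fgc if finitely generated as a module over its centre. $\mathfrak{sl}_{r+1}(\mathcal A)$ is the derived algebra of $\mathrm{Mat}_{r+1}(\mathcal A)$ under the commutator product; it is an fgc centreless Lie torus of type $A_r$, with root grading the root-space decomposition relative to $\mathfrak h=\sum_{i=1}^r k(e_{ii}-e_{i+1,i+1})$ and $\Lambda$-grading induced entrywise from $\mathcal A$. Lie torus of type $(\Delta,\Lambda)$: a Lie algebra $\mathcal L$ with a $Q\times\Lambda$-grading ($Q=\mathrm{span}_{\mathbb Z}\Delta$, $\Delta$ a finite root system including $0$, $\mathcal L_\alpha=\bigoplus_\lambda\mathcal L_\alpha^\lambda$) such that $\{\alpha:\mathcal L_\alpha\ne0\}=\Delta$, $\mathcal L_\alpha^0\ne0$ for nonzero indivisible $\alpha$,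 every nonzero $\mathcal L_\alpha^\lambda$ with $\alpha\ne0$ is spanned by some $e$ with $\mathcal L_{-\alpha}^{-\lambda}=kf$ and $[[e,f],x]=\langle\beta,\alpha^\vee\rangle x$ for $x\in\mathcal L_\beta$, $\mathcal L$ is generated by the $\mathcal L_\alpha$ ($\alpha\ne0$), and $\Lambda$ is generated by the $\Lambda$-support. Centroid: $\{c\in\mathrm{End}_k\mathcal L:c[x,y]=[cx,y]=[x,cy]\}$. An fgc centreless Lie algebra $\mathcal L$ satisfies Assumption (C) if: whenever $\mathcal L$ carries a Lie torus structure of type $(\Delta,\Lambda)$ with $\mathfrak h=\mathcal L_0^0$ and (the same algebra) $\mathcal L$ carries a Lie torus structure of type $(\Delta',\Lambda')$ with degree-$(0,0)$ component $\mathfrak h'$, there exists an automorphism $\varphi$ of $\mathcal L$ with $\varphi(\mathfrak h)=\mathfrak h'$. *)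

theory Defs
  imports Main "HOL-Library.Function_Algebras" "HOL-Computational_Algebra.Polynomial"
begin

definition alg_closed :: "'k::field itself \<Rightarrow> bool" where
  "alg_closed (TYPE('k)) \<longleftrightarrow>
     (\<forall>p :: 'k poly. degree p > 0 \<longrightarrow> (\<exists>x. poly p x = 0))"

definition zgen :: "'g::ab_group_add set \<Rightarrow> 'g set" where
  "zgen S = \<Inter>{H. 0 \<in> H \<and> (\<forall>x\<in>H. \<forall>y\<in>H. x - y \<in> H) \<and> S \<subseteq> H}"

definition direct_sum_decomp ::
    "('k::field \<Rightarrow> 'v::ab_group_add \<Rightarrow> 'v) \<Rightarrow> 'v set \<Rightarrow> 'i set \<Rightarrow> ('i \<Rightarrow> 'v set) \<Rightarrow> bool" where
  "direct_sum_decomp sc V I G \<longleftrightarrow>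
     (\<forall>i\<in>I. module.subspace sc (G i) \<and> G i \<subseteq> V) \<and>
     (\<forall>x\<in>V. \<exists>S c. finite S \<and> S \<subseteq> I \<and> (\<forall>i\<in>S. c i \<in> G i) \<and> x = sum c S) \<and>
     (\<forall>S c. finite S \<and> S \<subseteq> I \<and> (\<forall>i\<in>S. c i \<in> G i) \<and> sum c S = 0 \<longrightarrow> (\<forall>i\<in>S. c i = 0))"

definition k_algebra :: "('k::field \<Rightarrow> 'a::ring_1 \<Rightarrow> 'a) \<Rightarrow> bool" where
  "k_algebra sc \<longleftrightarrow> vector_space sc \<and>
     (\<forall>c x y. sc c (x * y) = sc c x * y \<and> sc c (x * y) = x * sc c y)"

definition lat :: "nat \<Rightarrow> (nat \<Rightarrow> int) set" where
  "lat n = {l. \<forall>i\<ge>n. l i = 0}"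

definition invertible_elt :: "'a::ring_1 \<Rightarrow> bool" where
  "invertible_elt u \<longleftrightarrow> (\<exists>v. u * v = 1 \<and> v * u = 1)"

definition assoc_torus_grading ::
    "('k::field \<Rightarrow> 'a::ring_1 \<Rightarrow> 'a) \<Rightarrow> nat \<Rightarrow> ((nat \<Rightarrow> int) \<Rightarrow> 'a set) \<Rightarrow> bool" where
  "assoc_torus_grading sc n G \<longleftrightarrow>
     direct_sum_decomp sc UNIV (lat n) G \<and>
     (\<forall>l\<in>lat n. \<forall>m\<in>lat n. \<forall>x\<in>G l. \<forall>y\<in>G m. x * y \<in> G (l + m)) \<and>
     (\<forall>l\<in>lat n. \<exists>u. invertible_elt u \<and> G l = module.span sc {u})"

text \<open>A is an associative torus of nullity n (i.e. graded by a free abelian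
  group of rank n, which we may take to be Z^n).\<close>
definition assoc_torus :: "('k::field \<Rightarrow> 'a::ring_1 \<Rightarrow> 'a) \<Rightarrow> nat \<Rightarrow> bool" where
  "assoc_torus sc n \<longleftrightarrow> k_algebra sc \<and> (\<exists>G. assoc_torus_grading sc n G)"

definition ring_centre :: "'a::ring_1 set" where
  "ring_centre = {z. \<forall>x. z * x = x * z}"

definition fgc_ring :: "'a::ring_1 itself \<Rightarrow> bool" where
  "fgc_ring (TYPE('a)) \<longleftrightarrow>
     (\<exists>S :: 'a set. finite S \<and>
        (\<forall>x. \<exists>c. (\<forall>s\<in>S. c s \<in> ring_centre) \<and> x = (\<Sum>s\<in>S. c s * s)))"

definition alg_iso ::
    "('k::field \<Rightarrow> 'a::ring_1 \<Rightarrow> 'a) \<Rightarrow> ('k \<Rightarrow> 'b::ring_1 \<Rightarrow> 'b) \<Rightarrow> ('a \<Rightarrow> 'b) \<Rightarrow> bool" where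
  "alg_iso sc sc' f \<longleftrightarrow> bij f \<and>
     (\<forall>x y. f (x + y) = f x + f y) \<and> (\<forall>c x. f (sc c x) = sc' c (f x)) \<and>
     (\<forall>x y. f (x * y) = f x * f y) \<and> f 1 = 1"

definition alg_isomorphic ::
    "('k::field \<Rightarrow> 'a::ring_1 \<Rightarrow> 'a) \<Rightarrow> ('k \<Rightarrow> 'b::ring_1 \<Rightarrow> 'b) \<Rightarrow> bool" where
  "alg_isomorphic sc sc' \<longleftrightarrow> (\<exists>f. alg_iso sc sc' f)"

definition lie_hom_iso ::
    "('k::field \<Rightarrow> 'L::ab_group_add \<Rightarrow> 'L) \<Rightarrow> 'L set \<Rightarrow> ('L \<Rightarrow> 'L \<Rightarrow> 'L) \<Rightarrow>
     ('k \<Rightarrow> 'M::ab_group_add \<Rightarrow> 'M) \<Rightarrow> 'M set \<Rightarrow> ('M \<Rightarrow> 'M \<Rightarrow> 'M) \<Rightarrow> ('L \<Rightarrow> 'M) \<Rightarrow> bool" where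
  "lie_hom_iso sc C br sc' C' br' f \<longleftrightarrow> bij_betw f C C' \<and>
     (\<forall>x\<in>C. \<forall>y\<in>C. f (x + y) = f x + f y) \<and>
     (\<forall>c. \<forall>x\<in>C. f (sc c x) = sc' c (f x)) \<and>
     (\<forall>x\<in>C. \<forall>y\<in>C. f (br x y) = br' (f x) (f y))"

definition lie_isomorphic ::
    "('k::field \<Rightarrow> 'L::ab_group_add \<Rightarrow> 'L) \<Rightarrow> 'L set \<Rightarrow> ('L \<Rightarrow> 'L \<Rightarrow> 'L) \<Rightarrow>
     ('k \<Rightarrow> 'M::ab_group_add \<Rightarrow> 'M) \<Rightarrow> 'M set \<Rightarrow> ('M \<Rightarrow> 'M \<Rightarrow> 'M) \<Rightarrow> bool" where
  "lie_isomorphic sc C br sc' C' br' \<longleftrightarrow> (\<exists>f. lie_hom_iso sc C br sc' C' br' f)"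

definition lie_subalgebra ::
    "('k::field \<Rightarrow> 'L::ab_group_add \<Rightarrow> 'L) \<Rightarrow> ('L \<Rightarrow> 'L \<Rightarrow> 'L) \<Rightarrow> 'L set \<Rightarrow> bool" where
  "lie_subalgebra sc br S \<longleftrightarrow> module.subspace sc S \<and> (\<forall>x\<in>S. \<forall>y\<in>S. br x y \<in> S)"

definition lie_generated ::
    "('k::field \<Rightarrow> 'L::ab_group_add \<Rightarrow> 'L) \<Rightarrow> ('L \<Rightarrow> 'L \<Rightarrow> 'L) \<Rightarrow> 'L set \<Rightarrow> 'L set" where
  "lie_generated sc br X = \<Inter>{S. lie_subalgebra sc br S \<and> X \<subseteq> S}"

definition centroid ::
    "('k::field \<Rightarrow> 'L::ab_group_add \<Rightarrow> 'L) \<Rightarrow> 'L set \<Rightarrow> ('L \<Rightarrow> 'L \<Rightarrow> 'L) \<Rightarrow> ('L \<Rightarrow> 'L) set" where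
  "centroid sc C br = {c. (\<forall>x\<in>C. c x \<in> C) \<and>
      (\<forall>x\<in>C. \<forall>y\<in>C. c (x + y) = c x + c y) \<and> (\<forall>a. \<forall>x\<in>C. c (sc a x) = sc a (c x)) \<and>
      (\<forall>x\<in>C. \<forall>y\<in>C. c (br x y) = br (c x) y \<and> c (br x y) = br x (c y))}"

definition lie_fgc ::
    "('k::field \<Rightarrow> 'L::ab_group_add \<Rightarrow> 'L) \<Rightarrow> 'L set \<Rightarrow> ('L \<Rightarrow> 'L \<Rightarrow> 'L) \<Rightarrow> bool" where
  "lie_fgc sc C br \<longleftrightarrow>
     (\<exists>S. finite S \<and> S \<subseteq> C \<and>
        (\<forall>x\<in>C. \<exists>c. (\<forall>s\<in>S. c s \<in> centroid sc C br) \<and> x = (\<Sum>s\<in>S. c s s)))"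

definition lie_centreless ::
    "'L::ab_group_add set \<Rightarrow> ('L \<Rightarrow> 'L \<Rightarrow> 'L) \<Rightarrow> bool" where
  "lie_centreless C br \<longleftrightarrow> (\<forall>z\<in>C. (\<forall>x\<in>C. br z x = 0) \<longrightarrow> z = 0)"

definition rvec :: "nat \<Rightarrow> (nat \<Rightarrow> real) set" where
  "rvec d = {v. \<forall>i\<ge>d. v i = 0}"

definition dotp :: "nat \<Rightarrow> (nat \<Rightarrow> real) \<Rightarrow> (nat \<Rightarrow> real) \<Rightarrow> real" where
  "dotp d u v = (\<Sum>i<d. u i * v i)"

text \<open>The Cartan integer <beta, alpha^vee> = 2(beta,alpha)/(alpha,alpha)
  (an integer whenever beta lies in the root lattice).\<close>
definition cartan_int :: "nat \<Rightarrow> (nat \<Rightarrow> real) \<Rightarrow> (nat \<Rightarrow> real) \<Rightarrow> int" where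
  "cartan_int d b a = \<lfloor>2 * dotp d b a / dotp d a a\<rfloor>"

definition root_system0 :: "nat \<Rightarrow> (nat \<Rightarrow> real) set \<Rightarrow> bool" where
  "root_system0 d D \<longleftrightarrow> finite D \<and> D \<subseteq> rvec d \<and> 0 \<in> D \<and>
     (\<forall>v\<in>rvec d. \<exists>c. v = (\<Sum>a\<in>D. (\<lambda>i. c a * a i))) \<and>
     (\<forall>a\<in>D - {0}. \<forall>b\<in>D.
        (\<exists>n::int. 2 * dotp d b a / dotp d a a = of_int n) \<and>
        (\<lambda>i. b i - 2 * dotp d b a / dotp d a a * a i) \<in> D)"

definition indivisible_root :: "(nat \<Rightarrow> real) set \<Rightarrow> (nat \<Rightarrow> real) \<Rightarrow> bool" where
  "indivisible_root D a \<longleftrightarrow> \<not> (\<exists>b\<in>D. a = b + b)"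

definition root_space ::
    "('k::field \<Rightarrow> 'L::ab_group_add \<Rightarrow> 'L) \<Rightarrow> nat \<Rightarrow> ((nat \<Rightarrow> real) \<Rightarrow> (nat \<Rightarrow> int) \<Rightarrow> 'L set)
     \<Rightarrow> (nat \<Rightarrow> real) \<Rightarrow> 'L set" where
  "root_space sc m Lg a = module.span sc (\<Union>l\<in>lat m. Lg a l)"

definition lie_torus_structure ::
    "('k::field \<Rightarrow> 'L::ab_group_add \<Rightarrow> 'L) \<Rightarrow> 'L set \<Rightarrow> ('L \<Rightarrow> 'L \<Rightarrow> 'L) \<Rightarrow>
     nat \<Rightarrow> (nat \<Rightarrow> real) set \<Rightarrow> nat \<Rightarrow> ((nat \<Rightarrow> real) \<Rightarrow> (nat \<Rightarrow> int) \<Rightarrow> 'L set) \<Rightarrow> bool" where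
  "lie_torus_structure sc C br d D m Lg \<longleftrightarrow>
     (let Q = zgen D in
      root_system0 d D \<and>
      direct_sum_decomp sc C (Q \<times> lat m) (\<lambda>(a, l). Lg a l) \<and>
      (\<forall>a\<in>Q. \<forall>b\<in>Q. \<forall>l\<in>lat m. \<forall>l'\<in>lat m. \<forall>x\<in>Lg a l. \<forall>y\<in>Lg b l'.
          br x y \<in> Lg (a + b) (l + l')) \<and>
      {a\<in>Q. \<exists>l\<in>lat m. Lg a l \<noteq> {0}} = D \<and>
      (\<forall>a\<in>D. a \<noteq> 0 \<and> indivisible_root D a \<longrightarrow> Lg a 0 \<noteq> {0}) \<and>
      (\<forall>a\<in>D - {0}. \<forall>l\<in>lat m. Lg a l \<noteq> {0} \<longrightarrow>
          (\<exists>e f. Lg a l = module.span sc {e} \<and> Lg (- a) (- l) = module.span sc {f} \<and>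
             (\<forall>b\<in>Q. \<forall>x\<in>root_space sc m Lg b.
                 br (br e f) x = sc (of_int (cartan_int d b a)) x))) \<and>
      lie_generated sc br (\<Union>a\<in>D - {0}. root_space sc m Lg a) = C \<and>
      zgen {l\<in>lat m. \<exists>a\<in>Q. Lg a l \<noteq> {0}} = lat m)"

definition assumption_C ::
    "('k::field \<Rightarrow> 'L::ab_group_add \<Rightarrow> 'L) \<Rightarrow> 'L set \<Rightarrow> ('L \<Rightarrow> 'L \<Rightarrow> 'L) \<Rightarrow> bool" where
  "assumption_C sc C br \<longleftrightarrow> lie_fgc sc C br \<and> lie_centreless C br \<and>
     (\<forall>d D m Lg d' D' m' Lg'.
        lie_torus_structure sc C br d D m Lg \<and> lie_torus_structure sc C br d' D' m' Lg' \<longrightarrow>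
        (\<exists>\<phi>. lie_hom_iso sc C br sc C br \<phi> \<and> \<phi> ` (Lg 0 0) = Lg' 0 0))"

definition matn :: "nat \<Rightarrow> (nat \<Rightarrow> nat \<Rightarrow> 'a::ring_1) set" where
  "matn r = {X. \<forall>i j. (r < i \<or> r < j) \<longrightarrow> X i j = 0}"

definition mat_mult :: "nat \<Rightarrow> (nat \<Rightarrow> nat \<Rightarrow> 'a::ring_1) \<Rightarrow> (nat \<Rightarrow> nat \<Rightarrow> 'a) \<Rightarrow> (nat \<Rightarrow> nat \<Rightarrow> 'a)" where
  "mat_mult r X Y = (\<lambda>i j. if i \<le> r \<and> j \<le> r then (\<Sum>l\<le>r. X i l * Y l j) else 0)"

definition mat_comm :: "nat \<Rightarrow> (nat \<Rightarrow> nat \<Rightarrow> 'a::ring_1) \<Rightarrow> (nat \<Rightarrow> nat \<Rightarrow> 'a) \<Rightarrow> (nat \<Rightarrow> nat \<Rightarrow> 'a)" where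
  "mat_comm r X Y = mat_mult r X Y - mat_mult r Y X"

definition mat_scale :: "('k \<Rightarrow> 'a \<Rightarrow> 'a) \<Rightarrow> 'k \<Rightarrow> (nat \<Rightarrow> nat \<Rightarrow> 'a) \<Rightarrow> (nat \<Rightarrow> nat \<Rightarrow> 'a)" where
  "mat_scale sc c X = (\<lambda>i j. sc c (X i j))"

definition sl_carrier :: "('k::field \<Rightarrow> 'a::ring_1 \<Rightarrow> 'a) \<Rightarrow> nat \<Rightarrow> (nat \<Rightarrow> nat \<Rightarrow> 'a) set" where
  "sl_carrier sc r = module.span (mat_scale sc) {mat_comm r X Y | X Y. X \<in> matn r \<and> Y \<in> matn r}"

end

theory Submission
  imports Defs "HOL-Library.Fun_Lexorder" "HOL-Computational_Algebra.Primes"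
begin

text \<open>Transport the Lie torus structure of \<open>sl(A)\<close> along the given isomorphism; by Assumption (C)
  for \<open>sl(A')\<close> the isomorphism can be corrected so that it matches the degree-zero Cartan
  subalgebras. It then maps a pair of opposite root spaces \<open>A e\<^sub>p\<^sub>q\<close>, \<open>A e\<^sub>q\<^sub>p\<close> onto such a pair
  \<open>A' e\<^sub>i\<^sub>j\<close>, \<open>A' e\<^sub>j\<^sub>i\<close>, and \<open>[[x e\<^sub>p\<^sub>q, y e\<^sub>q\<^sub>p], z e\<^sub>p\<^sub>q] = (x y z + z y x) e\<^sub>p\<^sub>q\<close> makes the two coordinate
  maps an isomorphism of Jordan pairs. As \<open>A'\<close> is a domain, dividing by the image of \<open>1\<close> gives an
  isomorphism or an anti-isomorphism \<open>A \<rightarrow> A'\<close>, for all \<open>r \<ge> 1\<close> at once. In the second case compose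
  with an anti-automorphism of \<open>A'\<close>: since \<open>A'\<close> is fgc, its commutation factors are powers
  \<open>\<zeta> powi w(l, m)\<close> of one root of unity with \<open>w\<close> an integral alternating form, and such a form has
  an isometry to its negative.\<close>

section \<open>Roots of unity in a field\<close>

text \<open>The alternative between isomorphism and anti-isomorphism cannot be avoided:
  \<open>X \<mapsto> - X^T\<close> identifies the special linear algebra over a torus with the one
  over its opposite, so the theorem includes that such a torus is isomorphic to its opposite. This
  is where finite generation over the centre enters. The commutation factors take values in a
  multiplicative group, where nothing is minimal; lifting their exponents to the integers gives a
  form with a least positive value, and division with remainder then splits off planes. The
  restriction to two opposite root spaces keeps \<open>r = 1\<close> in reach: without a third index
  there is no rule multiplying entries at \<open>(i, j)\<close> and \<open>(j, k)\<close>, only the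
  symmetric triple product. It forgets the order of the factors, and the absence of zero divisors
  recovers that order up to one global reversal. The coordinate map need not send 1 to 1:
  conjugation by a diagonal matrix with unit entries fixes the Cartan subalgebra and rescales the
  root spaces. Hence the normalisation by the image of 1, and hence two coordinate maps instead of
  one.\<close>

lemma root_of_unity_order:
  fixes z :: "'k::field"
  assumes "z ^ M = 1" "M > 0"
  shows "\<exists>N>0. \<forall>j. z ^ j = 1 \<longleftrightarrow> N dvd j"
proof -
  define N where "N = (LEAST k. k > 0 \<and> z ^ k = 1)"
  have N: "N > 0 \<and> z ^ N = 1"
    unfolding N_def by (rule LeastI[of "\<lambda>k. k > 0 \<and> z ^ k = 1" M]) (use assms in simp)
  have least: "N \<le> k" if "k > 0" "z ^ k = 1" for k
    unfolding N_def using that by (intro Least_le conjI)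
  have "N dvd j" if "z ^ j = 1" for j
  proof (rule ccontr)
    assume "\<not> N dvd j"
    then have pos: "j mod N > 0" by (simp add: dvd_eq_mod_eq_0)
    have "z ^ j = (z ^ N) ^ (j div N) * z ^ (j mod N)"
      by (simp flip: power_mult power_add)
    then have "z ^ (j mod N) = 1" using N that by simp
    then have "N \<le> j mod N" by (rule least[OF pos])
    moreover have "j mod N < N" using N by simp
    ultimately show False by simp
  qed
  moreover have "z ^ j = 1" if "N dvd j" for j
  proof -
    from that obtain i where "j = N * i" by (rule dvdE)
    then show ?thesis using N by (simp add: power_mult)
  qed
  ultimately show ?thesis using N by blast
qed

text \<open>Orders are expressed by divisibility (\<open>x ^ j = 1\<close> iff
  \<open>s dvd j\<close>). Raising to the power \<open>t\<close> removes \<open>y\<close>, so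
  \<open>s\<close> divides \<open>j * t\<close> and, by coprimality, \<open>j\<close>; the roles of
  \<open>x\<close> and \<open>y\<close> are then exchanged.\<close>

lemma order_mult_coprime:
  fixes x y :: "'k::field"
  assumes x: "\<And>j. x ^ j = 1 \<longleftrightarrow> s dvd j" and y: "\<And>j. y ^ j = 1 \<longleftrightarrow> t dvd j"
    and "coprime s t"
  shows "(x * y) ^ j = 1 \<longleftrightarrow> s * t dvd j"
proof
  assume "s * t dvd j"
  then have "s dvd j" "t dvd j" by (auto dest: dvd_mult_left dvd_mult_right)
  then have "x ^ j = 1" "y ^ j = 1" using x y by blast+
  then show "(x * y) ^ j = 1" by (simp add: power_mult_distrib)
next
  assume xy: "(x * y) ^ j = 1"
  have "x ^ (j * t) = 1"
  proof -
    have "1 = (x * y) ^ (j * t)" using xy by (simp add: power_mult)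
    also have "\<dots> = x ^ (j * t) * y ^ (j * t)" by (simp add: power_mult_distrib)
    also have "y ^ (j * t) = 1" using y by simp
    finally show ?thesis by simp
  qed
  then have "s dvd j" using x \<open>coprime s t\<close> by (simp add: coprime_dvd_mult_left_iff)
  have "y ^ (j * s) = 1"
  proof -
    have "1 = (x * y) ^ (j * s)" using xy by (simp add: power_mult)
    also have "\<dots> = x ^ (j * s) * y ^ (j * s)" by (simp add: power_mult_distrib)
    also have "x ^ (j * s) = 1" using x by simp
    finally show ?thesis by simp
  qed
  then have "t dvd j" using y \<open>coprime s t\<close>
    by (simp add: coprime_dvd_mult_left_iff coprime_commute)
  with \<open>s dvd j\<close> show "s * t dvd j" using \<open>coprime s t\<close> by (simp add: divides_mult)
qed

lemma order_power_divisor: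
  fixes x :: "'k::field"
  assumes "\<And>j. x ^ j = 1 \<longleftrightarrow> d * s dvd j" "d > 0"
  shows "(x ^ d) ^ j = 1 \<longleftrightarrow> s dvd j"
  using assms(2) assms(1)[of "d * j"] by (simp add: power_mult)

text \<open>Take \<zeta> of the greatest order \<open>N\<close> that occurs. The order of every
  other root divides \<open>N\<close>, since otherwise a product of suitable powers would have a
  greater order. So all roots are zeros of the polynomial \<open>X^N - 1\<close>, which has at most
  \<open>N\<close> of them, and the powers of \<zeta> already supply \<open>N\<close>. The value
  \<open>N\<close> may be smaller than \<open>M\<close>.\<close>

lemma roots_of_unity_cyclic:
  fixes M :: nat
  assumes "M > 0"
  shows "\<exists>\<zeta> :: 'k::field. \<zeta> ^ M = 1 \<and> (\<forall>z. z ^ M = 1 \<longrightarrow> (\<exists>j::nat. z = \<zeta> ^ j))"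
proof -
  define P where "P N \<longleftrightarrow> N > 0 \<and> (\<exists>z::'k. z ^ M = 1 \<and> (\<forall>j. z ^ j = 1 \<longleftrightarrow> N dvd j))" for N :: nat
  have le: "N \<le> M" if PN: "P N" for N
  proof -
    obtain z :: 'k where "z ^ M = 1" "\<forall>j. z ^ j = 1 \<longleftrightarrow> N dvd j"
      using PN unfolding P_def by blast
    then have "N dvd M" by blast
    then show ?thesis using assms by (rule dvd_imp_le)
  qed
  have "P 1" unfolding P_def by (rule conjI, simp, rule exI[of _ 1], simp)
  define N where "N = (GREATEST N. P N)"
  have PN: "P N" unfolding N_def using \<open>P 1\<close> le by (rule GreatestI_nat)
  have greatest: "N' \<le> N" if "P N'" for N'
    unfolding N_def using that le by (rule Greatest_le_nat)
  from PN obtain \<zeta> :: 'k where \<zeta>: "\<zeta> ^ M = 1" "\<And>j. \<zeta> ^ j = 1 \<longleftrightarrow> N dvd j" and "N > 0"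
    unfolding P_def by blast
  have all: "z ^ N = 1" if z: "z ^ M = 1" for z :: 'k
  proof -
    obtain t where t: "t > 0" "\<And>j. z ^ j = 1 \<longleftrightarrow> t dvd j"
      using root_of_unity_order[OF z assms] by blast
    have "t dvd N"
    proof (rule ccontr)
      assume "\<not> t dvd N"
      then obtain p where p: "prime p" "multiplicity p t > multiplicity p N"
        using multiplicity_le_imp_dvd[of t N] t(1) by (metis not_le neq0_conv)
      obtain N' where N': "N = p ^ multiplicity p N * N'" "\<not> p dvd N'"
        using multiplicity_decompose'[of N p] p(1) \<open>N > 0\<close>
        by (metis gr_implies_not0 not_prime_unit)
      obtain t' where t': "t = t' * p ^ multiplicity p t"
        using multiplicity_dvd[of p t] by (metis dvd_def mult.commute)
      have "t' > 0" using t' t(1) by (metis mult_is_0 neq0_conv)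
      have p0: "p ^ i > 0" for i using p(1) by (simp add: prime_gt_0_nat)
      \<comment> \<open>The power of \<zeta> keeps the part of \<open>N\<close> prime to
        \<open>p\<close>, the power of \<open>z\<close> keeps the \<open>p\<close>-part of its
        order. These are coprime, and their product exceeds \<open>N\<close> because
        \<open>p\<close> occurs more often in \<open>t\<close> than in \<open>N\<close>.\<close>
      have o1: "(\<zeta> ^ (p ^ multiplicity p N)) ^ j = 1 \<longleftrightarrow> N' dvd j" for j
        by (rule order_power_divisor) (subst N'(1)[symmetric], rule \<zeta>(2), rule p0)
      have o2: "(z ^ t') ^ j = 1 \<longleftrightarrow> p ^ multiplicity p t dvd j" for j
        by (rule order_power_divisor) (subst t'[symmetric], rule t(2), rule \<open>t' > 0\<close>)
      have "coprime N' (p ^ multiplicity p t)"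
        using p(1) N'(2) by (metis coprime_commute coprime_power_right_iff prime_imp_coprime)
      from order_mult_coprime[OF o1 o2 this]
      have "P (N' * p ^ multiplicity p t)"
        unfolding P_def
      proof (intro conjI exI[of _ "\<zeta> ^ (p ^ multiplicity p N) * z ^ t'"] allI)
        show "0 < N' * p ^ multiplicity p t" using N'(2) p0 by (cases N') auto
        have "(\<zeta> ^ (p ^ multiplicity p N)) ^ M = (\<zeta> ^ M) ^ (p ^ multiplicity p N)"
          by (simp only: mult.commute flip: power_mult)
        moreover have "(z ^ t') ^ M = (z ^ M) ^ t'"
          by (simp only: mult.commute flip: power_mult)
        ultimately show "(\<zeta> ^ (p ^ multiplicity p N) * z ^ t') ^ M = 1"
          using \<zeta>(1) z by (simp only: power_mult_distrib power_one mult_1_left)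
      qed
      then have "N' * p ^ multiplicity p t \<le> N" by (rule greatest)
      moreover have "N < N' * p ^ multiplicity p t"
      proof -
        have "p ^ multiplicity p N < p ^ multiplicity p t"
          using p by (intro power_strict_increasing) (use prime_gt_1_nat in auto)
        moreover have "N' > 0" using N'(2) by (cases N') auto
        ultimately have "p ^ multiplicity p N * N' < N' * p ^ multiplicity p t"
          by simp
        then show ?thesis using N'(1) by linarith
      qed
      ultimately show False by simp
    qed
    then show ?thesis using t(2) by blast
  qed
  define p :: "'k poly" where "p = monom 1 N - 1"
  have pz: "poly p z = z ^ N - 1" for z by (simp add: p_def poly_monom)
  have "coeff p N = 1" using \<open>N > 0\<close> by (simp add: p_def)
  then have "p \<noteq> 0" by auto
  have "degree p \<le> N" unfolding p_def by (rule degree_diff_le) (auto simp: degree_monom_le)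
  then have card: "card {z. z ^ N = (1::'k)} \<le> N"
    using card_poly_roots_bound[OF \<open>p \<noteq> 0\<close>] by (simp add: pz)
  have fin: "finite {z. z ^ N = (1::'k)}"
    using poly_roots_finite[OF \<open>p \<noteq> 0\<close>] by (simp add: pz)
  have inj: "inj_on ((^) \<zeta>) {..<N}"
  proof (rule linorder_inj_onI)
    fix i j assume ij: "i < j" "i \<in> {..<N}" "j \<in> {..<N}"
    have "\<zeta> \<noteq> 0" using \<zeta>(1) assms by (metis not_gr0 power_0_left zero_neq_one)
    have "\<zeta> ^ j = \<zeta> ^ i * \<zeta> ^ (j - i)" using ij by (simp flip: power_add)
    moreover have "\<zeta> ^ (j - i) \<noteq> 1" using \<zeta>(2) ij by (auto dest: dvd_imp_le)
    ultimately show "\<zeta> ^ i \<noteq> \<zeta> ^ j" using \<open>\<zeta> \<noteq> 0\<close> by auto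
  qed auto
  have "(^) \<zeta> ` {..<N} = {z. z ^ N = 1}"
  proof (rule card_subset_eq[OF fin])
    show sub: "(^) \<zeta> ` {..<N} \<subseteq> {z. z ^ N = 1}"
    proof clarify
      fix j
      have "(\<zeta> ^ j) ^ N = \<zeta> ^ (j * N)" by (rule power_mult[symmetric])
      then show "(\<zeta> ^ j) ^ N = 1" using \<zeta>(2)[of "j * N"] by simp
    qed
    have "card ((^) \<zeta> ` {..<N}) = N" by (simp add: card_image[OF inj])
    then have "card {z. z ^ N = (1::'k)} \<le> card ((^) \<zeta> ` {..<N})"
      by (rule ssubst) (rule card)
    then show "card ((^) \<zeta> ` {..<N}) = card {z. z ^ N = (1::'k)}"
      by (rule le_antisym[OF card_mono[OF fin sub]])
  qed
  then have "z \<in> (^) \<zeta> ` {..<N}" if "z ^ M = 1" for z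
    using all[OF that] by simp
  then have "\<forall>z. z ^ M = 1 \<longrightarrow> (\<exists>j::nat. z = \<zeta> ^ j)" by blast
  with \<zeta>(1) show ?thesis by (intro exI conjI)
qed

section \<open>Alternating forms on lattices\<close>

definition zscale :: "int \<Rightarrow> (nat \<Rightarrow> int) \<Rightarrow> nat \<Rightarrow> int" where
  "zscale a x = (\<lambda>i. a * x i)"

lemma zscale_apply: "zscale a x i = a * x i"
  by (simp add: zscale_def)

text \<open>Split off the plane spanned by \<open>e\<close>, \<open>f\<close> with \<open>w e f\<close> positive and minimal, on which the
  isometry is \<open>e \<mapsto> - e\<close>, \<open>f \<mapsto> f\<close>. The measure is \<open>2 ^ rank H\<close>, counted as the image of \<open>H\<close>
  modulo 2; purity of \<open>H\<close> makes it drop.\<close>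

lemma alternating_anti_isometry:
  fixes H :: "(nat \<Rightarrow> int) set" and w :: "(nat \<Rightarrow> int) \<Rightarrow> (nat \<Rightarrow> int) \<Rightarrow> int"
  assumes w_add: "\<And>x y z. w (x + y) z = w x z + w y z"
    and w_scale: "\<And>a x y. w (zscale a x) y = a * w x y"
    and w_alt: "\<And>x y. w x y = - w y x"
    and "H \<subseteq> lat n" "0 \<in> H"
    and "\<And>x y. x \<in> H \<Longrightarrow> y \<in> H \<Longrightarrow> x + y \<in> H"
    and "\<And>a x. x \<in> H \<Longrightarrow> zscale a x \<in> H"
    and "\<And>x. x + x \<in> H \<Longrightarrow> x \<in> H"
  shows "\<exists>\<sigma>. bij_betw \<sigma> H H \<and> (\<forall>x\<in>H. \<forall>y\<in>H. \<sigma> (x + y) = \<sigma> x + \<sigma> y) \<and>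
           (\<forall>x\<in>H. \<forall>y\<in>H. w (\<sigma> x) (\<sigma> y) = - w x y)"
  using assms(4-8)
proof (induction "card ((\<lambda>x. {i. odd (x i)}) ` H)" arbitrary: H rule: less_induct)
  case less
  note H0 = \<open>0 \<in> H\<close> and Hadd = less.prems(3) and Hsc = less.prems(4) and pure = less.prems(5)
  let ?par = "\<lambda>x :: nat \<Rightarrow> int. {i. odd (x i)}"
  have w_add2: "w z (x + y) = w z x + w z y" for x y z
    using w_alt[of z] w_add[of x y z] by simp
  have w_scale2: "w y (zscale a x) = a * w y x" for a x y
    using w_alt[of y] w_scale[of a x y] by simp
  have w_self: "w x x = 0" for x
    using w_alt[of x x] by simp
  note w_simps = w_add w_add2 w_scale w_scale2 w_self
  show ?case
  proof (cases "\<forall>x\<in>H. \<forall>y\<in>H. w x y = 0")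
    case True
    then show ?thesis by (intro exI[of _ id]) (auto intro: bij_betw_id)
  next
    case False
    define P where "P k \<longleftrightarrow> k > 0 \<and> (\<exists>x\<in>H. \<exists>y\<in>H. w x y = int k)" for k
    define d where "d = (LEAST k. P k)"
    have exP: "\<exists>k. P k"
    proof -
      from False obtain x y where xy: "x \<in> H" "y \<in> H" "w x y \<noteq> 0" by blast
      show ?thesis
      proof (cases "w x y > 0")
        case True
        then have "P (nat (w x y))" unfolding P_def using xy by auto
        then show ?thesis by blast
      next
        case False
        then have "w y x > 0" using xy w_alt[of x y] by simp
        then have "P (nat (w y x))" unfolding P_def using xy by auto
        then show ?thesis by blast
      qed
    qed
    then have "P d" unfolding d_def by (rule LeastI_ex)
    then obtain e f where ef: "e \<in> H" "f \<in> H" "w e f = int d" and d0: "d > 0"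
      unfolding P_def by blast
    have least: "d \<le> k" if "P k" for k
      unfolding d_def using that by (rule Least_le)
    have minimal: "\<not> (0 < w x y \<and> w x y < int d)" if "x \<in> H" "y \<in> H" for x y
    proof
      assume a: "0 < w x y \<and> w x y < int d"
      then have "P (nat (w x y))" unfolding P_def using that by auto
      from least[OF this] a show False by (simp add: le_nat_iff)
    qed
    have fe: "w f e = - int d" using w_alt[of f e] ef by simp
    \<comment> \<open>The coordinates along \<open>e\<close> and \<open>f\<close>. The divisions are
      exact on \<open>H\<close>: subtracting a multiple of \<open>e\<close> turns
      \<open>w y f\<close> into its remainder modulo \<open>d\<close>, which by minimality cannot
      lie strictly between 0 and \<open>d\<close>.\<close>
    define A where "A y = w y f div int d" for y
    define B where "B y = w e y div int d" for y
    have A: "w y f = int d * A y" if y: "y \<in> H" for y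
    proof -
      have "w (y + zscale (- A y) e) f = w y f mod int d"
        by (simp add: w_simps ef A_def minus_div_mult_eq_mod mult.commute flip: minus_mod_eq_mult_div)
      moreover have "y + zscale (- A y) e \<in> H" using y ef Hadd Hsc by blast
      ultimately have "\<not> (0 < w y f mod int d \<and> w y f mod int d < int d)"
        using minimal[of "y + zscale (- A y) e" f] ef by simp
      then have "w y f mod int d = 0" using d0
        by (metis of_nat_0_less_iff pos_mod_bound pos_mod_sign order_le_less)
      then show ?thesis using mult_div_mod_eq[of "int d" "w y f"] by (simp add: A_def)
    qed
    have B: "w e y = int d * B y" if y: "y \<in> H" for y
    proof -
      have "w e (y + zscale (- B y) f) = w e y mod int d"
        by (simp add: w_simps ef B_def minus_div_mult_eq_mod mult.commute flip: minus_mod_eq_mult_div)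
      moreover have "y + zscale (- B y) f \<in> H" using y ef Hadd Hsc by blast
      ultimately have "\<not> (0 < w e y mod int d \<and> w e y mod int d < int d)"
        using minimal[of e "y + zscale (- B y) f"] ef by simp
      then have "w e y mod int d = 0" using d0
        by (metis of_nat_0_less_iff pos_mod_bound pos_mod_sign order_le_less)
      then show ?thesis using mult_div_mod_eq[of "int d" "w e y"] by (simp add: B_def)
    qed
    \<comment> \<open>\<open>R\<close> projects onto the orthogonal complement \<open>K\<close> of
      the plane, and \<open>mk\<close> reassembles an element from its parts, so \<open>H\<close> is
      the direct sum of the multiples of \<open>e\<close>, those of \<open>f\<close>, and
      \<open>K\<close>.\<close>
    define R where "R y = y + (zscale (- A y) e + zscale (- B y) f)" for y
    define K where "K = {y \<in> H. w e y = 0 \<and> w y f = 0}"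
    define mk where "mk a b h = zscale a e + (zscale b f + h)" for a b h
    have RK: "R y \<in> K" if "y \<in> H" for y
      unfolding K_def R_def using that ef Hadd Hsc A[OF that] B[OF that]
      by (simp add: w_simps)
    have dec: "y = mk (A y) (B y) (R y)" for y
      by (rule ext) (simp add: zscale_apply R_def mk_def)
    have mkH: "mk a b h \<in> H" and mkA: "A (mk a b h) = a" and mkB: "B (mk a b h) = b"
      and mkR: "R (mk a b h) = h" if "h \<in> K" for a b h
    proof -
      from that have h: "h \<in> H" "w e h = 0" "w h f = 0" by (auto simp: K_def)
      show "mk a b h \<in> H" unfolding mk_def by (intro Hadd Hsc ef h)
      show 1: "A (mk a b h) = a" unfolding A_def mk_def using h ef d0 by (simp add: w_simps)
      show 2: "B (mk a b h) = b" unfolding B_def mk_def using h ef d0 by (simp add: w_simps)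
      show "R (mk a b h) = h" unfolding R_def 1 2 by (rule ext) (simp add: zscale_apply mk_def)
    qed
    have wmk: "w (mk a b h) (mk a' b' h') = (a * b' - b * a') * int d + w h h'"
      if "h \<in> K" "h' \<in> K" for a b h a' b' h'
    proof -
      from that have "w e h = 0" "w h f = 0" "w e h' = 0" "w h' f = 0" by (auto simp: K_def)
      then show ?thesis using w_alt[of h e] w_alt[of f h']
        by (simp add: mk_def w_simps ef fe algebra_simps)
    qed
    have mkadd: "mk a b h + mk a' b' h' = mk (a + a') (b + b') (h + h')" for a b h a' b' h'
      by (rule ext) (simp add: zscale_apply mk_def algebra_simps)
    have KH: "K \<subseteq> H" by (auto simp: K_def)
    have Kadd: "x + y \<in> K" if "x \<in> K" "y \<in> K" for x y
      using that Hadd by (auto simp: K_def w_simps)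
    have "i < n" if "x \<in> H" "odd (x i)" for x i
    proof (rule ccontr)
      assume "\<not> i < n"
      then have "x i = 0" using that(1) less.prems(1) by (auto simp: lat_def)
      with that(2) show False by simp
    qed
    then have fin: "finite (?par ` H)"
      by (intro finite_subset[of "?par ` H" "Pow {..<n}"]) auto
    \<comment> \<open>If \<open>e\<close> had the parities of some \<open>h\<close> in
      \<open>K\<close>, purity would put half of \<open>e - h\<close> into \<open>H\<close>, and
      pairing this half with \<open>f\<close> gives \<open>d / 2\<close>, against the minimality of
      \<open>d\<close>.\<close>
    have "?par e \<notin> ?par ` K"
    proof
      assume "?par e \<in> ?par ` K"
      then obtain h where h: "h \<in> K" "?par e = ?par h" by blast
      define l where "l i = (e i - h i) div 2" for i
      have "even (e i - h i)" for i using h(2) by (auto simp: set_eq_iff)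
      then have ll: "l + l = e + zscale (- 1) h"
        by (intro ext) (simp add: zscale_apply l_def)
      have "l \<in> H" by (rule pure) (use ll h KH ef Hadd Hsc in auto)
      have "2 * w l f = w (l + l) f" unfolding w_add by simp
      also have "\<dots> = int d" unfolding ll using h ef by (simp add: w_simps K_def)
      finally have "0 < w l f \<and> w l f < int d" using d0 by linarith
      with minimal[OF \<open>l \<in> H\<close> ef(2)] show False by blast
    qed
    then have "?par ` K \<subset> ?par ` H" using KH ef(1) by blast
    then have "card (?par ` K) < card (?par ` H)" by (rule psubset_card_mono[OF fin])
    from less.hyps[OF this]
    obtain \<tau> where \<tau>: "bij_betw \<tau> K K" "\<And>x y. x \<in> K \<Longrightarrow> y \<in> K \<Longrightarrow> \<tau> (x + y) = \<tau> x + \<tau> y"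
      "\<And>x y. x \<in> K \<Longrightarrow> y \<in> K \<Longrightarrow> w (\<tau> x) (\<tau> y) = - w x y"
    proof -
      have "K \<subseteq> lat n" using KH less.prems(1) by blast
      moreover have "0 \<in> K" using H0 w_add2[of e 0 0] w_add[of 0 0 f] by (auto simp: K_def)
      moreover have "zscale a x \<in> K" if "x \<in> K" for a x
        using that Hsc by (auto simp: K_def w_simps)
      moreover have "x \<in> K" if "x + x \<in> K" for x
        using that pure w_add2[of e x x] w_add[of x x f] by (auto simp: K_def)
      ultimately have "\<exists>\<sigma>. bij_betw \<sigma> K K \<and> (\<forall>x\<in>K. \<forall>y\<in>K. \<sigma> (x + y) = \<sigma> x + \<sigma> y) \<and>
           (\<forall>x\<in>K. \<forall>y\<in>K. w (\<sigma> x) (\<sigma> y) = - w x y)"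
        by (intro less.hyps[OF \<open>card (?par ` K) < card (?par ` H)\<close>] Kadd)
      then show thesis using that by blast
    qed
    have \<tau>K: "\<tau> x \<in> K" if "x \<in> K" for x using \<tau>(1) that by (rule bij_betw_apply)
    define \<sigma> where "\<sigma> y = mk (- A y) (B y) (\<tau> (R y))" for y
    have add: "A (x + y) = A x + A y \<and> B (x + y) = B x + B y \<and> R (x + y) = R x + R y"
      if "x \<in> H" "y \<in> H" for x y
    proof -
      have "x + y = mk (A x + A y) (B x + B y) (R x + R y)"
        by (rule trans[OF arg_cong2[where f = "(+)", OF dec dec] mkadd])
      then show ?thesis using mkA mkB mkR Kadd RK that by metis
    qed
    have "bij_betw \<sigma> H H"
    proof (rule bij_betw_byWitness[where f' = "\<lambda>y. mk (- A y) (B y) (inv_into K \<tau> (R y))"])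
      have inv: "inv_into K \<tau> x \<in> K" "\<tau> (inv_into K \<tau> x) = x" if "x \<in> K" for x
        using \<tau>(1) that by (auto simp: bij_betw_def inv_into_into f_inv_into_f)
      have inv': "inv_into K \<tau> (\<tau> x) = x" if "x \<in> K" for x
        using \<tau>(1) that by (auto simp: bij_betw_def)
      show "\<forall>a\<in>H. mk (- A (\<sigma> a)) (B (\<sigma> a)) (inv_into K \<tau> (R (\<sigma> a))) = a"
        unfolding \<sigma>_def using RK \<tau>K by (auto simp: mkA mkB mkR inv' simp flip: dec)
      show "\<forall>a'\<in>H. \<sigma> (mk (- A a') (B a') (inv_into K \<tau> (R a'))) = a'"
        unfolding \<sigma>_def using RK inv by (auto simp: mkA mkB mkR simp flip: dec)
      show "\<sigma> ` H \<subseteq> H" unfolding \<sigma>_def using RK \<tau>K mkH by blast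
      show "(\<lambda>y. mk (- A y) (B y) (inv_into K \<tau> (R y))) ` H \<subseteq> H"
        using RK inv mkH by blast
    qed
    moreover have "\<sigma> (x + y) = \<sigma> x + \<sigma> y" if "x \<in> H" "y \<in> H" for x y
      unfolding \<sigma>_def mkadd using add[OF that] \<tau>(2)[OF RK RK, OF that] by simp
    moreover have "w (\<sigma> x) (\<sigma> y) = - w x y" if "x \<in> H" "y \<in> H" for x y
    proof -
      have "w (\<sigma> x) (\<sigma> y) = (- A x * B y + B x * A y) * int d - w (R x) (R y)"
        unfolding \<sigma>_def using wmk \<tau>K \<tau>(3) RK that by simp
      moreover have "w x y = (A x * B y - B x * A y) * int d + w (R x) (R y)"
        using wmk[OF RK RK, OF that] dec by metis
      ultimately show ?thesis by (simp add: algebra_simps)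
    qed
    ultimately show ?thesis by blast
  qed
qed

section \<open>Unit vectors, multiplicative maps and the lexicographic order on the lattice\<close>

definition unit_vec :: "nat \<Rightarrow> nat \<Rightarrow> int" where
  "unit_vec i = (\<lambda>j. if j = i then 1 else 0)"

lemma lat_add [intro]: "x \<in> lat n \<Longrightarrow> y \<in> lat n \<Longrightarrow> x + y \<in> lat n"
  by (simp add: lat_def)

lemma lat_diff [intro]: "x \<in> lat n \<Longrightarrow> y \<in> lat n \<Longrightarrow> x - y \<in> lat n"
  by (simp add: lat_def)

lemma lat_uminus [intro]: "x \<in> lat n \<Longrightarrow> - x \<in> lat n"
  by (simp add: lat_def)

lemma lat_zero [simp, intro]: "0 \<in> lat n"
  by (simp add: lat_def)

lemma lat_zscale [intro]: "x \<in> lat n \<Longrightarrow> zscale a x \<in> lat n"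
  by (simp add: lat_def zscale_apply)

lemma lat_unit_vec [intro]: "i < n \<Longrightarrow> unit_vec i \<in> lat n"
  by (simp add: lat_def unit_vec_def)

lemma lat_mono: "k \<le> n \<Longrightarrow> lat k \<subseteq> lat n"
  by (auto simp: lat_def)

lemma lat_Suc_decomp:
  assumes "x \<in> lat (Suc k)"
  obtains y where "y \<in> lat k" "\<And>i. i < k \<Longrightarrow> y i = x i" "x = y + zscale (x k) (unit_vec k)"
proof
  show "x(k := 0) \<in> lat k"
    unfolding lat_def
  proof (clarify, goal_cases)
    case (1 i)
    then show ?case using assms by (cases "i = k") (auto simp: lat_def)
  qed
  show "x = x(k := 0) + zscale (x k) (unit_vec k)"
    by (rule ext) (simp add: unit_vec_def zscale_apply)
qed simp

lemma zscale_simps [simp]: "zscale 0 x = 0" "zscale 1 x = x" "zscale a 0 = 0"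
  by (rule ext, simp add: zscale_apply)+

lemma zscale_add: "zscale (a + b) x = zscale a x + zscale b x"
  by (rule ext) (simp add: zscale_apply algebra_simps)

lemma multiplicative_int_power:
  fixes f :: "(nat \<Rightarrow> int) \<Rightarrow> 'k::field"
  assumes mult: "\<And>x y. x \<in> lat n \<Longrightarrow> y \<in> lat n \<Longrightarrow> f (x + y) = f x * f y"
    and nz: "\<And>x. x \<in> lat n \<Longrightarrow> f x \<noteq> 0" and x: "x \<in> lat n"
  shows "f (zscale a x) = f x powi a"
proof (induction a rule: int_induct[where k = 0])
  case base
  have "f 0 * f 0 = f 0 * 1" using mult[of 0 0] by simp
  then have "f 0 = 1" using nz[of 0] by (metis lat_zero mult_left_cancel)
  then show ?case by (simp only: zscale_simps power_int_0_right)
next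
  case (step1 i)
  have "f (zscale (i + 1) x) = f (zscale i x) * f x"
    using mult[of "zscale i x" x] x by (simp only: zscale_add zscale_simps lat_zscale)
  then show ?case using step1 nz[OF x] by (simp add: power_int_add)
next
  case (step2 i)
  have "f (zscale (i - 1) x) * f x = f (zscale (i - 1) x + x)"
    using mult[of "zscale (i - 1) x" x] x by (simp add: lat_zscale)
  also have "zscale (i - 1) x + x = zscale i x" by (rule ext) (simp add: zscale_apply algebra_simps)
  finally have "f (zscale (i - 1) x) * f x = f x powi (i - 1) * f x"
    using step2 nz[OF x] by (simp add: power_int_diff field_simps)
  then show ?case using nz[OF x] by simp
qed

text \<open>Two such maps that agree on the unit vectors agree everywhere. In
  \<open>q_integer_form\<close> this compares the commutation factors with powers of \<zeta> in one
  argument at a time. The parameter \<open>k\<close> carries the induction over the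
  coordinates.\<close>

lemma multiplicative_expand:
  fixes f :: "(nat \<Rightarrow> int) \<Rightarrow> 'k::field"
  assumes mult: "\<And>x y. x \<in> lat n \<Longrightarrow> y \<in> lat n \<Longrightarrow> f (x + y) = f x * f y"
    and nz: "\<And>x. x \<in> lat n \<Longrightarrow> f x \<noteq> 0"
  shows "k \<le> n \<Longrightarrow> x \<in> lat k \<Longrightarrow> f x = (\<Prod>i<k. f (unit_vec i) powi x i)"
proof (induction k arbitrary: x)
  case 0
  then have "x = 0" by (auto simp: lat_def)
  have "f (zscale 0 0) = f 0 powi 0"
    by (rule multiplicative_int_power[of n f]) (use mult nz in auto)
  then show ?case by (simp only: \<open>x = 0\<close> zscale_simps power_int_0_right lessThan_0 prod.empty)
next
  case (Suc k)
  obtain y where y: "y \<in> lat k" "\<And>i. i < k \<Longrightarrow> y i = x i" "x = y + zscale (x k) (unit_vec k)"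
    using lat_Suc_decomp[OF Suc.prems(2)] by blast
  have k: "unit_vec k \<in> lat n" using Suc.prems(1) by (intro lat_unit_vec) simp
  have y0: "y \<in> lat n" using y(1) lat_mono[of k n] Suc.prems(1) by auto
  have "f x = f y * f (zscale (x k) (unit_vec k))"
    by (subst y(3)) (rule mult[OF y0 lat_zscale[OF k]])
  also have "f y = (\<Prod>i<k. f (unit_vec i) powi y i)"
    using Suc.IH[OF _ y(1)] Suc.prems(1) by simp
  also have "\<dots> = (\<Prod>i<k. f (unit_vec i) powi x i)" by (rule prod.cong) (auto simp: y(2))
  also have "f (zscale (x k) (unit_vec k)) = f (unit_vec k) powi x k"
    by (rule multiplicative_int_power[of n f]) (use mult nz k in auto)
  finally show ?case by simp
qed

text \<open>Arbitrary functions need not be comparable under \<open>less_fun\<close>, but two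
  members of \<open>lat n\<close> differ in finitely many places only, and there trichotomy
  holds.\<close>

lemma ex_less_fun_max:
  fixes S :: "(nat \<Rightarrow> int) set"
  assumes "finite S" "S \<noteq> {}" "S \<subseteq> lat n"
  shows "\<exists>m\<in>S. \<forall>l\<in>S. l = m \<or> less_fun l m"
  using assms
proof (induction rule: finite_ne_induct)
  case (singleton x)
  then show ?case by simp
next
  case (insert x F)
  then obtain m where m: "m \<in> F" "\<forall>l\<in>F. l = m \<or> less_fun l m" by auto
  have "{i. x i \<noteq> m i} \<subseteq> {..<n}"
    using insert.prems m(1) by (fastforce simp: lat_def not_less[symmetric])
  then have "less_fun x m \<or> x = m \<or> less_fun m x"
    by (intro less_fun_trichotomy) (rule finite_subset, auto)
  then show ?case
  proof (elim disjE)
    assume "less_fun m x"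
    have "l = x \<or> less_fun l x" if "l \<in> insert x F" for l
      using that m(2) \<open>less_fun m x\<close> less_fun_trans[of l m x] by (metis insert_iff)
    then show ?thesis by blast
  qed (use m in auto)
qed

lemma less_fun_add:
  fixes a b c d :: "nat \<Rightarrow> int"
  shows "less_fun a b \<Longrightarrow> less_fun (a + c) (b + c)"
  by (auto simp: less_fun_def)

section \<open>Coordinates and commutation factors of associative tori\<close>

text \<open>One unit chosen in each degree turns the grading into a basis. Outside
  \<open>lat n\<close> the values of \<open>u\<close> are unconstrained. The scalar in
  \<open>u_mult_ex\<close> stays existential here and is read off as a coordinate once coordinates
  exist.\<close>

locale torus_basis = vector_space sc for sc :: "'k::field \<Rightarrow> 'a::ring_1 \<Rightarrow> 'a" +
  fixes n :: nat and u :: "(nat \<Rightarrow> int) \<Rightarrow> 'a"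
  assumes scale_mult_left: "sc c (x * y) = sc c x * y"
    and scale_mult_right: "sc c (x * y) = x * sc c y"
    and u_invertible: "l \<in> lat n \<Longrightarrow> invertible_elt (u l)"
    and u_mult_ex: "l \<in> lat n \<Longrightarrow> m \<in> lat n \<Longrightarrow> \<exists>c. u l * u m = sc c (u (l + m))"
    and u_inj: "inj_on u (lat n)"
    and u_independent: "independent (u ` lat n)"
    and u_span: "span (u ` lat n) = UNIV"

lemma assoc_torus_has_basis:
  assumes "assoc_torus sc n"
  shows "\<exists>u. torus_basis sc n u"
proof -
  from assms obtain G where alg: "k_algebra sc" and G: "assoc_torus_grading sc n G"
    unfolding assoc_torus_def by blast
  interpret vector_space sc using alg unfolding k_algebra_def by blast
  obtain u where u: "\<And>l. l \<in> lat n \<Longrightarrow> invertible_elt (u l) \<and> G l = span {u l}"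
    using G unfolding assoc_torus_grading_def by metis
  have Gmult: "\<And>l m x y. l \<in> lat n \<Longrightarrow> m \<in> lat n \<Longrightarrow> x \<in> G l \<Longrightarrow> y \<in> G m \<Longrightarrow> x * y \<in> G (l + m)"
    and Gex: "\<And>x. \<exists>S c. finite S \<and> S \<subseteq> lat n \<and> (\<forall>i\<in>S. c i \<in> G i) \<and> x = sum c S"
    and Gun: "\<And>S c. finite S \<Longrightarrow> S \<subseteq> lat n \<Longrightarrow> (\<forall>i\<in>S. c i \<in> G i) \<Longrightarrow> sum c S = 0 \<Longrightarrow> \<forall>i\<in>S. c i = 0"
    using G unfolding assoc_torus_grading_def direct_sum_decomp_def by blast+
  have uG: "sc c (u l) \<in> G l" if "l \<in> lat n" for l c
    using u[OF that] by (auto simp: span_singleton)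
  have unz: "u l \<noteq> 0" if "l \<in> lat n" for l
    using u[OF that] by (auto simp: invertible_elt_def)
  have inj: "inj_on u (lat n)"
  proof (rule inj_onI, rule ccontr)
    fix l m assume lm: "l \<in> lat n" "m \<in> lat n" "u l = u m" "l \<noteq> m"
    \<comment> \<open>If \<open>u l = u m\<close>, then \<open>u l - u m\<close> is a vanishing sum
      of nonzero components in two different degrees.\<close>
    define c where "c i = (if i = l then sc 1 (u l) else sc (-1) (u m))" for i
    have "c i \<in> G i" if "i \<in> {l, m}" for i
      using that lm uG[of l 1] uG[of m "- 1"] by (auto simp: c_def)
    moreover have "sum c {l, m} = 0" using lm by (simp add: c_def)
    ultimately have "\<forall>i\<in>{l, m}. c i = 0" using lm by (intro Gun) auto
    then show False using unz[OF lm(1)] by (auto simp: c_def)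
  qed
  show ?thesis
  proof (intro exI[of _ u], unfold_locales)
    fix c x y
    show "sc c (x * y) = sc c x * y" "sc c (x * y) = x * sc c y"
      using alg unfolding k_algebra_def by blast+
  next
    fix l assume "l \<in> lat n"
    then show "invertible_elt (u l)" using u by blast
  next
    fix l m assume lm: "l \<in> lat n" "m \<in> lat n"
    then have "u l * u m \<in> G (l + m)" using Gmult uG[of _ 1] by simp
    then show "\<exists>c. u l * u m = sc c (u (l + m))"
      using u[OF lat_add[OF lm]] by (auto simp: span_singleton)
  next
    show "inj_on u (lat n)" by (rule inj)
  next
    show "independent (u ` lat n)"
      unfolding independent_explicit_module
    proof (intro allI impI)
      fix t f v assume t: "finite t" "t \<subseteq> u ` lat n" "(\<Sum>v\<in>t. sc (f v) v) = 0" "v \<in> t"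
      define S where "S = {l \<in> lat n. u l \<in> t}"
      have "u ` S = t" using t by (auto simp: S_def)
      have injS: "inj_on u S" using inj by (rule inj_on_subset) (auto simp: S_def)
      have "finite S" using injS t(1) \<open>u ` S = t\<close> finite_imageD by blast
      have "(\<Sum>l\<in>S. sc (f (u l)) (u l)) = 0"
        using t(3) sum.reindex[OF injS, of "\<lambda>v. sc (f v) v"] \<open>u ` S = t\<close> by simp
      then have "\<forall>i\<in>S. sc (f (u i)) (u i) = 0"
        by (intro Gun[OF \<open>finite S\<close>]) (use uG in \<open>auto simp: S_def\<close>)
      moreover obtain l where "l \<in> S" "v = u l" using t(4) \<open>u ` S = t\<close> by blast
      ultimately show "f v = 0" using unz by (auto simp: S_def)
    qed
  next
    have "x \<in> span (u ` lat n)" for x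
    proof -
      obtain S c where S: "finite S" "S \<subseteq> lat n" "\<forall>i\<in>S. c i \<in> G i" "x = sum c S"
        using Gex[of x] by fast
      have "c i \<in> span (u ` lat n)" if "i \<in> S" for i
      proof -
        have "c i \<in> span {u i}" using S that u by blast
        then show ?thesis using span_mono[of "{u i}" "u ` lat n"] S that by blast
      qed
      then show ?thesis unfolding S(4) by (rule span_sum)
    qed
    then show "span (u ` lat n) = UNIV" by blast
  qed
qed

context torus_basis
begin

text \<open>The value 0 off the lattice, where \<open>u\<close> is arbitrary, makes
  \<open>supp x\<close> a finite subset of \<open>lat n\<close>.\<close>

definition co :: "'a \<Rightarrow> (nat \<Rightarrow> int) \<Rightarrow> 'k" where
  "co x l = (if l \<in> lat n then representation (u ` lat n) x (u l) else 0)"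

abbreviation supp :: "'a \<Rightarrow> (nat \<Rightarrow> int) set" where
  "supp x \<equiv> {l. co x l \<noteq> 0}"

lemma u_nonzero: "l \<in> lat n \<Longrightarrow> u l \<noteq> 0"
  using u_invertible[of l] unfolding invertible_elt_def by (metis mult_zero_left zero_neq_one)

lemma co_add: "co (x + y) l = co x l + co y l"
  by (simp add: co_def representation_add u_independent u_span)

lemma co_scale: "co (sc c x) l = c * co x l"
  by (simp add: co_def representation_scale u_independent u_span)

lemma co_zero [simp]: "co 0 l = 0"
  by (simp add: co_def representation_zero)

lemma co_sum: "co (sum f S) l = (\<Sum>i\<in>S. co (f i) l)"
  by (induction S rule: infinite_finite_induct) (auto simp: co_add)

lemma co_u: "m \<in> lat n \<Longrightarrow> co (u m) l = (if l = m then 1 else 0)"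
  using u_inj by (auto simp: co_def representation_basis u_independent inj_on_def)

lemma supp_lat: "supp x \<subseteq> lat n"
  by (auto simp: co_def split: if_splits)

lemma finite_supp [simp]: "finite (supp x)"
proof (rule finite_imageD)
  show "finite (u ` supp x)"
    by (rule finite_subset[OF _ finite_representation[of "u ` lat n" x]])
       (auto simp: co_def split: if_splits)
  show "inj_on u (supp x)" using u_inj supp_lat by (rule inj_on_subset)
qed

lemma expand: "x = (\<Sum>l\<in>supp x. sc (co x l) (u l))"
proof -
  have "u ` supp x = {b. representation (u ` lat n) x b \<noteq> 0}"
    using representation_ne_zero[of "u ` lat n" x] by (auto simp: co_def split: if_splits)
  moreover have "inj_on u (supp x)" using u_inj supp_lat by (rule inj_on_subset)
  ultimately have "(\<Sum>b | representation (u ` lat n) x b \<noteq> 0. sc (representation (u ` lat n) x b) b)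
      = (\<Sum>l\<in>supp x. sc (representation (u ` lat n) x (u l)) (u l))"
    by (metis (no_types, lifting) sum.reindex_cong)
  also have "\<dots> = (\<Sum>l\<in>supp x. sc (co x l) (u l))"
    by (rule sum.cong) (auto simp: co_def split: if_splits)
  finally show ?thesis
    using sum_nonzero_representation_eq[OF u_independent, of x] u_span by simp
qed

lemma co_eqI: "(\<And>l. l \<in> lat n \<Longrightarrow> co x l = co y l) \<Longrightarrow> x = y"
proof -
  assume a: "\<And>l. l \<in> lat n \<Longrightarrow> co x l = co y l"
  have "co x l = co y l" for l
    by (cases "l \<in> lat n") (use a in \<open>auto simp: co_def\<close>)
  then show "x = y" using expand[of x] expand[of y] by simp
qed

lemma scale_cancel: "x \<noteq> 0 \<Longrightarrow> sc a x = sc b x \<Longrightarrow> a = b"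
  using scale_right_imp_eq by blast

text \<open>The structure constants: the torus is the twisted group algebra of the lattice with
  cocycle \<tau>.\<close>

definition \<tau> :: "(nat \<Rightarrow> int) \<Rightarrow> (nat \<Rightarrow> int) \<Rightarrow> 'k" where
  "\<tau> l m = co (u l * u m) (l + m)"

lemma u_mult: "l \<in> lat n \<Longrightarrow> m \<in> lat n \<Longrightarrow> u l * u m = sc (\<tau> l m) (u (l + m))"
  using u_mult_ex[of l m] by (auto simp: \<tau>_def co_scale co_u lat_add)

lemma invertible_cancel: "invertible_elt x \<Longrightarrow> x * y = 0 \<longleftrightarrow> y = 0"
  unfolding invertible_elt_def by (metis mult.assoc mult_1_left mult_zero_right)

lemma u_mult_nonzero: "l \<in> lat n \<Longrightarrow> m \<in> lat n \<Longrightarrow> u l * u m \<noteq> 0"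
  using invertible_cancel[OF u_invertible] u_nonzero by blast

lemma \<tau>_nonzero: "l \<in> lat n \<Longrightarrow> m \<in> lat n \<Longrightarrow> \<tau> l m \<noteq> 0"
  using u_mult[of l m] u_mult_nonzero[of l m] by auto

lemma co_mult:
  "co (x * y) p = (\<Sum>i\<in>supp x. \<Sum>j\<in>supp y. if i + j = p then co x i * co y j * \<tau> i j else 0)"
proof -
  have "x * y = (\<Sum>i\<in>supp x. \<Sum>j\<in>supp y. sc (co x i) (u i) * sc (co y j) (u j))"
    unfolding sum_product[symmetric] expand[symmetric] ..
  also have "\<dots> = (\<Sum>i\<in>supp x. \<Sum>j\<in>supp y. sc (co x i * co y j * \<tau> i j) (u (i + j)))"
  proof (intro sum.cong refl)
    fix i j assume ij: "i \<in> supp x" "j \<in> supp y"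
    then have "i \<in> lat n" "j \<in> lat n" using supp_lat by blast+
    then show "sc (co x i) (u i) * sc (co y j) (u j) = sc (co x i * co y j * \<tau> i j) (u (i + j))"
      by (simp add: u_mult mult_ac flip: scale_mult_left scale_mult_right)
  qed
  finally have "co (x * y) p = (\<Sum>i\<in>supp x. \<Sum>j\<in>supp y. co x i * co y j * \<tau> i j * co (u (i + j)) p)"
    by (simp add: co_sum co_scale)
  also have "\<dots> = (\<Sum>i\<in>supp x. \<Sum>j\<in>supp y. if i + j = p then co x i * co y j * \<tau> i j else 0)"
  proof (intro sum.cong refl)
    fix i j assume ij: "i \<in> supp x" "j \<in> supp y"
    then have "i + j \<in> lat n" using supp_lat by blast
    then show "co x i * co y j * \<tau> i j * co (u (i + j)) p
        = (if i + j = p then co x i * co y j * \<tau> i j else 0)"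
      by (auto simp: co_u)
  qed
  finally show ?thesis .
qed

lemma supp_u: "m \<in> lat n \<Longrightarrow> supp (u m) = {m}"
  by (auto simp: co_u)

lemma co_mult_u: "m \<in> lat n \<Longrightarrow> l \<in> lat n \<Longrightarrow> co (x * u m) (l + m) = co x l * \<tau> l m"
  by (subst co_mult) (auto simp: supp_u co_u cong: if_cong)

lemma co_u_mult: "m \<in> lat n \<Longrightarrow> l \<in> lat n \<Longrightarrow> co (u m * x) (m + l) = co x l * \<tau> m l"
  by (subst co_mult) (auto simp: supp_u co_u cong: if_cong)

text \<open>The lexicographic order on the lattice is total and translation invariant, so leading terms multiply.\<close>

lemma torus_domain:
  fixes x y :: 'a
  assumes "x * y = 0"
  shows "x = 0 \<or> y = 0"
proof (rule ccontr)
  assume "\<not> (x = 0 \<or> y = 0)"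
  then have ne: "supp x \<noteq> {}" "supp y \<noteq> {}"
    using co_eqI[of _ 0] by auto
  obtain l where l: "l \<in> supp x" "\<forall>i\<in>supp x. i = l \<or> less_fun i l"
    using ex_less_fun_max[OF finite_supp ne(1) supp_lat] by blast
  obtain m where m: "m \<in> supp y" "\<forall>j\<in>supp y. j = m \<or> less_fun j m"
    using ex_less_fun_max[OF finite_supp ne(2) supp_lat] by blast
  have uniq: "i + j = l + m \<longleftrightarrow> i = l \<and> j = m" if "i \<in> supp x" "j \<in> supp y" for i j
  proof
    assume e: "i + j = l + m"
    have "less_fun (i + j) (l + m)" if "\<not> (i = l \<and> j = m)"
    proof -
      have 1: "i + j = l + j \<or> less_fun (i + j) (l + j)"
        using l(2) \<open>i \<in> supp x\<close> less_fun_add[of i l j] by metis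
      have 2: "l + j = l + m \<or> less_fun (l + j) (l + m)"
        using m(2) \<open>j \<in> supp y\<close> less_fun_add[of j m l] by (metis add.commute)
      have "\<not> (i + j = l + j \<and> l + j = l + m)" using that by simp
      then show ?thesis using 1 2 less_fun_trans by metis
    qed
    then show "i = l \<and> j = m" using e less_fun_irrefl by metis
  qed simp
  have "co (x * y) (l + m)
      = (\<Sum>i\<in>supp x. \<Sum>j\<in>supp y. if i = l then (if j = m then co x l * co y m * \<tau> l m else 0) else 0)"
    unfolding co_mult by (intro sum.cong refl) (auto simp: uniq)
  also have "\<dots> = (\<Sum>i\<in>supp x. if i = l then \<Sum>j\<in>supp y. (if j = m then co x l * co y m * \<tau> l m else 0) else 0)"
    by (intro sum.cong refl) auto
  also have "\<dots> = co x l * co y m * \<tau> l m" using l(1) m(1) by simp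
  finally show False using l m \<tau>_nonzero[of l m] supp_lat assms by auto
qed

text \<open>Unlike \<tau>, which changes when the units are rescaled, this commutator depends on the
  grading only (see \<open>homog_commute\<close>), and it is multiplicative in each
  argument.\<close>

definition q :: "(nat \<Rightarrow> int) \<Rightarrow> (nat \<Rightarrow> int) \<Rightarrow> 'k" where
  "q l m = \<tau> l m / \<tau> m l"

lemma q_nonzero: "l \<in> lat n \<Longrightarrow> m \<in> lat n \<Longrightarrow> q l m \<noteq> 0"
  by (simp add: q_def \<tau>_nonzero)

lemma u_commute: "l \<in> lat n \<Longrightarrow> m \<in> lat n \<Longrightarrow> u l * u m = sc (q l m) (u m * u l)"
  by (simp add: u_mult q_def \<tau>_nonzero add.commute)

lemma q_swap: "q m l = inverse (q l m)"
  by (simp add: q_def)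

lemma q_self: "l \<in> lat n \<Longrightarrow> q l l = 1"
  by (simp add: q_def \<tau>_nonzero)

text \<open>Move \<open>u m\<close> past \<open>u l * u l'\<close> one factor at a time, then cancel
  the common scalar \<open>\<tau> l l'\<close>.\<close>

lemma q_add_left:
  assumes "l \<in> lat n" "l' \<in> lat n" "m \<in> lat n"
  shows "q (l + l') m = q l m * q l' m"
proof -
  have "u l * u l' * u m = sc (q l m * q l' m) (u m * (u l * u l'))"
  proof -
    have "u l * u l' * u m = u l * (u l' * u m)" by (simp add: mult.assoc)
    also have "\<dots> = sc (q l' m) (u l * u m * u l')"
      using assms by (simp add: u_commute[of l' m] mult.assoc flip: scale_mult_right)
    also have "u l * u m * u l' = sc (q l m) (u m * u l * u l')"
      using assms by (simp add: u_commute[of l m] flip: scale_mult_left)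
    finally show ?thesis by (simp add: mult.assoc mult.commute[of "q l m"])
  qed
  then have "sc (\<tau> l l') (u (l + l') * u m) = sc (\<tau> l l' * (q l m * q l' m)) (u m * u (l + l'))"
    using assms by (simp add: u_mult[of l l'] mult_ac flip: scale_mult_left scale_mult_right)
  then have "sc (\<tau> l l' * q (l + l') m) (u m * u (l + l')) = sc (\<tau> l l' * (q l m * q l' m)) (u m * u (l + l'))"
    using assms by (simp add: u_commute[of "l + l'" m] lat_add)
  then have "\<tau> l l' * q (l + l') m = \<tau> l l' * (q l m * q l' m)"
    using scale_cancel u_mult_nonzero assms lat_add by blast
  then show ?thesis using \<tau>_nonzero assms by simp
qed

lemma q_add_right:
  assumes "l \<in> lat n" "l' \<in> lat n" "m \<in> lat n"
  shows "q m (l + l') = q m l * q m l'"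
  using q_add_left[OF assms] q_swap[of m] by (metis inverse_mult_distrib)

text \<open>Comparing \<open>z * u m\<close> and \<open>u m * z\<close> in degree
  \<open>l + m\<close> shows that the degrees occurring in a central element lie in the radical of
  \<open>q\<close>.\<close>

lemma centre_degrees:
  assumes "z \<in> ring_centre" "co z l \<noteq> 0" "m \<in> lat n"
  shows "q l m = 1"
proof -
  have l: "l \<in> lat n" using assms(2) supp_lat by blast
  have "z * u m = u m * z" using assms(1) by (simp add: ring_centre_def)
  then have "co z l * \<tau> l m = co z l * \<tau> m l"
    using co_mult_u[OF assms(3) l, of z] co_u_mult[OF assms(3) l, of z] by (simp add: add.commute)
  then show ?thesis using assms \<tau>_nonzero l by (simp add: q_def)
qed

text \<open>The finitely many generators over the centre involve a finite set \<open>F\<close> of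
  degrees. Each lattice point is a degree from \<open>F\<close> plus a degree of a central element,
  and \<open>q\<close> does not see the latter. So \<open>q\<close> takes finitely many values on
  the multiples of \<open>l\<close>, and two powers of \<open>q l m\<close> coincide.\<close>

lemma q_root_of_unity:
  assumes "fgc_ring TYPE('a)" "l \<in> lat n" "m \<in> lat n"
  shows "\<exists>N>0. q l m ^ N = 1"
proof -
  obtain S :: "'a set" where S: "finite S"
    "\<And>x. \<exists>c. (\<forall>s\<in>S. c s \<in> ring_centre) \<and> x = (\<Sum>s\<in>S. c s * s)"
    using assms(1) unfolding fgc_ring_def by blast
  define F where "F = (\<Union>s\<in>S. supp s)"
  have "finite F" unfolding F_def using S(1) finite_supp by blast
  have "\<exists>j\<in>F. j \<in> lat n \<and> q p m = q j m" if p: "p \<in> lat n" for p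
  proof -
    obtain c where c: "\<forall>s\<in>S. c s \<in> ring_centre" "u p = (\<Sum>s\<in>S. c s * s)" using S(2) by blast
    have "(\<Sum>s\<in>S. co (c s * s) p) = 1" using c(2) p by (metis co_sum co_u)
    then obtain s where s: "s \<in> S" "co (c s * s) p \<noteq> 0" using sum.not_neutral_contains_not_neutral[of "\<lambda>s. co (c s * s) p" S] by auto
    then obtain i where i: "i \<in> supp (c s)"
      "(\<Sum>j\<in>supp s. if i + j = p then co (c s) i * co s j * \<tau> i j else 0) \<noteq> 0"
      unfolding co_mult using sum.not_neutral_contains_not_neutral by blast
    obtain j where j': "j \<in> supp s" "(if i + j = p then co (c s) i * co s j * \<tau> i j else 0) \<noteq> 0"
      by (rule sum.not_neutral_contains_not_neutral[OF i(2)])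
    then have j: "j \<in> supp s" "i + j = p" by meson+
    have "i \<in> lat n" "j \<in> lat n" using i j supp_lat by blast+
    moreover have "q i m = 1" using centre_degrees c(1) s(1) i(1) assms(3) by auto
    ultimately have "q p m = q j m" using q_add_left[of i j m] j(2) assms(3) by simp
    then show ?thesis using j s \<open>j \<in> lat n\<close> unfolding F_def by blast
  qed
  then obtain f where f: "\<And>p. p \<in> lat n \<Longrightarrow> f p \<in> F \<and> q p m = q (f p) m" by metis
  have "finite (range (\<lambda>k::nat. f (zscale (int k) l)))"
    by (rule finite_subset[OF _ \<open>finite F\<close>]) (use f assms(2) lat_zscale in blast)
  then have "\<not> inj (\<lambda>k::nat. f (zscale (int k) l))" using finite_imageD infinite_UNIV_nat by blast
  then obtain i j :: nat where ij: "i < j" "f (zscale (int i) l) = f (zscale (int j) l)"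
    unfolding inj_def by (metis linorder_neqE_nat)
  have "q (zscale (int k) l) m = q l m ^ k" for k
    using multiplicative_int_power[of n "\<lambda>x. q x m" l "int k"] assms q_add_left q_nonzero by simp
  then have "q l m ^ i = q l m ^ j"
    using f[of "zscale (int i) l"] f[of "zscale (int j) l"] ij(2) assms(2) lat_zscale by metis
  also have "q l m ^ j = q l m ^ i * q l m ^ (j - i)" using ij(1) by (simp flip: power_add)
  finally have "q l m ^ (j - i) = 1" using q_nonzero assms by simp
  then show ?thesis using ij(1) by (intro exI[of _ "j - i"]) simp
qed

text \<open>The finitely many factors of unit vectors have a common exponent \<open>M\<close>, so
  all are powers of a single \<zeta>. Both sides are then expanded over unit vectors, first in the
  left argument, then in the right.\<close>

lemma q_integer_form:
  assumes "fgc_ring TYPE('a)"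
  shows "\<exists>\<zeta> w. \<zeta> \<noteq> 0 \<and> (\<forall>x y z. w (x + y) z = w x z + w y z) \<and>
    (\<forall>a x y. w (zscale a x) y = a * w x y) \<and> (\<forall>x y. w x y = - w y x) \<and>
    (\<forall>l\<in>lat n. \<forall>m\<in>lat n. q l m = \<zeta> powi (w l m))"
proof -
  have "\<exists>M>0. \<forall>x\<in>X. x ^ M = 1" if "finite X" "\<forall>x\<in>X. \<exists>N>0. x ^ N = 1" for X :: "'k set"
    using that
  proof (induction rule: finite_induct)
    case empty
    then show ?case by auto
  next
    case (insert x X)
    then obtain M N where M: "M > 0" "\<forall>x\<in>X. x ^ M = 1" and N: "N > 0" "x ^ N = 1" by auto
    have "y ^ (M * N) = 1" if "y \<in> insert x X" for y
      using that M N power_mult[of y M N] power_mult[of y N M] by (auto simp: mult.commute)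
    then show ?case using M(1) N(1) by (intro exI[of _ "M * N"]) simp
  qed
  from this[of "(\<lambda>(i, j). q (unit_vec i) (unit_vec j)) ` ({..<n} \<times> {..<n})"]
  obtain M where M: "M > 0" "\<And>i j. i < n \<Longrightarrow> j < n \<Longrightarrow> q (unit_vec i) (unit_vec j) ^ M = 1"
    using q_root_of_unity[OF assms] lat_unit_vec by auto
  obtain \<zeta> :: 'k where \<zeta>: "\<zeta> ^ M = 1" "\<And>z. z ^ M = 1 \<Longrightarrow> \<exists>j::nat. z = \<zeta> ^ j"
    using roots_of_unity_cyclic[OF M(1)] by blast
  have "\<zeta> \<noteq> 0" using \<zeta>(1) M(1) by (metis not_gr0 power_0_left zero_neq_one)
  obtain e where e: "\<And>i j. i < n \<Longrightarrow> j < n \<Longrightarrow> q (unit_vec i) (unit_vec j) = \<zeta> ^ (e i j :: nat)"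
  proof -
    have "\<forall>i j. \<exists>e::nat. i < n \<longrightarrow> j < n \<longrightarrow> q (unit_vec i) (unit_vec j) = \<zeta> ^ e"
      using M(2) \<zeta>(2) by blast
    then have "\<exists>e::nat \<Rightarrow> nat \<Rightarrow> nat. \<forall>i j. i < n \<longrightarrow> j < n \<longrightarrow> q (unit_vec i) (unit_vec j) = \<zeta> ^ e i j"
      by (simp only: choice_iff)
    then show thesis using that by blast
  qed
  \<comment> \<open>Only the exponents with \<open>i < j\<close> are used, and the rest is filled in
    antisymmetrically. Exponents chosen separately for \<open>(i, j)\<close> and
    \<open>(j, i)\<close> would be opposite only modulo the order of \<zeta>, whereas the form must
    alternate over the integers.\<close>
  define w where "w x y = (\<Sum>i<n. \<Sum>j<n. if i < j then int (e i j) * (x i * y j - x j * y i) else 0)"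
    for x y :: "nat \<Rightarrow> int"
  have add: "w (x + y) z = w x z + w y z" for x y z
    unfolding w_def sum.distrib[symmetric] by (intro sum.cong refl) (simp add: algebra_simps)
  have scale: "w (zscale a x) y = a * w x y" for a x y
    unfolding w_def sum_distrib_left by (intro sum.cong refl) (simp add: zscale_apply algebra_simps)
  have alt: "w x y = - w y x" for x y
    unfolding w_def sum_negf[symmetric] by (intro sum.cong refl) (simp add: algebra_simps)
  have add2: "w z (x + y) = w z x + w z y" for x y z
    using add[of x y z] alt[of z] by simp
  have basis: "w (unit_vec i) (unit_vec j) = int (e i j)" if "i < j" "j < n" for i j
  proof -
    have "w (unit_vec i) (unit_vec j)
        = (\<Sum>i'<n. \<Sum>j'<n. if i' = i then (if j' = j then int (e i j) else 0) else 0)"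
      unfolding w_def by (intro sum.cong refl) (use that in \<open>auto simp: unit_vec_def\<close>)
    also have "\<dots> = (\<Sum>i'<n. if i' = i then \<Sum>j'<n. (if j' = j then int (e i j) else 0) else 0)"
      by (intro sum.cong refl) auto
    finally show ?thesis using that by simp
  qed
  have w_self: "w x x = 0" for x using alt[of x x] by simp
  have qb: "q (unit_vec i) (unit_vec j) = \<zeta> powi w (unit_vec i) (unit_vec j)" if "i < n" "j < n" for i j
  proof (cases i j rule: linorder_cases)
    case less
    then show ?thesis using that e basis by simp
  next
    case equal
    then show ?thesis using that q_self lat_unit_vec w_self by simp
  next
    case greater
    then have "q (unit_vec j) (unit_vec i) = \<zeta> powi w (unit_vec j) (unit_vec i)" using that e basis by simp
    then show ?thesis using q_swap[of "unit_vec i" "unit_vec j"] alt[of "unit_vec i" "unit_vec j"]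
      by (simp add: power_int_minus)
  qed
  have ql: "q l (unit_vec j) = \<zeta> powi w l (unit_vec j)" if "l \<in> lat n" "j < n" for l j
  proof -
    have "q l (unit_vec j) = (\<Prod>i<n. q (unit_vec i) (unit_vec j) powi l i)"
      by (rule multiplicative_expand[of n "\<lambda>l. q l (unit_vec j)"])
         (use that q_add_left q_nonzero lat_unit_vec in auto)
    also have "\<dots> = (\<Prod>i<n. (\<zeta> powi w (unit_vec i) (unit_vec j)) powi l i)"
      by (intro prod.cong refl) (use that qb in auto)
    also have "\<dots> = \<zeta> powi w l (unit_vec j)"
      by (rule multiplicative_expand[of n "\<lambda>l. \<zeta> powi w l (unit_vec j)", symmetric])
         (use that \<open>\<zeta> \<noteq> 0\<close> in \<open>auto simp: add power_int_add\<close>)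
    finally show ?thesis .
  qed
  have "q l m = \<zeta> powi w l m" if "l \<in> lat n" "m \<in> lat n" for l m
  proof -
    have "q l m = (\<Prod>i<n. q l (unit_vec i) powi m i)"
      by (rule multiplicative_expand[of n "\<lambda>m. q l m"])
         (use that q_add_right q_nonzero in auto)
    also have "\<dots> = (\<Prod>i<n. (\<zeta> powi w l (unit_vec i)) powi m i)"
      by (intro prod.cong refl) (use that ql in auto)
    also have "\<dots> = \<zeta> powi w l m"
      by (rule multiplicative_expand[of n "\<lambda>m. \<zeta> powi w l m", symmetric])
         (use that \<open>\<zeta> \<noteq> 0\<close> in \<open>auto simp: add2 power_int_add\<close>)
    finally show ?thesis .
  qed
  then show ?thesis using \<open>\<zeta> \<noteq> 0\<close> add scale alt by blast
qed

text \<open>Negating the exponent inverts the commutation factor, and the inverse of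
  \<open>q x y\<close> is \<open>q y x\<close>.\<close>

lemma ex_anti_isometry:
  assumes "fgc_ring TYPE('a)"
  shows "\<exists>\<sigma>. bij_betw \<sigma> (lat n) (lat n) \<and> (\<forall>x\<in>lat n. \<forall>y\<in>lat n. \<sigma> (x + y) = \<sigma> x + \<sigma> y) \<and>
           (\<forall>x\<in>lat n. \<forall>y\<in>lat n. q (\<sigma> x) (\<sigma> y) = q y x)"
proof -
  obtain \<zeta> w where w: "\<zeta> \<noteq> 0" "\<And>x y z. w (x + y) z = w x z + w y z"
    "\<And>a x y. w (zscale a x) y = a * w x y" "\<And>x y. w x y = - w y x"
    "\<And>l m. l \<in> lat n \<Longrightarrow> m \<in> lat n \<Longrightarrow> q l m = \<zeta> powi (w l m)"
    using q_integer_form[OF assms] by blast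
  have pure: "x \<in> lat n" if "x + x \<in> lat n" for x
    using that by (auto simp: lat_def)
  obtain \<sigma> where \<sigma>: "bij_betw \<sigma> (lat n) (lat n)"
    "\<And>x y. x \<in> lat n \<Longrightarrow> y \<in> lat n \<Longrightarrow> \<sigma> (x + y) = \<sigma> x + \<sigma> y"
    "\<And>x y. x \<in> lat n \<Longrightarrow> y \<in> lat n \<Longrightarrow> w (\<sigma> x) (\<sigma> y) = - w x y"
    using alternating_anti_isometry[OF w(2-4) subset_refl lat_zero lat_add lat_zscale pure] by blast
  have "q (\<sigma> x) (\<sigma> y) = q y x" if "x \<in> lat n" "y \<in> lat n" for x y
  proof -
    have "\<sigma> x \<in> lat n" "\<sigma> y \<in> lat n" using bij_betw_apply[OF \<sigma>(1)] that by auto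
    then show ?thesis using w(5) \<sigma>(3) w(4)[of x y] that by simp
  qed
  then show ?thesis using \<sigma> by blast
qed

end

section \<open>Anti-automorphisms of fgc tori\<close>

text \<open>The value at a non-unit is junk.\<close>

definition unit_inv :: "'a::ring_1 \<Rightarrow> 'a" where
  "unit_inv x = (SOME v. x * v = 1 \<and> v * x = 1)"

definition unit_power :: "'a::ring_1 \<Rightarrow> int \<Rightarrow> 'a" where
  "unit_power x a = (if a \<ge> 0 then x ^ nat a else unit_inv x ^ nat (- a))"

lemma unit_inv:
  assumes "invertible_elt x"
  shows "x * unit_inv x = 1" "unit_inv x * x = 1"
  using someI_ex[of "\<lambda>v. x * v = 1 \<and> v * x = 1"] assms
  unfolding invertible_elt_def unit_inv_def by blast+

lemma unit_power_0 [simp]: "unit_power x 0 = 1"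
  by (simp add: unit_power_def)

lemma unit_power_Suc:
  assumes "invertible_elt x"
  shows "unit_power x (a + 1) = unit_power x a * x"
proof (cases "a \<ge> 0")
  case True
  then have "nat (a + 1) = Suc (nat a)" by simp
  then show ?thesis using True by (simp add: unit_power_def power_Suc2 del: power_Suc)
next
  case False
  then have "nat (- a) = Suc (nat (- (a + 1)))" by simp
  then have "unit_power x a * x = unit_inv x ^ nat (- (a + 1)) * (unit_inv x * x)"
    using False by (simp add: unit_power_def power_Suc2 mult.assoc del: power_Suc)
  also have "\<dots> = unit_power x (a + 1)"
    using False by (cases "a = - 1") (auto simp: unit_power_def unit_inv[OF assms])
  finally show ?thesis ..
qed

lemma unit_power_add:
  assumes "invertible_elt x"
  shows "unit_power x (a + b) = unit_power x a * unit_power x b"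
proof (induction b rule: int_induct[where k = 0])
  case base
  then show ?case by simp
next
  case (step1 b)
  have "unit_power x (a + (b + 1)) = unit_power x (a + b) * x"
    using unit_power_Suc[OF assms, of "a + b"] by (simp add: add.assoc)
  then show ?case using step1 by (simp add: unit_power_Suc[OF assms] mult.assoc)
next
  case (step2 b)
  have "unit_power x (a + (b - 1)) * x = unit_power x a * unit_power x (b - 1) * x"
    using unit_power_Suc[OF assms, of "a + (b - 1)"] unit_power_Suc[OF assms, of "b - 1"] step2
    by (simp add: mult.assoc)
  then have "unit_power x (a + (b - 1)) * x * unit_inv x
      = unit_power x a * unit_power x (b - 1) * x * unit_inv x" by simp
  then show ?case by (simp add: mult.assoc unit_inv[OF assms])
qed

context torus_basis
begin

text \<open>The scalars are nonzero, so all these elements are units when \<open>l\<close> is a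
  lattice point. Knowing the degree without the scalar is enough for commutation relations.\<close>

definition homog :: "(nat \<Rightarrow> int) \<Rightarrow> 'a set" where
  "homog l = {sc c (u l) | c. c \<noteq> 0}"

lemma homog_mult:
  assumes "x \<in> homog l" "y \<in> homog m" "l \<in> lat n" "m \<in> lat n"
  shows "x * y \<in> homog (l + m)"
proof -
  obtain c d where "x = sc c (u l)" "y = sc d (u m)" "c \<noteq> 0" "d \<noteq> 0"
    using assms by (auto simp: homog_def)
  then have "x * y = sc (c * d * \<tau> l m) (u (l + m))"
    using assms by (simp add: u_mult mult_ac flip: scale_mult_left scale_mult_right)
  then show ?thesis unfolding homog_def using \<open>c \<noteq> 0\<close> \<open>d \<noteq> 0\<close> \<tau>_nonzero[OF assms(3,4)] by auto
qed

lemma homog_commute: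
  assumes "x \<in> homog l" "y \<in> homog m" "l \<in> lat n" "m \<in> lat n"
  shows "x * y = sc (q l m) (y * x)"
proof -
  obtain c d where "x = sc c (u l)" "y = sc d (u m)"
    using assms by (auto simp: homog_def)
  then show ?thesis
    using u_commute[OF assms(3,4)] by (simp add: mult_ac flip: scale_mult_left scale_mult_right)
qed

text \<open>\<open>u 0\<close> is a unit whose square is a scalar multiple of itself, so cancelling
  one factor makes it a scalar.\<close>

lemma one_homog: "1 \<in> homog 0"
proof -
  have "invertible_elt (u 0)" by (simp add: u_invertible)
  have "u 0 * u 0 = sc (\<tau> 0 0) (u 0)" using u_mult[of 0 0] by simp
  also have "\<dots> = u 0 * sc (\<tau> 0 0) 1" by (simp flip: scale_mult_right)
  finally have "u 0 * (u 0 - sc (\<tau> 0 0) 1) = 0" by (simp add: right_diff_distrib)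
  then have "u 0 = sc (\<tau> 0 0) 1"
    using invertible_cancel[OF \<open>invertible_elt (u 0)\<close>] by simp
  then have "1 = sc (inverse (\<tau> 0 0)) (u 0)" using \<tau>_nonzero[of 0 0] by simp
  then show ?thesis unfolding homog_def using \<tau>_nonzero[of 0 0] by (auto intro!: exI[of _ "inverse (\<tau> 0 0)"])
qed

lemma invertible_scale: "invertible_elt x \<Longrightarrow> c \<noteq> 0 \<Longrightarrow> invertible_elt (sc c x)"
  unfolding invertible_elt_def
  by (elim exE conjE, rule_tac x = "sc (inverse c) v" in exI)
     (simp flip: scale_mult_left scale_mult_right)

lemma homog_invertible: "x \<in> homog l \<Longrightarrow> l \<in> lat n \<Longrightarrow> invertible_elt x"
  using u_invertible invertible_scale by (auto simp: homog_def)

lemma unit_inv_homog: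
  assumes "x \<in> homog l" "l \<in> lat n"
  shows "unit_inv x \<in> homog (- l)"
proof -
  note ux = homog_invertible[OF assms]
  have "u (- l) \<in> homog (- l)" by (auto simp: homog_def intro!: exI[of _ 1])
  then have "u (- l) * x \<in> homog 0"
    using homog_mult[of "u (- l)" "- l" x l] assms lat_uminus by simp
  then obtain c where c: "c \<noteq> 0" "u (- l) * x = sc c (u 0)" by (auto simp: homog_def)
  obtain d where d: "d \<noteq> 0" "1 = sc d (u 0)" using one_homog by (auto simp: homog_def)
  have "u 0 = sc (inverse d) 1"
    using arg_cong[OF d(2), of "sc (inverse d)"] d(1) by simp
  then have "u (- l) * x = sc (c * inverse d) 1" using c by simp
  then have "u (- l) * x * unit_inv x = sc (c * inverse d) (unit_inv x)"
    by (simp flip: scale_mult_left)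
  then have "u (- l) = sc (c * inverse d) (unit_inv x)"
    by (simp add: mult.assoc unit_inv[OF ux])
  then have "sc (inverse c * d) (u (- l)) = sc (inverse c * d) (sc (c * inverse d) (unit_inv x))"
    by (rule arg_cong)
  also have "\<dots> = sc (inverse c * d * (c * inverse d)) (unit_inv x)" by simp
  also have "inverse c * d * (c * inverse d) = 1" using c(1) d(1) by (simp add: field_simps)
  also have "sc 1 (unit_inv x) = unit_inv x" by simp
  finally have "unit_inv x = sc (inverse c * d) (u (- l))" ..
  then show ?thesis unfolding homog_def using c d by (auto intro!: exI[of _ "inverse c * d"])
qed

lemma power_homog:
  assumes "x \<in> homog l" "l \<in> lat n"
  shows "x ^ k \<in> homog (zscale (int k) l)"
proof (induction k)
  case 0
  then show ?case using one_homog by (simp only: of_nat_0 zscale_simps power_0)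
next
  case (Suc k)
  have "zscale (int (Suc k)) l = l + zscale (int k) l"
    by (rule ext) (simp add: zscale_apply algebra_simps)
  then show ?case using homog_mult[OF assms(1) Suc assms(2) lat_zscale[OF assms(2)]]
    by (simp only: power_Suc)
qed

lemma unit_power_homog:
  assumes "x \<in> homog l" "l \<in> lat n"
  shows "unit_power x a \<in> homog (zscale a l)"
proof (cases "a \<ge> 0")
  case True
  then show ?thesis using power_homog[OF assms, of "nat a"] by (simp add: unit_power_def)
next
  case False
  have "zscale (int (nat (- a))) (- l) = zscale a l"
    using False by (intro ext) (simp add: zscale_apply)
  then show ?thesis using False power_homog[OF unit_inv_homog[OF assms] lat_uminus[OF assms(2)], of "nat (- a)"]
    by (simp add: unit_power_def)
qed

text \<open>\<open>a l\<close> is the ordered monomial in units of degree \<open>unit_vec i\<close>, and \<open>b l\<close> the reversed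
  monomial in units of degree \<open>\<sigma> (unit_vec i)\<close>: reordering costs the same scalar in both.\<close>

lemma ex_matching_monomials:
  assumes \<sigma>: "\<And>x. x \<in> lat n \<Longrightarrow> \<sigma> x \<in> lat n"
    "\<And>x y. x \<in> lat n \<Longrightarrow> y \<in> lat n \<Longrightarrow> \<sigma> (x + y) = \<sigma> x + \<sigma> y"
    "\<And>x y. x \<in> lat n \<Longrightarrow> y \<in> lat n \<Longrightarrow> q (\<sigma> x) (\<sigma> y) = q y x"
    and "k \<le> n"
  shows "\<exists>a b. (\<forall>l\<in>lat k. a l \<in> homog l \<and> b l \<in> homog (\<sigma> l)) \<and>
    (\<forall>l\<in>lat k. \<forall>m\<in>lat k. \<exists>t. a l * a m = sc t (a (l + m)) \<and> b m * b l = sc t (b (l + m)))"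
  using \<open>k \<le> n\<close>
proof (induction k)
  case 0
  have "lat 0 = {0}" by (auto simp: lat_def)
  moreover have "\<sigma> 0 = 0" using \<sigma>(2)[of 0 0] by simp
  ultimately have "1 \<in> homog l \<and> 1 \<in> homog (\<sigma> l)" if "l \<in> lat 0" for l
    using that one_homog by (metis singletonD)
  then show ?case by (intro exI[of _ "\<lambda>_. 1"]) (auto intro!: exI[of _ 1])
next
  case (Suc k)
  then obtain a b where ab: "\<And>l. l \<in> lat k \<Longrightarrow> a l \<in> homog l \<and> b l \<in> homog (\<sigma> l)"
    "\<And>l m. l \<in> lat k \<Longrightarrow> m \<in> lat k \<Longrightarrow> \<exists>t. a l * a m = sc t (a (l + m)) \<and> b m * b l = sc t (b (l + m))"
    by (metis Suc_leD)
  define e where "e = unit_vec k"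
  have e: "e \<in> lat n" unfolding e_def using Suc.prems by (intro lat_unit_vec) simp
  have kn: "l \<in> lat n" if "l \<in> lat k" for l using that lat_mono[of k n] Suc.prems by auto
  define p where "p = unit_power (u e)"
  define r where "r = unit_power (u (\<sigma> e))"
  have ue: "u e \<in> homog e" "u (\<sigma> e) \<in> homog (\<sigma> e)"
    by (auto simp: homog_def intro!: exI[of _ 1])
  have \<sigma>sc: "\<sigma> (zscale i e) = zscale i (\<sigma> e)" for i
  proof (induction i rule: int_induct[where k = 0])
    case base
    have "\<sigma> 0 + \<sigma> 0 = \<sigma> 0 + 0" using \<sigma>(2)[OF lat_zero lat_zero] by (simp only: add_0_right)
    then have "\<sigma> 0 = 0" by (rule add_left_imp_eq)
    then show ?case by (simp only: zscale_simps)
  next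
    case (step1 i)
    then show ?case using \<sigma>(2)[OF lat_zscale[OF e] e, of i] by (simp only: zscale_add zscale_simps)
  next
    case (step2 i)
    have s: "zscale i x = zscale (i - 1) x + x" for x
      by (rule ext) (simp add: zscale_apply algebra_simps)
    have "\<sigma> (zscale (i - 1) e) + \<sigma> e = zscale (i - 1) (\<sigma> e) + \<sigma> e"
      using \<sigma>(2)[OF lat_zscale[OF e] e, of "i - 1"] step2(2) s by metis
    then show ?case by (rule add_right_imp_eq)
  qed
  have p: "p i \<in> homog (zscale i e)" and r: "r i \<in> homog (\<sigma> (zscale i e))" for i
    unfolding p_def r_def \<sigma>sc by (rule unit_power_homog[OF ue(1) e] unit_power_homog[OF ue(2) \<sigma>(1)[OF e]])+
  have p_add: "p (i + j) = p i * p j" and r_add: "r (i + j) = r j * r i" for i j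
    unfolding p_def r_def
    using unit_power_add[OF u_invertible[OF e], of i j]
      unit_power_add[OF u_invertible[OF \<sigma>(1)[OF e]], of j i]
    by (simp_all add: add.commute)
  \<comment> \<open>The new power stands on the right in \<open>a'\<close> and on the left in
    \<open>b'\<close>, so \<open>a' l * a' m\<close> and \<open>b' m * b' l\<close> each need a
    single exchange, of \<open>p i\<close> with \<open>a m0\<close> and of \<open>b m0\<close> with
    \<open>r i\<close>. Since \<open>q (\<sigma> x) (\<sigma> y) = q y x\<close>, both exchanges
    produce the same scalar.\<close>
  define a' where "a' l = a (l(k := 0)) * p (l k)" for l
  define b' where "b' l = r (l k) * b (l(k := 0))" for l
  have dec: "l(k := 0) \<in> lat k" "l = l(k := 0) + zscale (l k) e" if l: "l \<in> lat (Suc k)" for l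
  proof -
    obtain y where y: "y \<in> lat k" "\<And>i. i < k \<Longrightarrow> y i = l i" "l = y + zscale (l k) e"
      unfolding e_def using lat_Suc_decomp[OF l] by blast
    have "y = l(k := 0)"
    proof
      fix i
      show "y i = (l(k := 0)) i"
        using y(1,2) l by (cases i k rule: linorder_cases) (auto simp: lat_def)
    qed
    then show "l(k := 0) \<in> lat k" "l = l(k := 0) + zscale (l k) e" using y by simp_all
  qed
  have "a' l \<in> homog l \<and> b' l \<in> homog (\<sigma> l)" if l: "l \<in> lat (Suc k)" for l
  proof -
    note d = dec[OF l]
    have "\<sigma> l = \<sigma> (zscale (l k) e) + \<sigma> (l(k := 0))"
      using \<sigma>(2)[OF kn[OF d(1)] lat_zscale[OF e]] d(2) by (metis add.commute)
    then show ?thesis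
      using homog_mult[OF conjunct1[OF ab(1)[OF d(1)]] p kn[OF d(1)] lat_zscale[OF e], of "l k"]
        homog_mult[OF r conjunct2[OF ab(1)[OF d(1)]] \<sigma>(1)[OF lat_zscale[OF e]] \<sigma>(1)[OF kn[OF d(1)]], of "l k"]
        d(2) by (simp only: a'_def b'_def flip: d(2))
  qed
  moreover have "\<exists>t. a' l * a' m = sc t (a' (l + m)) \<and> b' m * b' l = sc t (b' (l + m))"
    if l: "l \<in> lat (Suc k)" and m: "m \<in> lat (Suc k)" for l m
  proof -
    define l0 where "l0 = l(k := 0)"
    define m0 where "m0 = m(k := 0)"
    define i where "i = l k"
    define j where "j = m k"
    have l0: "l0 \<in> lat k" and m0: "m0 \<in> lat k" unfolding l0_def m0_def using dec(1) l m by blast+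
    have lm: "(l + m)(k := 0) = l0 + m0" "(l + m) k = i + j"
      by (auto simp: l0_def m0_def i_def j_def)
    obtain t where t: "a l0 * a m0 = sc t (a (l0 + m0))" "b m0 * b l0 = sc t (b (l0 + m0))"
      using ab(2)[OF l0 m0] by blast
    define s where "s = q (zscale i e) m0"
    have c1: "p i * a m0 = sc s (a m0 * p i)"
      unfolding s_def using homog_commute[OF p] ab(1) m0 kn e lat_zscale by blast
    have c2: "b m0 * r i = sc s (r i * b m0)"
      unfolding s_def using homog_commute[of "b m0" "\<sigma> m0" "r i" "\<sigma> (zscale i e)"] ab(1) m0 kn e lat_zscale r \<sigma>
      by simp
    have "a' l * a' m = a l0 * (p i * a m0) * p j"
      by (simp add: a'_def l0_def m0_def i_def j_def mult.assoc)
    also have "\<dots> = sc s ((a l0 * a m0) * (p i * p j))"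
      unfolding c1 by (simp add: mult.assoc flip: scale_mult_left scale_mult_right)
    also have "\<dots> = sc (s * t) (a (l0 + m0) * p (i + j))"
      unfolding t p_add by (simp flip: scale_mult_left)
    finally have 1: "a' l * a' m = sc (s * t) (a' (l + m))" by (simp only: a'_def lm)
    have "b' m * b' l = r j * (b m0 * r i) * b l0"
      by (simp add: b'_def l0_def m0_def i_def j_def mult.assoc)
    also have "\<dots> = sc s ((r j * r i) * (b m0 * b l0))"
      unfolding c2 by (simp add: mult.assoc flip: scale_mult_left scale_mult_right)
    also have "\<dots> = sc (s * t) (r (i + j) * b (l0 + m0))"
      unfolding t r_add by (simp flip: scale_mult_right)
    finally have "b' m * b' l = sc (s * t) (b' (l + m))" by (simp only: b'_def lm)
    with 1 show ?thesis by blast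
  qed
  ultimately show ?case by blast
qed

text \<open>Send the monomial \<open>a l\<close> to \<open>b l\<close>. The two families have the
  same structure scalars with the factors in opposite order, so this linear map reverses products.
  It is bijective because \<sigma> permutes the degrees.\<close>

lemma ex_anti_automorphism:
  assumes "fgc_ring TYPE('a)"
  shows "\<exists>\<Phi>. bij \<Phi> \<and> (\<forall>x y. \<Phi> (x + y) = \<Phi> x + \<Phi> y) \<and> (\<forall>c x. \<Phi> (sc c x) = sc c (\<Phi> x)) \<and>
    (\<forall>x y. \<Phi> (x * y) = \<Phi> y * \<Phi> x) \<and> \<Phi> 1 = 1"
proof -
  obtain \<sigma> where \<sigma>: "bij_betw \<sigma> (lat n) (lat n)"
    "\<And>x y. x \<in> lat n \<Longrightarrow> y \<in> lat n \<Longrightarrow> \<sigma> (x + y) = \<sigma> x + \<sigma> y"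
    "\<And>x y. x \<in> lat n \<Longrightarrow> y \<in> lat n \<Longrightarrow> q (\<sigma> x) (\<sigma> y) = q y x"
    using ex_anti_isometry[OF assms] by blast
  have \<sigma>l: "\<sigma> x \<in> lat n" if "x \<in> lat n" for x using bij_betw_apply[OF \<sigma>(1) that] .
  obtain a b where ab: "\<And>l. l \<in> lat n \<Longrightarrow> a l \<in> homog l" "\<And>l. l \<in> lat n \<Longrightarrow> b l \<in> homog (\<sigma> l)"
    "\<And>l m. l \<in> lat n \<Longrightarrow> m \<in> lat n \<Longrightarrow> \<exists>t. a l * a m = sc t (a (l + m)) \<and> b m * b l = sc t (b (l + m))"
    using ex_matching_monomials[OF \<sigma>l \<sigma>(2,3) order_refl] by blast
  have "\<forall>l\<in>lat n. \<exists>c. c \<noteq> 0 \<and> u l = sc c (a l)"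
  proof
    fix l assume "l \<in> lat n"
    then obtain c where "c \<noteq> 0" "a l = sc c (u l)" using ab(1) by (auto simp: homog_def)
    then show "\<exists>c. c \<noteq> 0 \<and> u l = sc c (a l)" by (intro exI[of _ "inverse c"]) simp
  qed
  then obtain c where c: "\<And>l. l \<in> lat n \<Longrightarrow> c l \<noteq> 0 \<and> u l = sc (c l) (a l)" by metis
  \<comment> \<open>The images are prescribed on the basis \<open>u\<close>, so the scalar
    \<open>c l\<close> between \<open>u l\<close> and \<open>a l\<close> is carried along in order
    to obtain \<open>\<Phi> (a l) = b l\<close>.\<close>
  define g where "g x = sc (c (inv_into (lat n) u x)) (b (inv_into (lat n) u x))" for x
  interpret pair: vector_space_pair sc sc ..
  define \<Phi> where "\<Phi> = pair.construct (u ` lat n) g"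
  interpret \<Phi>: Vector_Spaces.linear sc sc \<Phi>
    unfolding \<Phi>_def by (rule pair.linear_construct[OF u_independent])
  have \<Phi>u: "\<Phi> (u l) = sc (c l) (b l)" if "l \<in> lat n" for l
    unfolding \<Phi>_def using pair.construct_basis[OF u_independent, of "u l" g] that u_inj
    by (simp add: g_def)
  have \<Phi>a: "\<Phi> (a l) = b l" if "l \<in> lat n" for l
  proof -
    have "a l = sc (inverse (c l)) (u l)" using c[OF that] by simp
    then show ?thesis using \<Phi>u[OF that] c[OF that] by (simp add: \<Phi>.scale)
  qed
  have spana: "span (a ` lat n) = UNIV"
  proof -
    have "u ` lat n \<subseteq> span (a ` lat n)"
      using c by (auto intro!: span_scale[OF span_base])
    then have "span (u ` lat n) \<subseteq> span (a ` lat n)" by (rule span_minimal) (rule subspace_span)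
    then show ?thesis using u_span by auto
  qed
  have inj: "inj \<Phi>"
    unfolding \<Phi>.inj_iff_eq_0
  proof (intro allI impI)
    fix x assume "\<Phi> x = 0"
    show "x = 0"
    proof (rule co_eqI)
      fix m assume m: "m \<in> lat n"
      have nz: "b l \<in> homog (\<sigma> l)" "\<sigma> l \<in> lat n" if "l \<in> supp x" for l
      proof -
        have "l \<in> lat n" using supp_lat that by blast
        then show "b l \<in> homog (\<sigma> l)" "\<sigma> l \<in> lat n" using ab(2) \<sigma>l by simp_all
      qed
      have "\<Phi> x = (\<Sum>l\<in>supp x. sc (co x l) (\<Phi> (u l)))"
        by (subst expand[of x]) (simp add: \<Phi>.sum \<Phi>.scale)
      also have "\<dots> = (\<Sum>l\<in>supp x. sc (co x l * c l) (b l))"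
      proof (rule sum.cong[OF refl])
        fix l assume "l \<in> supp x"
        then have "l \<in> lat n" using supp_lat by blast
        then show "sc (co x l) (\<Phi> (u l)) = sc (co x l * c l) (b l)" by (simp add: \<Phi>u)
      qed
      \<comment> \<open>Since \<sigma> is injective, the coordinate of \<open>\<Phi> x\<close> in
        degree \<open>\<sigma> m\<close> receives a contribution from \<open>l = m\<close>
        alone.\<close>
      finally have "co (\<Phi> x) (\<sigma> m) = (\<Sum>l\<in>supp x. co x l * c l * co (b l) (\<sigma> m))"
        by (simp add: co_sum co_scale)
      then have "0 = (\<Sum>l\<in>supp x. co x l * c l * co (b l) (\<sigma> m))"
        using \<open>\<Phi> x = 0\<close> by simp
      also have "\<dots> = (\<Sum>l\<in>supp x. if l = m then co x m * c m * co (b m) (\<sigma> m) else 0)"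
      proof (rule sum.cong[OF refl])
        fix l assume l: "l \<in> supp x"
        then have ll: "l \<in> lat n" using supp_lat by blast
        obtain d where "b l = sc d (u (\<sigma> l))" using nz[OF l] by (auto simp: homog_def)
        moreover have "\<sigma> m = \<sigma> l \<longleftrightarrow> m = l"
          using \<sigma>(1) m ll by (auto simp: bij_betw_def inj_on_def)
        ultimately show "co x l * c l * co (b l) (\<sigma> m) = (if l = m then co x m * c m * co (b m) (\<sigma> m) else 0)"
          using \<sigma>l[OF ll] by (auto simp: co_scale co_u)
      qed
      also have "\<dots> = co x m * c m * co (b m) (\<sigma> m)" by simp
      finally have "co x m * c m * co (b m) (\<sigma> m) = 0" by simp
      moreover obtain d where "d \<noteq> 0" "b m = sc d (u (\<sigma> m))" using ab(2)[OF m] by (auto simp: homog_def)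
      ultimately show "co x m = co 0 m" using c[OF m] \<sigma>l[OF m] by (simp add: co_scale co_u)
    qed
  qed
  have surj: "surj \<Phi>"
  proof -
    have "u m \<in> range \<Phi>" if m: "m \<in> lat n" for m
    proof -
      obtain l where l: "l \<in> lat n" "\<sigma> l = m" using bij_betw_imp_surj_on[OF \<sigma>(1)] m by (metis imageE)
      obtain d where "d \<noteq> 0" "b l = sc d (u m)" using ab(2)[OF l(1)] l(2) by (auto simp: homog_def)
      then have "u m = \<Phi> (sc (inverse d) (a l))" using \<Phi>a[OF l(1)] by (simp add: \<Phi>.scale)
      then show ?thesis by blast
    qed
    then have "span (u ` lat n) \<subseteq> range \<Phi>"
      by (intro span_minimal) (auto intro: \<Phi>.subspace_image)
    then show ?thesis using u_span by auto
  qed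
  have mult_a: "\<Phi> (a l * a m) = \<Phi> (a m) * \<Phi> (a l)" if lm: "l \<in> lat n" "m \<in> lat n" for l m
  proof -
    obtain t where "a l * a m = sc t (a (l + m))" "b m * b l = sc t (b (l + m))" using ab(3)[OF lm] by blast
    then show ?thesis using lm by (simp add: \<Phi>a \<Phi>.scale lat_add)
  qed
  have mult1: "\<Phi> (a l * y) = \<Phi> y * \<Phi> (a l)" if l: "l \<in> lat n" for l y
  proof -
    have "y \<in> span (a ` lat n)" using spana by simp
    then show ?thesis
    proof (induction y rule: span_induct_alt)
      case base
      then show ?case by (simp add: \<Phi>.zero)
    next
      case (step d z y)
      then show ?case using mult_a[OF l]
        by (auto simp: distrib_left distrib_right \<Phi>.add \<Phi>.scale
            simp flip: scale_mult_left scale_mult_right)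
    qed
  qed
  have mult: "\<Phi> (x * y) = \<Phi> y * \<Phi> x" for x y
  proof -
    have "x \<in> span (a ` lat n)" using spana by simp
    then show ?thesis
    proof (induction x rule: span_induct_alt)
      case base
      then show ?case by (simp add: \<Phi>.zero)
    next
      case (step d z x)
      then show ?case using mult1
        by (auto simp: distrib_left distrib_right \<Phi>.add \<Phi>.scale
            simp flip: scale_mult_left scale_mult_right)
    qed
  qed
  have "\<Phi> 1 = 1"
  proof -
    obtain e where "\<Phi> e = 1" using surj by (metis surjD)
    then show ?thesis using mult[of e 1] by simp
  qed
  then show ?thesis using inj surj mult \<Phi>.add \<Phi>.scale by (auto simp: bij_def)
qed

end

section \<open>Jordan isomorphisms onto domains\<close>

text \<open>A group is not the union of two proper subgroups: with \<open>a\<close> outside the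
  second and \<open>b\<close> outside the first, \<open>a + b\<close> is in neither.\<close>

lemma two_subgroups_cover:
  fixes P Q :: "'a::ab_group_add \<Rightarrow> bool"
  assumes "\<And>x y. P x \<Longrightarrow> P y \<Longrightarrow> P (x - y)" "\<And>x y. Q x \<Longrightarrow> Q y \<Longrightarrow> Q (x - y)"
    and "\<And>x. P x \<or> Q x"
  shows "(\<forall>x. P x) \<or> (\<forall>x. Q x)"
proof (rule ccontr)
  assume "\<not> ((\<forall>x. P x) \<or> (\<forall>x. Q x))"
  then obtain a b where ab: "\<not> Q a" "\<not> P b" by blast
  then have "P a" "Q b" using assms(3) by blast+
  then have "P (a + b) \<Longrightarrow> P b" "Q (a + b) \<Longrightarrow> Q a"
    using assms(1)[of "a + b" a] assms(2)[of "a + b" b] by simp_all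
  then show False using ab assms(3) by blast
qed

text \<open>For a Jordan homomorphism, \<open>(h (x * y) - h x * h y) * (h (x * y) - h y * h x) = 0\<close>.\<close>

lemma jordan_triple_hom_or_antihom:
  fixes h :: "'a::ring_1 \<Rightarrow> 'b::ring_1"
  assumes add: "\<And>x y. h (x + y) = h x + h y" and one: "h 1 = 1"
    and triple: "\<And>x y z. h (x * y * z + z * y * x) = h x * h y * h z + h z * h y * h x"
    and domain: "\<And>a b :: 'b. a * b = 0 \<Longrightarrow> a = 0 \<or> b = 0"
    and two: "\<And>b :: 'b. b + b = 0 \<Longrightarrow> b = 0"
  shows "(\<forall>x y. h (x * y) = h x * h y) \<or> (\<forall>x y. h (x * y) = h y * h x)"
proof -
  have diff: "h (x - y) = h x - h y" for x y
    using add[of "x - y" y] by simp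
  have quad: "h (x * y * x) = h x * h y * h x" for x y
  proof -
    have "(h (x * y * x) - h x * h y * h x) + (h (x * y * x) - h x * h y * h x) = 0"
      using triple[of x y x] by (simp add: add algebra_simps)
    from two[OF this] show ?thesis by simp
  qed
  have sq: "h (x * x) = h x * h x" for x
    using quad[of x 1] by (simp add: one)
  \<comment> \<open>Apply the triple law to \<open>(x * y, y, x)\<close>: its left side is the image
    of \<open>x * (y * y) * x\<close> plus a square, which the laws \<open>quad\<close> and
    \<open>sq\<close> evaluate independently.\<close>
  have zero: "(h (x * y) - h x * h y) * (h (x * y) - h y * h x) = 0" for x y
  proof -
    have "h (x * y) * h y * h x + h x * h y * h (x * y) = h (x * y * y * x + x * y * (x * y))"
      using triple[of "x * y" y x] by simp
    also have "\<dots> = h (x * (y * y) * x) + h ((x * y) * (x * y))"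
      by (simp add: add mult.assoc)
    also have "\<dots> = h x * (h y * h y) * h x + h (x * y) * h (x * y)"
      by (simp only: quad sq)
    finally show ?thesis by (simp add: algebra_simps)
  qed
  have cases: "h (x * y) = h x * h y \<or> h (x * y) = h y * h x" for x y
    using domain[OF zero[of x y]] by auto
  \<comment> \<open>The choice between the two laws still depends on the pair. For fixed
    \<open>x\<close> each law holds for a subgroup of elements \<open>y\<close>; the same argument
    over \<open>x\<close> then makes the choice global.\<close>
  have "(\<forall>y. h (x * y) = h x * h y) \<or> (\<forall>y. h (x * y) = h y * h x)" for x
    by (rule two_subgroups_cover) (use cases in \<open>auto simp: algebra_simps diff\<close>)
  then show ?thesis
    by (intro two_subgroups_cover) (auto simp: algebra_simps diff)
qed

text \<open>Putting \<open>x = z = 1\<close> in the triple law expresses \<open>gp\<close> by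
  \<open>gm\<close> and \<open>v = gp 1\<close>. Once \<open>v\<close> is inverted,
  \<open>gm\<close> can be eliminated, and \<open>gp\<close> divided by \<open>v\<close> preserves 1
  and the Jordan triple product.\<close>

lemma jordan_pair_iso_hom_or_antihom:
  fixes gp gm :: "'a::ring_1 \<Rightarrow> 'b::ring_1"
  assumes bij: "bij gp" and add: "\<And>x y. gp (x + y) = gp x + gp y"
    and triple: "\<And>x y z. gp (x * y * z + z * y * x) = gp x * gm y * gp z + gp z * gm y * gp x"
    and domain: "\<And>a b :: 'b. a * b = 0 \<Longrightarrow> a = 0 \<or> b = 0"
    and two: "\<And>b :: 'b. b + b = 0 \<Longrightarrow> b = 0"
  shows "\<exists>w. bij (\<lambda>x. w * gp x) \<and> w * gp 1 = 1 \<and>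
    ((\<forall>x y. w * gp (x * y) = (w * gp x) * (w * gp y)) \<or>
     (\<forall>x y. w * gp (x * y) = (w * gp y) * (w * gp x)))"
proof -
  define v where "v = gp 1"
  have gp_eq: "gp y = v * gm y * v" for y
  proof -
    have "(gp y - v * gm y * v) + (gp y - v * gm y * v) = 0"
      using triple[of 1 y 1] by (simp add: add v_def algebra_simps)
    from two[OF this] show ?thesis by simp
  qed
  obtain y where y: "gp y = 1" using bij by (metis bij_pointE)
  \<comment> \<open>As \<open>v * gm y * v = gp y = 1\<close>, this is a right inverse of
    \<open>v\<close>; the domain hypothesis makes it two-sided.\<close>
  define w where "w = gm y * v"
  have "v * w = 1" using gp_eq[of y] y by (simp add: w_def mult.assoc)
  moreover have "w * v = 1"
  proof -
    have "v * (w * v - 1) = 0" using \<open>v * w = 1\<close> by (simp add: right_diff_distrib flip: mult.assoc)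
    moreover have "v \<noteq> 0" using \<open>v * w = 1\<close> by auto
    ultimately show ?thesis using domain by fastforce
  qed
  ultimately have vw: "v * w = 1" "w * v = 1" .
  have vw': "v * (w * x) = x" "w * (v * x) = x" for x
    by (simp_all add: vw flip: mult.assoc)
  define h where "h x = w * gp x" for x
  have gm: "gm y = w * gp y * w" for y
    by (simp add: gp_eq mult.assoc vw vw')
  have "(\<forall>x y. h (x * y) = h x * h y) \<or> (\<forall>x y. h (x * y) = h y * h x)"
  proof (rule jordan_triple_hom_or_antihom[OF _ _ _ domain two])
    show "h (x + y) = h x + h y" for x y by (simp add: h_def add distrib_left)
    show "h 1 = 1" using vw by (simp add: h_def v_def)
    show "h (x * y * z + z * y * x) = h x * h y * h z + h z * h y * h x" for x y z
      unfolding h_def triple gm by (simp only: distrib_left mult.assoc vw')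
  qed
  moreover have "bij h"
  proof (rule bijI)
    show "inj h"
    proof (rule injI)
      fix x y assume "h x = h y"
      then have "v * h x = v * h y" by simp
      then show "x = y" using bij by (simp add: h_def vw' bij_def inj_eq)
    qed
    show "surj h"
    proof (rule surjI)
      fix z
      show "h (inv gp (v * z)) = z" using bij by (simp add: h_def bij_def surj_f_inv_f vw')
    qed
  qed
  ultimately show ?thesis using vw unfolding h_def v_def by (intro exI[of _ w]) auto
qed

section \<open>The root system of type A\<close>

text \<open>Vertices \<open>vert r 0, \<dots>, vert r r\<close> of a regular simplex in \<open>\<real>\<^sup>r\<close> with edges of length \<open>sqrt 2\<close>: the
  first \<open>r\<close> are the standard basis vectors, the last is a multiple of \<open>(1, \<dots>, 1)\<close>.
  Their differences form the root system \<open>A\<^sub>r\<close>.\<close>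

definition apex :: "nat \<Rightarrow> real" where
  "apex r = (1 + sqrt (1 + real r)) / real r"

definition vert :: "nat \<Rightarrow> nat \<Rightarrow> nat \<Rightarrow> real" where
  "vert r i j = (if j < r then (if i < r then of_bool (i = j) else apex r) else 0)"

definition roots :: "nat \<Rightarrow> (nat \<Rightarrow> real) set" where
  "roots r = {vert r i - vert r j | i j. i \<le> r \<and> j \<le> r}"

lemma rootsI: "i \<le> r \<Longrightarrow> j \<le> r \<Longrightarrow> vert r i - vert r j \<in> roots r"
  by (auto simp: roots_def)

text \<open>The quadratic equation behind the constant: it says that the point with all
  \<open>r\<close> coordinates equal to \<open>apex r\<close> has squared distance 2 from each
  standard basis vector.\<close>

lemma apex_eq: "r \<ge> 1 \<Longrightarrow> real r * apex r * apex r = 1 + 2 * apex r"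
  by (simp add: apex_def field_simps power2_eq_square)

lemma dotp_diff_left: "dotp d (x - y) z = dotp d x z - dotp d y z"
  by (simp add: dotp_def algebra_simps sum_subtractf)

lemma dotp_diff_right: "dotp d z (x - y) = dotp d z x - dotp d z y"
  by (simp add: dotp_def algebra_simps sum_subtractf)

text \<open>The vertices are not orthonormal, but each correction term depends on one index only and
  so cancels in inner products of differences.\<close>

lemma dotp_vert:
  assumes "r \<ge> 1" "i \<le> r" "j \<le> r"
  shows "dotp r (vert r i) (vert r j)
    = of_bool (i = j) + (if i = r then apex r else 0) + (if j = r then apex r else 0)"
proof -
  have *: "dotp r (vert r i) (vert r j)
      = (\<Sum>k<r. (if i < r then of_bool (i = k) else apex r) * (if j < r then of_bool (j = k) else apex r))"
    unfolding dotp_def by (intro sum.cong refl) (simp add: vert_def)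
  consider "i < r" "j < r" | "i < r" "j = r" | "i = r" "j < r" | "i = r" "j = r"
    using assms by linarith
  then show ?thesis
  proof cases
    case 1
    have "(\<Sum>k<r. of_bool (i = k) * of_bool (j = k)) = (\<Sum>k<r. if k = i then of_bool (i = j) else (0::real))"
      by (intro sum.cong refl) auto
    then show ?thesis using 1 * by simp
  next
    case 2
    have "(\<Sum>k<r. of_bool (i = k) * apex r) = (\<Sum>k<r. if k = i then apex r else 0)"
      by (intro sum.cong refl) auto
    then show ?thesis using 2 * by simp
  next
    case 3
    have "(\<Sum>k<r. apex r * of_bool (j = k)) = (\<Sum>k<r. if k = j then apex r else 0)"
      by (intro sum.cong refl) auto
    then show ?thesis using 3 * by simp
  next
    case 4
    then show ?thesis using * apex_eq[OF assms(1)] by (simp add: mult.assoc)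
  qed
qed

lemma dotp_roots:
  assumes "r \<ge> 1" "i \<le> r" "j \<le> r" "k \<le> r" "l \<le> r"
  shows "dotp r (vert r i - vert r j) (vert r k - vert r l)
    = of_bool (i = k) - of_bool (i = l) - of_bool (j = k) + of_bool (j = l)"
  using assms by (simp add: dotp_diff_left dotp_diff_right dotp_vert)

lemma dotp_root_self:
  assumes "r \<ge> 1" "i \<le> r" "j \<le> r" "i \<noteq> j"
  shows "dotp r (vert r i - vert r j) (vert r i - vert r j) = 2"
  using assms by (simp add: dotp_roots)

text \<open>Equal roots have inner product 2, and the sum of the four signed Kronecker deltas
  reaches 2 only if the index pairs coincide.\<close>

lemma root_eq_iff:
  assumes "r \<ge> 1" "i \<le> r" "j \<le> r" "k \<le> r" "l \<le> r" "i \<noteq> j"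
  shows "vert r i - vert r j = vert r k - vert r l \<longleftrightarrow> i = k \<and> j = l"
proof
  assume "vert r i - vert r j = vert r k - vert r l"
  then have "dotp r (vert r i - vert r j) (vert r k - vert r l) = 2"
    using dotp_root_self[OF assms(1-3,6)] by simp
  then have "of_bool (i = k) - of_bool (i = l) - of_bool (j = k) + of_bool (j = l) = (2::real)"
    by (simp only: dotp_roots[OF assms(1-5)])
  then show "i = k \<and> j = l" by (auto simp: of_bool_def split: if_splits)
qed simp

lemma root_eq_zero_iff:
  assumes "r \<ge> 1" "i \<le> r" "j \<le> r"
  shows "vert r i - vert r j = 0 \<longleftrightarrow> i = j"
  using root_eq_iff[OF assms assms(2,2)] by auto

lemma cartan_int_roots:
  assumes "r \<ge> 1" "i \<le> r" "j \<le> r" "k \<le> r" "l \<le> r" "i \<noteq> j"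
  shows "cartan_int r (vert r k - vert r l) (vert r i - vert r j)
    = of_bool (k = i) - of_bool (k = j) - of_bool (l = i) + of_bool (l = j)"
proof -
  have "2 * dotp r (vert r k - vert r l) (vert r i - vert r j) / dotp r (vert r i - vert r j) (vert r i - vert r j)
      = of_int (of_bool (k = i) - of_bool (k = j) - of_bool (l = i) + of_bool (l = j))"
    using assms by (simp add: dotp_root_self dotp_roots)
  then show ?thesis by (simp only: cartan_int_def floor_of_int)
qed

lemma roots_span:
  assumes "r \<ge> 1" "v \<in> rvec r"
  shows "\<exists>c. v = (\<Sum>a\<in>roots r. (\<lambda>i. c a * a i))"
proof -
  interpret F: vector_space "\<lambda>(c::real) (f :: nat \<Rightarrow> real) i. c * f i"
    by unfold_locales (auto simp: fun_eq_iff algebra_simps)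
  have fin: "finite (roots r)"
    using finite_image_set2[of "\<lambda>i. i \<le> r" "\<lambda>j. j \<le> r" "\<lambda>i j. vert r i - vert r j"] by (simp add: roots_def)
  have sum_app: "sum f {..<m} j = (\<Sum>i<m. f i j)" for f :: "nat \<Rightarrow> nat \<Rightarrow> real" and m j
    by (induction m) simp_all
  define ones where "ones j = (if j < r then 1 else 0 :: real)" for j
  \<comment> \<open>The roots \<open>vert r i - vert r r\<close> add up to this factor, which equals
    \<open>- sqrt (1 + r)\<close>, times the all-ones vector. With that vector in the span, so is
    every standard basis vector.\<close>
  have nz: "1 - real r * apex r \<noteq> 0" using assms(1) by (simp add: apex_def)
  have "(\<Sum>i<r. vert r i - vert r r) = (\<lambda>j. (1 - real r * apex r) * ones j)"
  proof
    fix j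
    have "(\<Sum>i<r. vert r i - vert r r) j = (\<Sum>i<r. vert r i j - vert r r j)"
      by (simp add: sum_app)
    also have "\<dots> = (1 - real r * apex r) * ones j"
      by (cases "j < r") (simp_all add: vert_def ones_def sum_subtractf of_bool_def)
    finally show "(\<Sum>i<r. vert r i - vert r r) j = (1 - real r * apex r) * ones j" .
  qed
  moreover have "(\<Sum>i<r. vert r i - vert r r) \<in> F.span (roots r)"
    by (intro F.span_sum F.span_base rootsI) auto
  ultimately have "(\<lambda>j. (1 - real r * apex r) * ones j) \<in> F.span (roots r)" by simp
  from F.span_scale[OF this, of "1 / (1 - real r * apex r)"]
  have "(\<lambda>j. 1 / (1 - real r * apex r) * ((1 - real r * apex r) * ones j)) \<in> F.span (roots r)" .
  then have ones: "ones \<in> F.span (roots r)" using nz by simp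
  define z where "z = (\<Sum>i<r. (\<lambda>j. v i * (vert r i - vert r r) j)) + (\<lambda>j. ((\<Sum>i<r. v i) * apex r) * ones j)"
  have "z \<in> F.span (roots r)"
    unfolding z_def
    by (intro F.span_add F.span_sum F.span_scale[OF ones] F.span_scale[OF F.span_base] rootsI) auto
  moreover have "z = v"
  proof
    fix j
    show "z j = v j"
    proof (cases "j < r")
      case True
      have "z j = (\<Sum>i<r. v i * (of_bool (i = j) - apex r)) + (\<Sum>i<r. v i) * apex r"
        using True by (simp add: z_def sum_app vert_def ones_def)
      also have "\<dots> = (\<Sum>i<r. v i * of_bool (i = j))"
        by (simp add: right_diff_distrib sum_subtractf sum_distrib_right)
      also have "\<dots> = (\<Sum>i<r. if i = j then v j else 0)" by (intro sum.cong refl) auto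
      finally show ?thesis using True by simp
    next
      case False
      then show ?thesis using assms(2) by (simp add: z_def sum_app vert_def ones_def rvec_def)
    qed
  qed
  ultimately show ?thesis unfolding F.span_finite[OF fin] by auto
qed

lemma root_system_roots:
  assumes "r \<ge> 1"
  shows "root_system0 r (roots r)"
  unfolding root_system0_def
proof (intro conjI ballI)
  show "finite (roots r)"
    using finite_image_set2[of "\<lambda>i. i \<le> r" "\<lambda>j. j \<le> r" "\<lambda>i j. vert r i - vert r j"] by (simp add: roots_def)
  show "roots r \<subseteq> rvec r" by (auto simp: roots_def rvec_def vert_def)
  show "0 \<in> roots r" using rootsI[of 0 r 0] by simp
  show "\<exists>c. v = (\<Sum>a\<in>roots r. (\<lambda>i. c a * a i))" if "v \<in> rvec r" for v
    using roots_span[OF assms that] .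
next
  fix a b assume "a \<in> roots r - {0}" "b \<in> roots r"
  then obtain i j k l where ij: "i \<le> r" "j \<le> r" "a = vert r i - vert r j" "a \<noteq> 0"
    and kl: "k \<le> r" "l \<le> r" "b = vert r k - vert r l"
    unfolding roots_def by blast
  have "i \<noteq> j" using ij(3,4) by auto
  note ij = ij(1,2) \<open>i \<noteq> j\<close> ij(3)
  define N :: int where "N = of_bool (k = i) - of_bool (k = j) - of_bool (l = i) + of_bool (l = j)"
  have N: "2 * dotp r b a / dotp r a a = of_int N"
    using assms ij(1-3) kl(1,2) unfolding ij(4) kl(3) by (simp add: dotp_root_self dotp_roots N_def)
  then show "\<exists>n::int. 2 * dotp r b a / dotp r a a = of_int n" by blast
  \<comment> \<open>On differences of vertices, the reflection in \<open>vert r i - vert r j\<close>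
    acts as the transposition of \<open>i\<close> and \<open>j\<close>.\<close>
  define s where "s m = (if m = i then j else if m = j then i else m)" for m
  have s: "vert r (s m) t = vert r m t - (of_bool (m = i) - of_bool (m = j)) * (vert r i t - vert r j t)" for m t
    using ij(3) by (auto simp: s_def)
  have "(\<lambda>t. b t - 2 * dotp r b a / dotp r a a * a t) = vert r (s k) - vert r (s l)"
    unfolding N by (rule ext) (simp add: s ij(4) kl(3) N_def algebra_simps)
  moreover have "s k \<le> r" "s l \<le> r" using ij kl by (auto simp: s_def)
  ultimately show "(\<lambda>t. b t - 2 * dotp r b a / dotp r a a * a t) \<in> roots r"
    using rootsI by simp
qed

section \<open>The Lie torus structure of the special linear algebra\<close>

lemma zgen_superset: "S \<subseteq> zgen S"
  unfolding zgen_def by blast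

lemma zgen_diff: "x \<in> zgen S \<Longrightarrow> y \<in> zgen S \<Longrightarrow> x - y \<in> zgen S"
  unfolding zgen_def by blast

lemma zgen_zero: "0 \<in> zgen S"
  unfolding zgen_def by blast

lemma zgen_add:
  assumes "x \<in> zgen S" "y \<in> zgen S"
  shows "x + y \<in> zgen S"
  using zgen_diff[OF assms(1) zgen_diff[OF zgen_zero assms(2)]] by simp

lemma zgen_lat: "zgen (lat n) = lat n"
proof
  show "zgen (lat n) \<subseteq> lat n" unfolding zgen_def by (rule Inter_lower) (auto simp del: lat_zero)
qed (rule zgen_superset)

section \<open>Matrix units and commutators\<close>

definition mat_unit :: "nat \<Rightarrow> nat \<Rightarrow> 'a::zero \<Rightarrow> nat \<Rightarrow> nat \<Rightarrow> 'a" where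
  "mat_unit i j x = (\<lambda>k l. if k = i \<and> l = j then x else 0)"

lemma mat_unit_same [simp]: "mat_unit i j x i j = x"
  by (simp add: mat_unit_def)

lemma mat_unit_matn: "i \<le> r \<Longrightarrow> j \<le> r \<Longrightarrow> mat_unit i j x \<in> matn r"
  by (auto simp: matn_def mat_unit_def)

lemma mat_unit_add: "mat_unit i j (x + y) = mat_unit i j x + mat_unit i j (y :: 'a::monoid_add)"
  by (intro ext) (simp add: mat_unit_def)

lemma mat_unit_diff: "mat_unit i j (x - y) = mat_unit i j x - mat_unit i j (y :: 'a::group_add)"
  by (intro ext) (simp add: mat_unit_def)

lemma mat_unit_zero [simp]: "mat_unit i j 0 = 0"
  by (intro ext) (simp add: mat_unit_def)

lemma sum_mat_apply: "sum f A i j = (\<Sum>a\<in>A. f a i j)"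
  for f :: "'c \<Rightarrow> nat \<Rightarrow> nat \<Rightarrow> 'a::comm_monoid_add"
  by (induction A rule: infinite_finite_induct) simp_all

lemma matn_expand:
  assumes "X \<in> matn r"
  shows "X = (\<Sum>i\<le>r. \<Sum>j\<le>r. mat_unit i j (X i j))"
proof (intro ext)
  fix k l
  have "(\<Sum>i\<le>r. \<Sum>j\<le>r. mat_unit i j (X i j)) k l
      = (\<Sum>i\<le>r. \<Sum>j\<le>r. if l = j then (if k = i then X k l else 0) else 0)"
    unfolding sum_mat_apply by (intro sum.cong refl) (simp add: mat_unit_def)
  also have "\<dots> = (\<Sum>i\<le>r. if k = i then (if l \<le> r then X k l else 0) else 0)"
    by (intro sum.cong refl) simp
  also have "\<dots> = X k l" using assms by (auto simp: matn_def not_le)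
  finally show "X k l = (\<Sum>i\<le>r. \<Sum>j\<le>r. mat_unit i j (X i j)) k l" by simp
qed

lemma mat_mult_matn: "mat_mult r X Y \<in> matn r"
  by (auto simp: matn_def mat_mult_def)

lemma mat_comm_matn: "mat_comm r X Y \<in> matn r"
  by (auto simp: matn_def mat_comm_def mat_mult_def)

lemma mat_mult_unit:
  assumes "i \<le> r" "j \<le> r" "k \<le> r" "l \<le> r"
  shows "mat_mult r (mat_unit i j x) (mat_unit k l y) = (if j = k then mat_unit i l (x * y) else 0)"
proof (intro ext)
  fix a b
  have "(\<Sum>c\<le>r. mat_unit i j x a c * mat_unit k l y c b)
      = (\<Sum>c\<le>r. if j = c then (if a = i \<and> j = k \<and> b = l then x * y else 0) else 0)"
    by (intro sum.cong refl) (auto simp: mat_unit_def)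
  also have "\<dots> = (if a = i \<and> j = k \<and> b = l then x * y else 0)" using assms by simp
  finally show "mat_mult r (mat_unit i j x) (mat_unit k l y) a b
      = (if j = k then mat_unit i l (x * y) else 0) a b"
    using assms by (auto simp: mat_mult_def mat_unit_def)
qed

lemma mat_comm_unit:
  assumes "i \<le> r" "j \<le> r" "k \<le> r" "l \<le> r"
  shows "mat_comm r (mat_unit i j x) (mat_unit k l y)
    = (if j = k then mat_unit i l (x * y) else 0) - (if l = i then mat_unit k j (y * x) else 0)"
  using assms by (simp add: mat_comm_def mat_mult_unit)

lemma mat_comm_diag:
  assumes "i \<le> r" "X \<in> matn r"
  shows "mat_comm r (mat_unit i i c) X = (\<lambda>k l. (if k = i then c * X k l else 0) - (if l = i then X k l * c else 0))"
proof (intro ext)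
  fix k l
  have 1: "(\<Sum>m\<le>r. mat_unit i i c k m * X m l) = (if k = i then c * X k l else 0)"
  proof -
    have "(\<Sum>m\<le>r. mat_unit i i c k m * X m l) = (\<Sum>m\<le>r. if i = m then (if k = i then c * X k l else 0) else 0)"
      by (intro sum.cong refl) (auto simp: mat_unit_def)
    then show ?thesis using assms by simp
  qed
  have 2: "(\<Sum>m\<le>r. X k m * mat_unit i i c m l) = (if l = i then X k l * c else 0)"
  proof -
    have "(\<Sum>m\<le>r. X k m * mat_unit i i c m l) = (\<Sum>m\<le>r. if i = m then (if l = i then X k l * c else 0) else 0)"
      by (intro sum.cong refl) (auto simp: mat_unit_def)
    then show ?thesis using assms by simp
  qed
  have "mat_comm r (mat_unit i i c) X k l = (if k \<le> r \<and> l \<le> r then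
      (\<Sum>m\<le>r. mat_unit i i c k m * X m l) - (\<Sum>m\<le>r. X k m * mat_unit i i c m l) else 0)"
    by (simp add: mat_comm_def mat_mult_def)
  then show "mat_comm r (mat_unit i i c) X k l = (if k = i then c * X k l else 0) - (if l = i then X k l * c else 0)"
    unfolding 1 2 using assms by (auto simp: matn_def)
qed

lemma mat_mult_add_left: "mat_mult r (X + Y) Z = mat_mult r X Z + mat_mult r Y Z"
  by (intro ext) (simp add: mat_mult_def distrib_right sum.distrib)

lemma mat_mult_add_right: "mat_mult r Z (X + Y) = mat_mult r Z X + mat_mult r Z Y"
  by (intro ext) (simp add: mat_mult_def distrib_left sum.distrib)

lemma mat_comm_add_left: "mat_comm r (X + Y) Z = mat_comm r X Z + mat_comm r Y Z"
  by (simp add: mat_comm_def mat_mult_add_left mat_mult_add_right)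

lemma mat_comm_diff_left: "mat_comm r (X - Y) Z = mat_comm r X Z - mat_comm r Y Z"
  using mat_comm_add_left[of r "X - Y" Y Z] by simp

lemma mat_comm_anti: "mat_comm r X Y = - mat_comm r Y X"
  by (simp add: mat_comm_def)

lemma mat_comm_add_right: "mat_comm r Z (X + Y) = mat_comm r Z X + mat_comm r Z Y"
  by (simp add: mat_comm_def mat_mult_add_left mat_mult_add_right)

lemma mat_comm_zero [simp]: "mat_comm r 0 X = 0" "mat_comm r X 0 = 0"
  by (intro ext, simp add: mat_comm_def mat_mult_def)+

lemma vector_space_mat_scale:
  assumes "vector_space sc"
  shows "vector_space (mat_scale sc)"
proof -
  interpret vector_space sc by fact
  show ?thesis
    by unfold_locales
       (auto simp: mat_scale_def fun_eq_iff scale_left_distrib scale_right_distrib)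
qed

context vector_space
begin

text \<open>\<open>direct_sum_decomp\<close> asks for one summand per index, so terms from the same
  \<open>G i\<close> have to be merged; this is the case \<open>i \<in> S\<close>.\<close>

lemma span_UN_finite_sum:
  assumes "x \<in> span (\<Union>i\<in>I. G i)" "\<And>i. i \<in> I \<Longrightarrow> subspace (G i)"
  shows "\<exists>S c. finite S \<and> S \<subseteq> I \<and> (\<forall>i\<in>S. c i \<in> G i) \<and> x = sum c S"
  using assms(1)
proof (induction rule: span_induct_alt)
  case base
  show ?case by (intro exI[of _ "{}"]) simp
next
  case (step a g y)
  then obtain i S c where i: "i \<in> I" "g \<in> G i"
    and S: "finite S" "S \<subseteq> I" "\<forall>i\<in>S. c i \<in> G i" "y = sum c S" by blast
  have "scale a g \<in> G i" using i assms(2) subspace_scale by blast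
  show ?case
  proof (cases "i \<in> S")
    case True
    have "c i + scale a g \<in> G i" using S(3) True \<open>scale a g \<in> G i\<close> i(1) assms(2) subspace_add by blast
    moreover have "sum (c(i := c i + scale a g)) S = scale a g + y"
      using True S(1,4) by (simp add: sum.remove[of S i] add.assoc add.left_commute)
    ultimately show ?thesis using S by (intro exI[of _ S] exI[of _ "c(i := c i + scale a g)"]) auto
  next
    case False
    have "sum (c(i := scale a g)) (insert i S) = scale a g + sum (c(i := scale a g)) S"
      using False S(1) by simp
    also have "sum (c(i := scale a g)) S = sum c S" by (intro sum.cong) (use False in auto)
    finally have "scale a g + y = sum (c(i := scale a g)) (insert i S)" using S(4) by simp
    then show ?thesis
      using False S \<open>scale a g \<in> G i\<close> i(1) by (intro exI[of _ "insert i S"] exI[of _ "c(i := scale a g)"]) auto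
  qed
qed

end

section \<open>The grading of the special linear algebra by roots and lattice degrees\<close>

locale sl_torus = torus_basis sc n u
  for sc :: "'k::field \<Rightarrow> 'a::ring_1 \<Rightarrow> 'a" and n u +
  fixes r :: nat
  assumes r_pos: "r \<ge> 1"
begin

sublocale M: vector_space "mat_scale sc"
  by (rule vector_space_mat_scale) (rule vector_space_axioms)

abbreviation "sl \<equiv> sl_carrier sc r"
abbreviation "br \<equiv> mat_comm r"

lemma br_scale_left: "br (mat_scale sc c X) Y = mat_scale sc c (br X Y)"
  by (intro ext)
     (simp add: mat_comm_def mat_mult_def mat_scale_def scale_right_diff_distrib scale_sum_right
       flip: scale_mult_left scale_mult_right)

lemma br_scale_right: "br X (mat_scale sc c Y) = mat_scale sc c (br X Y)"
  by (intro ext)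
     (simp add: mat_comm_def mat_mult_def mat_scale_def scale_right_diff_distrib scale_sum_right
       flip: scale_mult_left scale_mult_right)

lemma br_span:
  assumes X: "X \<in> M.span S" and Y: "Y \<in> M.span T" and W: "M.subspace W"
    and ST: "\<And>s t. s \<in> S \<Longrightarrow> t \<in> T \<Longrightarrow> br s t \<in> W"
  shows "br X Y \<in> W"
proof -
  have 1: "br s Y \<in> W" if "s \<in> S" for s
    using Y
  proof (induction rule: M.span_induct_alt)
    case base
    have "br s 0 \<in> W" using M.subspace_0[OF W] by simp
    then show ?case .
  next
    case (step c t Y)
    then have "br s (mat_scale sc c t + Y) \<in> W"
      using ST[OF that] W by (simp add: mat_comm_add_right br_scale_right M.subspace_add M.subspace_scale)
    then show ?case .
  qed
  show ?thesis
    using X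
  proof (induction rule: M.span_induct_alt)
    case base
    have "br 0 Y \<in> W" using M.subspace_0[OF W] by simp
    then show ?case .
  next
    case (step c s X)
    then have "br (mat_scale sc c s + X) Y \<in> W"
      using 1 W by (simp add: mat_comm_add_left br_scale_left M.subspace_add M.subspace_scale)
    then show ?case .
  qed
qed

lemma matn_subspace: "M.subspace (matn r)"
  by (auto simp: M.subspace_def matn_def mat_scale_def)

lemma sl_subspace: "M.subspace sl"
  unfolding sl_carrier_def by (rule M.subspace_span)

lemma br_in_sl: "X \<in> matn r \<Longrightarrow> Y \<in> matn r \<Longrightarrow> br X Y \<in> sl"
  unfolding sl_carrier_def by (rule M.span_base) blast

lemma sl_matn: "sl \<subseteq> matn r"
  unfolding sl_carrier_def
  by (rule M.span_minimal[OF _ matn_subspace]) (auto simp: mat_comm_matn)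

lemma br_sl: "X \<in> sl \<Longrightarrow> Y \<in> sl \<Longrightarrow> br X Y \<in> sl"
  using br_in_sl sl_matn by blast

lemma mat_unit_scale: "mat_unit i j (sc c x) = mat_scale sc c (mat_unit i j x)"
  by (intro ext) (simp add: mat_unit_def mat_scale_def)

lemma matn_span: "matn r \<subseteq> M.span {mat_unit i j x | i j x. i \<le> r \<and> j \<le> r}"
proof
  fix X :: "nat \<Rightarrow> nat \<Rightarrow> 'a" assume X: "X \<in> matn r"
  have "(\<Sum>i\<le>r. \<Sum>j\<le>r. mat_unit i j (X i j)) \<in> M.span {mat_unit i j x | i j x. i \<le> r \<and> j \<le> r}"
    by (intro M.span_sum M.span_base) blast
  then show "X \<in> M.span {mat_unit i j x | i j x. i \<le> r \<and> j \<le> r}"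
    by (subst matn_expand[OF X])
qed

lemma mat_unit_span: "mat_unit i j x \<in> M.span ((\<lambda>l. mat_unit i j (u l)) ` lat n)"
proof -
  have "x \<in> span (u ` lat n)" using u_span by simp
  then show ?thesis
  proof (induction rule: span_induct_alt)
    case base
    have "mat_unit i j 0 \<in> M.span ((\<lambda>l. mat_unit i j (u l)) ` lat n)" using M.span_zero by simp
    then show ?case .
  next
    case (step c y x)
    then have "mat_unit i j y \<in> M.span ((\<lambda>l. mat_unit i j (u l)) ` lat n)"
      by (intro M.span_base) blast
    then have "mat_unit i j (sc c y + x) \<in> M.span ((\<lambda>l. mat_unit i j (u l)) ` lat n)"
      unfolding mat_unit_add mat_unit_scale using step(2) by (intro M.span_add M.span_scale)
    then show ?case .
  qed
qed

lemma matn_span_u: "matn r \<subseteq> M.span {mat_unit i j (u l) | i j l. i \<le> r \<and> j \<le> r \<and> l \<in> lat n}"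
proof -
  have "mat_unit i j x \<in> M.span {mat_unit i j (u l) | i j l. i \<le> r \<and> j \<le> r \<and> l \<in> lat n}"
    if "i \<le> r" "j \<le> r" for i j x
    using mat_unit_span[of i j x] by (rule M.span_mono[THEN subsetD, rotated]) (use that in auto)
  then have "M.span {mat_unit i j x | i j x. i \<le> r \<and> j \<le> r}
      \<subseteq> M.span {mat_unit i j (u l) | i j l. i \<le> r \<and> j \<le> r \<and> l \<in> lat n}"
    by (intro M.span_minimal M.subspace_span) auto
  then show ?thesis using matn_span by blast
qed

lemma mat_unit_sl:
  assumes "i \<le> r" "j \<le> r" "i \<noteq> j"
  shows "mat_unit i j x \<in> sl"
proof -
  have "br (mat_unit i i 1) (mat_unit i j x) = mat_unit i j x"
    using assms by (simp add: mat_comm_unit)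
  then show ?thesis using br_in_sl[OF mat_unit_matn mat_unit_matn] assms by metis
qed

lemma mat_unit_diag_sl:
  assumes "i \<le> r" "j \<le> r" "i \<noteq> j"
  shows "mat_unit i i x - mat_unit j j x \<in> sl"
proof -
  have "br (mat_unit i j x) (mat_unit j i 1) = mat_unit i i x - mat_unit j j x"
    using assms by (simp add: mat_comm_unit)
  then show ?thesis using br_in_sl[OF mat_unit_matn mat_unit_matn] assms by metis
qed

text \<open>The grading is set up on all of \<open>matn r\<close> because the matrix product is
  homogeneous there (\<open>mat_mult_Mg\<close>), while \<open>sl\<close> is not closed under that
  product. The component of root 0 is diagonal, since \<open>vert r i - vert r j\<close> vanishes
  there only for \<open>i = j\<close>.\<close>

definition Mg :: "(nat \<Rightarrow> real) \<Rightarrow> (nat \<Rightarrow> int) \<Rightarrow> (nat \<Rightarrow> nat \<Rightarrow> 'a) set" where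
  "Mg a l = {X \<in> matn r. \<forall>i j. X i j \<in> span {u l} \<and> (a \<noteq> vert r i - vert r j \<longrightarrow> X i j = 0)}"

lemma Mg_entry: "X \<in> Mg a l \<Longrightarrow> X i j \<noteq> 0 \<Longrightarrow> a = vert r i - vert r j"
  by (auto simp: Mg_def)

definition Lg :: "(nat \<Rightarrow> real) \<Rightarrow> (nat \<Rightarrow> int) \<Rightarrow> (nat \<Rightarrow> nat \<Rightarrow> 'a) set" where
  "Lg a l = Mg a l \<inter> sl"

lemma Mg_subspace: "M.subspace (Mg a l)"
  unfolding M.subspace_def Mg_def
  by (auto simp: matn_def mat_scale_def intro: span_zero span_add span_scale)

lemma Lg_subspace: "M.subspace (Lg a l)"
  unfolding Lg_def by (rule M.subspace_inter[OF Mg_subspace sl_subspace])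

lemma span_u_mult:
  assumes "x \<in> span {u l}" "y \<in> span {u m}" "l \<in> lat n" "m \<in> lat n"
  shows "x * y \<in> span {u (l + m)}"
proof -
  obtain c d where "x = sc c (u l)" "y = sc d (u m)" using assms by (auto simp: span_singleton)
  then have "x * y = sc (c * d * \<tau> l m) (u (l + m))"
    using assms(3,4) by (simp add: u_mult mult_ac flip: scale_mult_left scale_mult_right)
  then show ?thesis by (auto simp: span_singleton)
qed

lemma mat_mult_Mg:
  assumes "X \<in> Mg a l" "Y \<in> Mg b m" "l \<in> lat n" "m \<in> lat n"
  shows "mat_mult r X Y \<in> Mg (a + b) (l + m)"
  unfolding Mg_def
proof (intro CollectI conjI allI impI)
  show "mat_mult r X Y \<in> matn r" by (rule mat_mult_matn)
  fix i j
  show "mat_mult r X Y i j \<in> span {u (l + m)}"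
    using assms by (auto simp: mat_mult_def Mg_def intro!: span_sum span_u_mult span_zero)
  assume ab: "a + b \<noteq> vert r i - vert r j"
  show "mat_mult r X Y i j = 0"
  proof (rule ccontr)
    assume "mat_mult r X Y i j \<noteq> 0"
    then have "(\<Sum>k\<le>r. X i k * Y k j) \<noteq> 0" by (auto simp: mat_mult_def split: if_splits)
    then obtain k where "X i k * Y k j \<noteq> 0" by (rule sum.not_neutral_contains_not_neutral)
    then have "X i k \<noteq> 0" "Y k j \<noteq> 0" by auto
    then have "a = vert r i - vert r k" "b = vert r k - vert r j" using assms(1,2) by (auto simp: Mg_def)
    then show False using ab by simp
  qed
qed

lemma br_Mg:
  assumes "X \<in> Mg a l" "Y \<in> Mg b m" "l \<in> lat n" "m \<in> lat n"
  shows "br X Y \<in> Mg (a + b) (l + m)"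
  using mat_mult_Mg[OF assms] mat_mult_Mg[OF assms(2,1,4,3)] M.subspace_diff[OF Mg_subspace]
  by (simp add: mat_comm_def add.commute)

lemma mat_unit_Mg:
  assumes "i \<le> r" "j \<le> r" "x \<in> span {u l}"
  shows "mat_unit i j x \<in> Mg (vert r i - vert r j) l"
  using assms by (auto simp: Mg_def mat_unit_matn) (auto simp: mat_unit_def span_zero split: if_splits)

lemma u_in_span: "u l \<in> span {u l}"
  by (rule span_base) simp

lemma homog_span: "x \<in> homog l \<Longrightarrow> l \<in> lat n \<Longrightarrow> span {x} = span {u l}"
proof -
  assume "x \<in> homog l" "l \<in> lat n"
  then obtain c where c: "c \<noteq> 0" "x = sc c (u l)" by (auto simp: homog_def)
  have "u l = sc (inverse c) x" using c by simp
  then have "u l \<in> span {x}" by (metis span_base span_scale singletonI)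
  moreover have "x \<in> span {u l}" using c u_in_span span_scale by simp
  ultimately show ?thesis by (simp add: span_eq)
qed

text \<open>Every homogeneous unit serves as a generator. The freedom is used in
  \<open>Lg_coroot\<close>: with the exact inverse of \<open>u l\<close> as the entry in degree
  \<open>- l\<close>, the bracket is the coroot without a scalar factor.\<close>

lemma Lg_root:
  assumes "i \<le> r" "j \<le> r" "i \<noteq> j" "l \<in> lat n" "x \<in> homog l"
  shows "Lg (vert r i - vert r j) l = M.span {mat_unit i j x}"
proof
  have "x \<in> span {u l}" using homog_span[OF assms(5,4)] span_base[of x "{x}"] by simp
  then have "mat_unit i j x \<in> Lg (vert r i - vert r j) l"
    using assms by (simp add: Lg_def mat_unit_Mg mat_unit_sl)
  then show "M.span {mat_unit i j x} \<subseteq> Lg (vert r i - vert r j) l"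
    by (intro M.span_minimal Lg_subspace) simp
  show "Lg (vert r i - vert r j) l \<subseteq> M.span {mat_unit i j x}"
  proof
    fix X assume "X \<in> Lg (vert r i - vert r j) l"
    then have X: "X \<in> matn r" "\<And>k m. X k m \<in> span {u l}"
      "\<And>k m. X k m \<noteq> 0 \<Longrightarrow> vert r i - vert r j = vert r k - vert r m"
      by (auto simp: Lg_def Mg_def)
    obtain c where c: "X i j = sc c x" using X(2)[of i j] homog_span[OF assms(5,4)] by (auto simp: span_singleton)
    have "X k m = 0" if "\<not> (k = i \<and> m = j)" for k m
    proof (rule ccontr)
      assume nz: "X k m \<noteq> 0"
      then have "k \<le> r" "m \<le> r" using X(1) by (auto simp: matn_def not_less[symmetric])
      then show False using X(3)[OF nz] root_eq_iff[OF r_pos assms(1,2) _ _ assms(3)] that by blast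
    qed
    then have "X = mat_scale sc c (mat_unit i j x)"
      using c by (intro ext) (auto simp: mat_scale_def mat_unit_def)
    then show "X \<in> M.span {mat_unit i j x}" by (auto simp: M.span_singleton)
  qed
qed

lemma u_homog: "u l \<in> homog l"
  by (auto simp: homog_def intro!: exI[of _ 1])

lemma mat_unit_eq_0_iff: "mat_unit i j x = 0 \<longleftrightarrow> x = 0"
  by (metis mat_unit_same mat_unit_zero zero_fun_apply)

lemma Lg_root_nonzero:
  assumes "i \<le> r" "j \<le> r" "i \<noteq> j" "l \<in> lat n"
  shows "Lg (vert r i - vert r j) l \<noteq> {0}"
proof -
  have "mat_unit i j (u l) \<in> Lg (vert r i - vert r j) l"
    unfolding Lg_root[OF assms u_homog] by (rule M.span_base) simp
  then show ?thesis using u_nonzero[OF assms(4)] mat_unit_eq_0_iff by blast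
qed

lemma span_one: "sc c 1 \<in> span {u 0}"
  using homog_span[OF one_homog] by (metis lat_zero rangeI span_singleton)

lemma diag_Lg_zero:
  assumes "i \<le> r" "j \<le> r" "i \<noteq> j"
  shows "mat_unit i i 1 - mat_unit j j 1 \<in> Lg 0 0"
proof -
  have "mat_unit k k 1 \<in> Mg 0 0" if "k \<le> r" for k
    using mat_unit_Mg[OF that that, of "1" 0] span_one[of 1] by simp
  then show ?thesis using assms M.subspace_diff[OF Mg_subspace] mat_unit_diag_sl by (simp add: Lg_def)
qed

lemma Lg_zero_nonzero: "Lg 0 0 \<noteq> {0}"
proof
  assume "Lg 0 0 = {0}"
  then have "mat_unit 0 0 1 - mat_unit 1 1 1 = (0 :: nat \<Rightarrow> nat \<Rightarrow> 'a)"
    using diag_Lg_zero[of 0 1] r_pos by simp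
  then have "(mat_unit 0 0 1 - mat_unit 1 1 1) 0 0 = (0 :: 'a)" by (metis zero_fun_apply)
  then show False by (simp add: mat_unit_def)
qed

lemma Lg_support:
  assumes "Lg a l \<noteq> {0}"
  shows "a \<in> roots r"
proof -
  obtain X where "X \<in> Lg a l" "X \<noteq> 0" using assms M.subspace_0[OF Lg_subspace] by blast
  then obtain i j where "X i j \<noteq> 0" by (metis ext zero_fun_apply)
  moreover have "i \<le> r" "j \<le> r"
    using \<open>X \<in> Lg a l\<close> \<open>X i j \<noteq> 0\<close> by (auto simp: Lg_def Mg_def matn_def not_less[symmetric])
  moreover have "a = vert r i - vert r j"
    using \<open>X \<in> Lg a l\<close> \<open>X i j \<noteq> 0\<close> Mg_entry[of X a l i j] by (simp add: Lg_def)
  ultimately show ?thesis using rootsI by simp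
qed

text \<open>A commutator expands into brackets of matrix units with entries \<open>u l\<close>. Each
  of these is homogeneous and is itself a commutator, so it lies in some \<open>Lg\<close>.\<close>

lemma sl_span: "sl \<subseteq> M.span (\<Union>(a, l)\<in>zgen (roots r) \<times> lat n. Lg a l)"
proof -
  let ?W = "M.span (\<Union>(a, l)\<in>zgen (roots r) \<times> lat n. Lg a l)"
  have "br X Y \<in> ?W" if X: "X \<in> matn r" and Y: "Y \<in> matn r" for X Y
  proof (rule br_span[OF matn_span_u[THEN subsetD, OF X] matn_span_u[THEN subsetD, OF Y]])
    fix s t
    assume "s \<in> {mat_unit i j (u l) | i j l. i \<le> r \<and> j \<le> r \<and> l \<in> lat n}"
      and "t \<in> {mat_unit i j (u l) | i j l. i \<le> r \<and> j \<le> r \<and> l \<in> lat n}"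
    then obtain i j l i' j' l' where st: "i \<le> r" "j \<le> r" "l \<in> lat n" "s = mat_unit i j (u l)"
      "i' \<le> r" "j' \<le> r" "l' \<in> lat n" "t = mat_unit i' j' (u l')" by blast
    let ?a = "vert r i - vert r j" and ?b = "vert r i' - vert r j'"
    have "br s t \<in> Mg (?a + ?b) (l + l')"
      unfolding st(4,8) by (intro br_Mg mat_unit_Mg u_in_span st)
    moreover have "br s t \<in> sl" unfolding st(4,8) by (intro br_in_sl mat_unit_matn st)
    ultimately have "br s t \<in> Lg (?a + ?b) (l + l')" by (simp add: Lg_def)
    moreover have "?a + ?b \<in> zgen (roots r)"
      using zgen_superset rootsI st by (intro zgen_add) blast+
    moreover have "l + l' \<in> lat n" using st by blast
    ultimately show "br s t \<in> ?W" by (intro M.span_base) blast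
  qed (rule M.subspace_span)
  then show ?thesis unfolding sl_carrier_def[of sc r] by (intro M.span_minimal M.subspace_span) auto
qed

text \<open>Choose a nonzero entry \<open>(i, j)\<close> of \<open>c s\<close>. Its position
  determines the root and its coordinate in degree \<open>l\<close> determines the lattice degree,
  so no other summand can cancel it.\<close>

lemma Lg_independent:
  assumes S: "finite S" "S \<subseteq> zgen (roots r) \<times> lat n" "\<forall>t\<in>S. c t \<in> (case t of (a, l) \<Rightarrow> Lg a l)"
    and zero: "sum c S = 0" and s: "s \<in> S"
  shows "c s = 0"
proof (rule ccontr)
  assume "c s \<noteq> 0"
  then obtain i j where ij: "c s i j \<noteq> 0" by (metis ext zero_fun_apply)
  obtain a l where al: "s = (a, l)" by (cases s)
  have cs: "c s \<in> Mg a l" using S(3) s al by (auto simp: Lg_def)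
  have l: "l \<in> lat n" using S(2) s al by blast
  have other: "co (c t i j) l = 0" if "t \<in> S" "t \<noteq> s" for t
  proof (rule ccontr)
    assume nz: "co (c t i j) l \<noteq> 0"
    obtain b m where bm: "t = (b, m)" by (cases t)
    have ct: "c t \<in> Mg b m" using S(3) that bm by (auto simp: Lg_def)
    have m: "m \<in> lat n" using S(2) that bm by blast
    have "c t i j \<in> span {u m}" using ct by (simp add: Mg_def)
    then obtain d where "c t i j = sc d (u m)" by (auto simp: span_singleton)
    then have "m = l" using nz m by (auto simp: co_scale co_u split: if_splits)
    moreover have "c t i j \<noteq> 0" using nz by auto
    then have "b = a" using Mg_entry[OF ct] Mg_entry[OF cs ij] by simp
    ultimately show False using that(2) al bm by simp
  qed
  have "(\<Sum>t\<in>S. c t i j) = 0" using zero sum_mat_apply[of c S i j] by simp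
  then have "(\<Sum>t\<in>S. co (c t i j) l) = 0" by (metis co_sum co_zero)
  then have "co (c s i j) l = 0"
    using sum.remove[OF S(1) s, of "\<lambda>t. co (c t i j) l"] other by simp
  moreover have "c s i j \<in> span {u l}" using cs by (simp add: Mg_def)
  then obtain d where "c s i j = sc d (u l)" by (auto simp: span_singleton)
  ultimately show False using ij l by (simp add: co_scale co_u)
qed

lemma Lg_decomp:
  "direct_sum_decomp (mat_scale sc) sl (zgen (roots r) \<times> lat n) (\<lambda>(a, l). Lg a l)"
  unfolding direct_sum_decomp_def
proof (intro conjI)
  show "\<forall>i\<in>zgen (roots r) \<times> lat n. M.subspace (case i of (a, l) \<Rightarrow> Lg a l) \<and> (case i of (a, l) \<Rightarrow> Lg a l) \<subseteq> sl"
    using Lg_subspace by (auto simp: Lg_def)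
  show "\<forall>x\<in>sl. \<exists>S c. finite S \<and> S \<subseteq> zgen (roots r) \<times> lat n \<and>
      (\<forall>i\<in>S. c i \<in> (case i of (a, l) \<Rightarrow> Lg a l)) \<and> x = sum c S"
  proof
    fix x assume "x \<in> sl"
    then have "x \<in> M.span (\<Union>i\<in>zgen (roots r) \<times> lat n. (case i of (a, l) \<Rightarrow> Lg a l))"
      using sl_span by blast
    then show "\<exists>S c. finite S \<and> S \<subseteq> zgen (roots r) \<times> lat n \<and>
      (\<forall>i\<in>S. c i \<in> (case i of (a, l) \<Rightarrow> Lg a l)) \<and> x = sum c S"
      by (rule M.span_UN_finite_sum) (use Lg_subspace in auto)
  qed
  show "\<forall>S c. finite S \<and> S \<subseteq> zgen (roots r) \<times> lat n \<and> (\<forall>i\<in>S. c i \<in> (case i of (a, l) \<Rightarrow> Lg a l)) \<and>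
      sum c S = 0 \<longrightarrow> (\<forall>i\<in>S. c i = 0)"
    using Lg_independent by blast
qed

lemma root_space_entries:
  assumes "X \<in> root_space (mat_scale sc) n Lg b"
  shows "X \<in> matn r" "X i j \<noteq> 0 \<Longrightarrow> b = vert r i - vert r j"
proof -
  let ?R = "{X \<in> matn r. \<forall>i j. b \<noteq> vert r i - vert r j \<longrightarrow> X i j = 0}"
  have "M.subspace ?R"
    unfolding M.subspace_def by (auto simp: matn_def mat_scale_def)
  moreover have "(\<Union>l\<in>lat n. Lg b l) \<subseteq> ?R" by (auto simp: Lg_def Mg_def)
  ultimately have "root_space (mat_scale sc) n Lg b \<subseteq> ?R"
    unfolding root_space_def by (intro M.span_minimal)
  then show "X \<in> matn r" "X i j \<noteq> 0 \<Longrightarrow> b = vert r i - vert r j" using assms by auto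
qed

lemma coroot_entry:
  assumes ij: "i \<le> r" "j \<le> r" "i \<noteq> j" and X: "X \<in> matn r"
  shows "br (mat_unit i i 1 - mat_unit j j 1) X k l
      = ((if k = i then X k l else 0) - (if l = i then X k l else 0))
        - ((if k = j then X k l else 0) - (if l = j then X k l else 0))"
proof -
  have "br (mat_unit i i 1 - mat_unit j j 1) X = br (mat_unit i i 1) X - br (mat_unit j j 1) X"
    by (rule mat_comm_diff_left)
  then show ?thesis using ij X by (simp add: mat_comm_diag)
qed

lemma coroot_action:
  assumes ij: "i \<le> r" "j \<le> r" "i \<noteq> j" and X: "X \<in> root_space (mat_scale sc) n Lg b"
  shows "br (mat_unit i i 1 - mat_unit j j 1) X = mat_scale sc (of_int (cartan_int r b (vert r i - vert r j))) X"
proof (intro ext)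
  fix k l
  note Xm = root_space_entries(1)[OF X]
  note e = coroot_entry[OF ij Xm, of k l]
  show "br (mat_unit i i 1 - mat_unit j j 1) X k l
      = mat_scale sc (of_int (cartan_int r b (vert r i - vert r j))) X k l"
  proof (cases "X k l = 0")
    case True
    then show ?thesis unfolding e mat_scale_def by (simp only: scale_zero_right diff_self if_cancel)
  next
    case False
    then have b: "b = vert r k - vert r l" using root_space_entries(2)[OF X] by blast
    have kl: "k \<le> r" "l \<le> r" using Xm False by (auto simp: matn_def not_less[symmetric])
    show ?thesis
      unfolding e b cartan_int_roots[OF r_pos ij(1,2) kl ij(3)] mat_scale_def
        of_int_add of_int_diff of_int_of_bool scale_left_distrib scale_left_diff_distrib
      by (auto simp: of_bool_def)
  qed
qed

lemma Lg_coroot: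
  assumes a: "a \<in> roots r - {0}" and l: "l \<in> lat n"
  shows "\<exists>e f. Lg a l = M.span {e} \<and> Lg (- a) (- l) = M.span {f} \<and>
    (\<forall>b\<in>zgen (roots r). \<forall>x\<in>root_space (mat_scale sc) n Lg b.
       br (br e f) x = mat_scale sc (of_int (cartan_int r b a)) x)"
proof -
  obtain i j where ij: "i \<le> r" "j \<le> r" "a = vert r i - vert r j" "a \<noteq> 0"
    using a unfolding roots_def by blast
  then have "i \<noteq> j" by auto
  define v where "v = unit_inv (u l)"
  have v: "v \<in> homog (- l)" unfolding v_def by (rule unit_inv_homog[OF u_homog l])
  have uv: "u l * v = 1" "v * u l = 1" unfolding v_def by (rule unit_inv[OF u_invertible[OF l]])+
  have "- a = vert r j - vert r i" using ij(3) by simp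
  then have 1: "Lg a l = M.span {mat_unit i j (u l)}" "Lg (- a) (- l) = M.span {mat_unit j i v}"
    using Lg_root[OF ij(1,2) \<open>i \<noteq> j\<close> l u_homog] Lg_root[OF ij(2,1) _ lat_uminus[OF l] v] \<open>i \<noteq> j\<close> ij(3)
    by simp_all
  have "br (mat_unit i j (u l)) (mat_unit j i v) = mat_unit i i 1 - mat_unit j j 1"
    using ij(1,2) \<open>i \<noteq> j\<close> by (simp add: mat_comm_unit uv)
  then show ?thesis using 1 coroot_action[OF ij(1,2) \<open>i \<noteq> j\<close>] ij(3)
    by (rule_tac exI[of _ "mat_unit i j (u l)"], rule_tac exI[of _ "mat_unit j i v"]) simp
qed

text \<open>Off-diagonal units lie in root spaces, and their brackets with diagonal units are again
  off-diagonal. The remaining case, two diagonal units at the same place, yields a ring commutator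
  on the diagonal.\<close>

lemma Lg_generates:
  "lie_generated (mat_scale sc) br (\<Union>a\<in>roots r - {0}. root_space (mat_scale sc) n Lg a) = sl"
proof
  have "lie_subalgebra (mat_scale sc) br sl"
    using sl_subspace br_sl by (simp add: lie_subalgebra_def)
  moreover have "root_space (mat_scale sc) n Lg a \<subseteq> sl" for a
    unfolding root_space_def by (intro M.span_minimal sl_subspace) (auto simp: Lg_def)
  ultimately show "lie_generated (mat_scale sc) br (\<Union>a\<in>roots r - {0}. root_space (mat_scale sc) n Lg a) \<subseteq> sl"
    unfolding lie_generated_def by blast
  show "sl \<subseteq> lie_generated (mat_scale sc) br (\<Union>a\<in>roots r - {0}. root_space (mat_scale sc) n Lg a)"
    unfolding lie_generated_def
  proof (rule Inter_greatest, clarify)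
    fix T X assume T: "lie_subalgebra (mat_scale sc) br T"
      "(\<Union>a\<in>roots r - {0}. root_space (mat_scale sc) n Lg a) \<subseteq> T" and X: "X \<in> sl"
    have Ts: "M.subspace T" and Tbr: "\<And>x y. x \<in> T \<Longrightarrow> y \<in> T \<Longrightarrow> br x y \<in> T"
      using T(1) by (auto simp: lie_subalgebra_def)
    have off: "mat_unit i j x \<in> T" if "i \<le> r" "j \<le> r" "i \<noteq> j" for i j x
    proof -
      have "mat_unit i j (u l) \<in> T" if "l \<in> lat n" for l
      proof -
        have "mat_unit i j (u l) \<in> Lg (vert r i - vert r j) l"
          unfolding Lg_root[OF \<open>i \<le> r\<close> \<open>j \<le> r\<close> \<open>i \<noteq> j\<close> that u_homog] by (rule M.span_base) simp
        then have "mat_unit i j (u l) \<in> root_space (mat_scale sc) n Lg (vert r i - vert r j)"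
          unfolding root_space_def using that by (intro M.span_base) blast
        moreover have "vert r i - vert r j \<in> roots r - {0}"
          using \<open>i \<le> r\<close> \<open>j \<le> r\<close> \<open>i \<noteq> j\<close> rootsI root_eq_zero_iff[OF r_pos] by blast
        ultimately show ?thesis using T(2) by blast
      qed
      then have "M.span ((\<lambda>l. mat_unit i j (u l)) ` lat n) \<subseteq> T"
        by (intro M.span_minimal Ts) auto
      then show ?thesis using mat_unit_span by blast
    qed
    \<comment> \<open>The second bracket is chosen to cancel the entry \<open>- y * x\<close> that
      the first one leaves at \<open>(j, j)\<close>; it contributes \<open>- y * x\<close> at
      \<open>(i, i)\<close> in return.\<close>
    have diag: "mat_unit i i (x * y - y * x) \<in> T" if i: "i \<le> r" for i x y
    proof -
      obtain j where j: "j \<le> r" "i \<noteq> j" using r_pos by (metis le0 not_one_le_zero)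
      have "br (mat_unit i j x) (mat_unit j i y) - br (mat_unit i j (y * x)) (mat_unit j i 1) \<in> T"
        using off i j by (intro M.subspace_diff[OF Ts] Tbr) auto
      moreover have "br (mat_unit i j x) (mat_unit j i y) - br (mat_unit i j (y * x)) (mat_unit j i 1)
          = mat_unit i i (x * y - y * x)"
        using i j by (simp add: mat_comm_unit mat_unit_diff)
      ultimately show ?thesis by simp
    qed
    have diag_off: "br (mat_unit i i x) (mat_unit k l y) \<in> T"
      if "i \<le> r" "k \<le> r" "l \<le> r" "k \<noteq> l" for i k l x y
      using that off M.subspace_0[OF Ts] M.subspace_neg[OF Ts] by (auto simp: mat_comm_unit)
    have gen: "br (mat_unit i j x) (mat_unit k l y) \<in> T"
      if "i \<le> r" "j \<le> r" "k \<le> r" "l \<le> r" for i j k l x y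
    proof -
      consider "i \<noteq> j" "k \<noteq> l" | "i = j" "k \<noteq> l" | "i \<noteq> j" "k = l" | "i = j" "k = l" by blast
      then show ?thesis
      proof cases
        case 1
        then show ?thesis using that off Tbr by blast
      next
        case 2
        then show ?thesis using that diag_off by blast
      next
        case 3
        then have "br (mat_unit k l y) (mat_unit i j x) \<in> T" using that diag_off by blast
        then show ?thesis using mat_comm_anti[of r "mat_unit i j x"] M.subspace_neg[OF Ts] by metis
      next
        case 4
        then show ?thesis using that diag M.subspace_0[OF Ts] by (simp add: mat_comm_unit flip: mat_unit_diff)
      qed
    qed
    have "br Y Z \<in> T" if "Y \<in> matn r" "Z \<in> matn r" for Y Z
      by (rule br_span[OF matn_span[THEN subsetD, OF that(1)] matn_span[THEN subsetD, OF that(2)] Ts])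
         (use gen in blast)
    then have "sl \<subseteq> T" unfolding sl_carrier_def[of sc r] by (intro M.span_minimal Ts) auto
    then show "X \<in> T" using X by blast
  qed
qed

theorem sl_lie_torus: "lie_torus_structure (mat_scale sc) sl br r (roots r) n Lg"
  unfolding lie_torus_structure_def Let_def
proof (intro conjI ballI impI)
  show "root_system0 r (roots r)" by (rule root_system_roots[OF r_pos])
  show "direct_sum_decomp (mat_scale sc) sl (zgen (roots r) \<times> lat n) (\<lambda>(a, l). Lg a l)"
    by (rule Lg_decomp)
  show "br x y \<in> Lg (a + b) (l + l')"
    if "l \<in> lat n" "l' \<in> lat n" "x \<in> Lg a l" "y \<in> Lg b l'" for a b l l' x y
    using that br_Mg br_sl by (simp add: Lg_def)
  show "Lg a 0 \<noteq> {0}" if a: "a \<in> roots r" "a \<noteq> 0 \<and> indivisible_root (roots r) a" for a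
  proof -
    obtain i j where ij: "i \<le> r" "j \<le> r" "a = vert r i - vert r j" using a(1) unfolding roots_def by blast
    then show ?thesis using Lg_root_nonzero[of i j 0] a(2) by auto
  qed
  show "{a \<in> zgen (roots r). \<exists>l\<in>lat n. Lg a l \<noteq> {0}} = roots r"
  proof
    show "{a \<in> zgen (roots r). \<exists>l\<in>lat n. Lg a l \<noteq> {0}} \<subseteq> roots r" using Lg_support by blast
    show "roots r \<subseteq> {a \<in> zgen (roots r). \<exists>l\<in>lat n. Lg a l \<noteq> {0}}"
    proof
      fix a assume a: "a \<in> roots r"
      then obtain i j where ij: "i \<le> r" "j \<le> r" "a = vert r i - vert r j" unfolding roots_def by blast
      have "Lg a 0 \<noteq> {0}"
        using Lg_root_nonzero[of i j 0] Lg_zero_nonzero ij by (cases "i = j") auto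
      then show "a \<in> {a \<in> zgen (roots r). \<exists>l\<in>lat n. Lg a l \<noteq> {0}}"
        using a zgen_superset[of "roots r"] lat_zero by blast
    qed
  qed
  show "\<exists>e f. Lg a l = M.span {e} \<and> Lg (- a) (- l) = M.span {f} \<and>
    (\<forall>b\<in>zgen (roots r). \<forall>x\<in>root_space (mat_scale sc) n Lg b.
       br (br e f) x = mat_scale sc (of_int (cartan_int r b a)) x)"
    if "a \<in> roots r - {0}" "l \<in> lat n" for a l
    using Lg_coroot[OF that] .
  show "lie_generated (mat_scale sc) br (\<Union>a\<in>roots r - {0}. root_space (mat_scale sc) n Lg a) = sl"
    by (rule Lg_generates)
  have "\<exists>a\<in>zgen (roots r). Lg a l \<noteq> {0}" if "l \<in> lat n" for l
    using Lg_root_nonzero[of 0 1 l] r_pos that rootsI[of 0 r 1] zgen_superset[of "roots r"] by auto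
  then have "{l \<in> lat n. \<exists>a\<in>zgen (roots r). Lg a l \<noteq> {0}} = lat n" by blast
  then show "zgen {l \<in> lat n. \<exists>a\<in>zgen (roots r). Lg a l \<noteq> {0}} = lat n" by (simp add: zgen_lat)
qed

end

section \<open>Transport along Lie isomorphisms\<close>

lemma lie_hom_iso_trans:
  assumes f: "lie_hom_iso s1 C br s2 C' br' f" and g: "lie_hom_iso s2 C' br' s3 C'' br'' g"
  shows "lie_hom_iso s1 C br s3 C'' br'' (g \<circ> f)"
proof -
  have "f x \<in> C'" if "x \<in> C" for x
    using f that by (auto simp: lie_hom_iso_def bij_betw_def)
  then show ?thesis
    using f g bij_betw_trans[of f C C' g C''] by (simp add: lie_hom_iso_def)
qed

text \<open>Only the values of \<open>f\<close> on \<open>C\<close> are constrained, so its laws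
  carry membership hypotheses. Closure is required of \<open>C\<close>; as the image of
  \<open>C\<close>, the target \<open>C'\<close> inherits it.\<close>

locale lie_iso = V: vector_space s1 + W: vector_space s2
  for s1 :: "'k::field \<Rightarrow> 'v::ab_group_add \<Rightarrow> 'v" and s2 :: "'k \<Rightarrow> 'w::ab_group_add \<Rightarrow> 'w" +
  fixes C br C' br' f
  assumes C_sub: "V.subspace C" and C_br: "\<And>x y. x \<in> C \<Longrightarrow> y \<in> C \<Longrightarrow> br x y \<in> C"
    and iso: "lie_hom_iso s1 C br s2 C' br' f"
begin

lemma f_add: "x \<in> C \<Longrightarrow> y \<in> C \<Longrightarrow> f (x + y) = f x + f y"
  and f_scale: "x \<in> C \<Longrightarrow> f (s1 c x) = s2 c (f x)"
  and f_br: "x \<in> C \<Longrightarrow> y \<in> C \<Longrightarrow> f (br x y) = br' (f x) (f y)"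
  and f_inj: "inj_on f C" and f_image: "f ` C = C'"
  using iso by (auto simp: lie_hom_iso_def bij_betw_def)

lemma f_zero: "f 0 = 0"
  using f_add[of 0 0] V.subspace_0[OF C_sub] by simp

lemma f_eq_zero: "x \<in> C \<Longrightarrow> f x = 0 \<longleftrightarrow> x = 0"
  using f_inj f_zero V.subspace_0[OF C_sub] unfolding inj_on_def by metis

lemma f_sum:
  assumes "\<And>i. i \<in> S \<Longrightarrow> c i \<in> C"
  shows "f (sum c S) = (\<Sum>i\<in>S. f (c i))"
  using assms
proof (induction S rule: infinite_finite_induct)
  case (insert i S)
  then show ?case using f_add V.subspace_sum[OF C_sub, of S c] by simp
qed (simp_all add: f_zero)

lemma span_f_image:
  assumes "X \<subseteq> C"
  shows "W.span (f ` X) = f ` V.span X"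
proof
  have XC: "V.span X \<subseteq> C" using assms C_sub by (rule V.span_minimal)
  show "W.span (f ` X) \<subseteq> f ` V.span X"
  proof
    fix y assume "y \<in> W.span (f ` X)"
    then show "y \<in> f ` V.span X"
    proof (induction rule: W.span_induct_alt)
      case base
      have "f 0 \<in> f ` V.span X" using V.span_zero by blast
      then show ?case by (simp add: f_zero)
    next
      case (step c z y)
      then obtain x x' where x: "x \<in> X" "z = f x" "x' \<in> V.span X" "y = f x'" by blast
      then have "s2 c z + y = f (s1 c x + x')"
        using XC assms V.subspace_scale[OF C_sub] by (auto simp: f_add f_scale subset_iff)
      moreover have "s1 c x + x' \<in> V.span X" using x V.span_add V.span_scale V.span_base by blast
      ultimately show ?case by blast
    qed
  qed
  have "x \<in> C \<and> f x \<in> W.span (f ` X)" if "x \<in> V.span X" for x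
    using that
  proof (induction rule: V.span_induct_alt)
    case base
    then show ?case using V.subspace_0[OF C_sub] f_zero W.span_zero by simp
  next
    case (step c x y)
    then have "x \<in> C" "s1 c x \<in> C" using assms V.subspace_scale[OF C_sub] by blast+
    moreover have "f x \<in> W.span (f ` X)" using step(1) by (intro W.span_base) blast
    ultimately show ?case
      using step by (simp add: f_add f_scale V.subspace_add[OF C_sub] W.span_add W.span_scale)
  qed
  then show "f ` V.span X \<subseteq> W.span (f ` X)" by blast
qed

lemma f_subspace: "V.subspace X \<Longrightarrow> X \<subseteq> C \<Longrightarrow> W.subspace (f ` X)"
  using span_f_image[of X] by (metis V.span_eq_iff W.subspace_span)

lemma direct_sum_transport:
  assumes "direct_sum_decomp s1 C I G"
  shows "direct_sum_decomp s2 C' I (\<lambda>i. f ` G i)"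
proof -
  have D1: "\<forall>i\<in>I. V.subspace (G i) \<and> G i \<subseteq> C"
    and D2: "\<forall>x\<in>C. \<exists>S c. finite S \<and> S \<subseteq> I \<and> (\<forall>i\<in>S. c i \<in> G i) \<and> x = sum c S"
    and D3: "\<forall>S c. finite S \<and> S \<subseteq> I \<and> (\<forall>i\<in>S. c i \<in> G i) \<and> sum c S = 0 \<longrightarrow> (\<forall>i\<in>S. c i = 0)"
    using assms unfolding direct_sum_decomp_def by - (elim conjE, assumption)+
  have G: "V.subspace (G i)" "G i \<subseteq> C" if "i \<in> I" for i
    using D1 that by simp_all
  show ?thesis
    unfolding direct_sum_decomp_def
  proof (intro conjI ballI allI impI)
    fix i assume i: "i \<in> I"
    show "W.subspace (f ` G i)" by (rule f_subspace[OF G(1)[OF i] G(2)[OF i]])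
    show "f ` G i \<subseteq> C'" using G(2)[OF i] f_image by blast
  next
    fix y assume "y \<in> C'"
    then obtain x where x: "x \<in> C" "y = f x" using f_image by blast
    obtain S c where S: "finite S" "S \<subseteq> I" "\<forall>i\<in>S. c i \<in> G i" "x = sum c S" using bspec[OF D2 x(1)] by (elim exE conjE)
    have cC: "c i \<in> C" if "i \<in> S" for i using S(2,3) G(2)[of i] that by blast
    have "y = (\<Sum>i\<in>S. f (c i))" unfolding x(2) S(4) by (rule f_sum) (rule cC)
    then show "\<exists>S c. finite S \<and> S \<subseteq> I \<and> (\<forall>i\<in>S. c i \<in> f ` G i) \<and> y = sum c S"
      using S by (intro exI[of _ S] exI[of _ "\<lambda>i. f (c i)"]) simp
  next
    fix S c i
    assume *: "finite S \<and> S \<subseteq> I \<and> (\<forall>i\<in>S. c i \<in> f ` G i) \<and> sum c S = 0" and i: "i \<in> S"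
    then have "\<forall>i\<in>S. \<exists>x. x \<in> G i \<and> c i = f x" by blast
    then obtain d where d: "\<And>i. i \<in> S \<Longrightarrow> d i \<in> G i" "\<And>i. i \<in> S \<Longrightarrow> c i = f (d i)" by metis
    have dC: "d i \<in> C" if "i \<in> S" for i using d(1)[OF that] * G(2)[of i] that by blast
    have "f (sum d S) = (\<Sum>i\<in>S. f (d i))" by (rule f_sum) (rule dC)
    also have "\<dots> = sum c S" by (rule sum.cong) (simp_all add: d(2))
    finally have "f (sum d S) = 0" using * by simp
    moreover have "sum d S \<in> C" by (rule V.subspace_sum[OF C_sub]) (rule dC)
    ultimately have "sum d S = 0" using f_eq_zero by blast
    then have "\<forall>i\<in>S. d i = 0"
      by (intro D3[THEN spec, THEN spec, THEN mp]) (use * d(1) in simp)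
    then have "d i = 0" using i by blast
    then show "c i = 0" using d(2)[OF i] f_zero by simp
  qed
qed

text \<open>Assumption (C) compares two structures on one and the same algebra, so the structure of
  the source has to be carried over before it applies.\<close>

lemma lie_torus_transport:
  assumes "lie_torus_structure s1 C br d D m Lg"
  shows "lie_torus_structure s2 C' br' d D m (\<lambda>a l. f ` Lg a l)"
proof -
  let ?Q = "zgen D"
  from assms have rs: "root_system0 d D"
    and decomp: "direct_sum_decomp s1 C (?Q \<times> lat m) (\<lambda>(a, l). Lg a l)"
    and gr: "\<forall>a\<in>?Q. \<forall>b\<in>?Q. \<forall>l\<in>lat m. \<forall>l'\<in>lat m. \<forall>x\<in>Lg a l. \<forall>y\<in>Lg b l'. br x y \<in> Lg (a + b) (l + l')"
    and supp: "{a\<in>?Q. \<exists>l\<in>lat m. Lg a l \<noteq> {0}} = D"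
    and indiv: "\<forall>a\<in>D. a \<noteq> 0 \<and> indivisible_root D a \<longrightarrow> Lg a 0 \<noteq> {0}"
    and cor: "\<forall>a\<in>D - {0}. \<forall>l\<in>lat m. Lg a l \<noteq> {0} \<longrightarrow>
        (\<exists>e f. Lg a l = V.span {e} \<and> Lg (- a) (- l) = V.span {f} \<and>
          (\<forall>b\<in>?Q. \<forall>x\<in>root_space s1 m Lg b. br (br e f) x = s1 (of_int (cartan_int d b a)) x))"
    and gen: "lie_generated s1 br (\<Union>a\<in>D - {0}. root_space s1 m Lg a) = C"
    and lat: "zgen {l\<in>lat m. \<exists>a\<in>?Q. Lg a l \<noteq> {0}} = lat m"
    unfolding lie_torus_structure_def Let_def by - (elim conjE, assumption)+
  have "\<forall>i\<in>?Q \<times> lat m. V.subspace (case i of (a, l) \<Rightarrow> Lg a l) \<and> (case i of (a, l) \<Rightarrow> Lg a l) \<subseteq> C"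
    using decomp unfolding direct_sum_decomp_def by (elim conjE)
  from bspec[OF this]
  have LC: "Lg a l \<subseteq> C" and Lsub: "V.subspace (Lg a l)" if "a \<in> ?Q" "l \<in> lat m" for a l
    using that by auto
  have ne: "f ` Lg a l = {0} \<longleftrightarrow> Lg a l = {0}" if al: "a \<in> ?Q" "l \<in> lat m" for a l
  proof
    assume fe: "f ` Lg a l = {0}"
    have "x = 0" if "x \<in> Lg a l" for x
    proof -
      have "f x = 0" using fe that by blast
      then show ?thesis using f_eq_zero[of x] LC[OF al] that by blast
    qed
    then show "Lg a l = {0}" using V.subspace_0[OF Lsub[OF al]] by blast
  qed (simp add: f_zero)
  have DQ: "a \<in> ?Q" if "a \<in> D" for a using zgen_superset that by blast
  have rsC: "root_space s1 m Lg b \<subseteq> C" if "b \<in> ?Q" for b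
    unfolding root_space_def using LC that C_sub by (intro V.span_minimal) auto
  have rs_image: "root_space s2 m (\<lambda>a l. f ` Lg a l) b = f ` root_space s1 m Lg b" if "b \<in> ?Q" for b
    unfolding root_space_def image_UN[symmetric] using LC that by (intro span_f_image) blast
  show ?thesis
    unfolding lie_torus_structure_def Let_def
  proof (intro conjI ballI impI)
    show "root_system0 d D" by (rule rs)
    show "direct_sum_decomp s2 C' (?Q \<times> lat m) (\<lambda>(a, l). f ` Lg a l)"
      using direct_sum_transport[OF decomp] by (simp add: case_prod_unfold)
  next
    fix a b l l' x y
    assume *: "a \<in> ?Q" "b \<in> ?Q" "l \<in> lat m" "l' \<in> lat m" "x \<in> f ` Lg a l" "y \<in> f ` Lg b l'"
    then obtain x' y' where xy: "x' \<in> Lg a l" "y' \<in> Lg b l'" "x = f x'" "y = f y'" by blast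
    have "x' \<in> C" using LC[OF *(1,3)] xy(1) by blast
    moreover have "y' \<in> C" using LC[OF *(2,4)] xy(2) by blast
    ultimately have "br' x y = f (br x' y')" by (simp add: f_br xy)
    moreover have "br x' y' \<in> Lg (a + b) (l + l')" using gr *(1-4) xy(1,2) by blast
    ultimately show "br' x y \<in> f ` Lg (a + b) (l + l')" by blast
  next
    have "(\<exists>l\<in>lat m. f ` Lg a l \<noteq> {0}) \<longleftrightarrow> (\<exists>l\<in>lat m. Lg a l \<noteq> {0})" if "a \<in> ?Q" for a
      using ne[OF that] by simp
    then have "{a \<in> ?Q. \<exists>l\<in>lat m. f ` Lg a l \<noteq> {0}} = {a \<in> ?Q. \<exists>l\<in>lat m. Lg a l \<noteq> {0}}"
      by (intro Collect_cong) (simp cong: conj_cong)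
    then show "{a \<in> ?Q. \<exists>l\<in>lat m. f ` Lg a l \<noteq> {0}} = D" using supp by (rule trans)
  next
    fix a assume "a \<in> D" "a \<noteq> 0 \<and> indivisible_root D a"
    then show "f ` Lg a 0 \<noteq> {0}" using indiv ne[OF DQ lat_zero] by simp
  next
    fix a l assume *: "a \<in> D - {0}" "l \<in> lat m" "f ` Lg a l \<noteq> {0}"
    have aQ: "a \<in> ?Q" using * DQ by blast
    have "Lg a l \<noteq> {0}" using *(3) ne[OF aQ *(2)] by simp
    obtain e g where eg: "Lg a l = V.span {e}" "Lg (- a) (- l) = V.span {g}"
      "\<And>b x. b \<in> ?Q \<Longrightarrow> x \<in> root_space s1 m Lg b \<Longrightarrow> br (br e g) x = s1 (of_int (cartan_int d b a)) x"
      using bspec[OF bspec[OF cor *(1)] *(2)] \<open>Lg a l \<noteq> {0}\<close> by blast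
    have maQ: "- a \<in> ?Q" using zgen_diff[OF zgen_zero aQ] by simp
    have e: "e \<in> C" using LC[OF aQ *(2)] eg(1) V.span_base[of e "{e}"] by blast
    have g: "g \<in> C" using LC[OF maQ lat_uminus[OF *(2)]] eg(2) V.span_base[of g "{g}"] by blast
    have "f ` Lg a l = W.span {f e}" using span_f_image[of "{e}"] e eg(1) by simp
    moreover have "f ` Lg (- a) (- l) = W.span {f g}" using span_f_image[of "{g}"] g eg(2) by simp
    moreover have "br' (br' (f e) (f g)) x = s2 (of_int (cartan_int d b a)) x"
      if b: "b \<in> ?Q" and x: "x \<in> root_space s2 m (\<lambda>a l. f ` Lg a l) b" for b x
    proof -
      obtain x' where x': "x' \<in> root_space s1 m Lg b" "x = f x'" using x rs_image[OF b] by blast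
      then have "x' \<in> C" using rsC[OF b] by blast
      then have "br' (br' (f e) (f g)) x = f (br (br e g) x')"
        using x'(2) e g C_br by (simp add: f_br)
      then show ?thesis using eg(3)[OF b x'(1)] f_scale[OF \<open>x' \<in> C\<close>] x'(2) by simp
    qed
    ultimately show "\<exists>e g. f ` Lg a l = W.span {e} \<and> f ` Lg (- a) (- l) = W.span {g} \<and>
      (\<forall>b\<in>?Q. \<forall>x\<in>root_space s2 m (\<lambda>a l. f ` Lg a l) b. br' (br' e g) x = s2 (of_int (cartan_int d b a)) x)"
      by blast
  next
    let ?X = "\<Union>a\<in>D - {0}. root_space s1 m Lg a"
    have X: "(\<Union>a\<in>D - {0}. root_space s2 m (\<lambda>a l. f ` Lg a l) a) = f ` ?X"
      unfolding image_UN by (intro SUP_cong refl rs_image) (use DQ in blast)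
    have XC: "?X \<subseteq> C" using rsC DQ by blast
    show "lie_generated s2 br' (\<Union>a\<in>D - {0}. root_space s2 m (\<lambda>a l. f ` Lg a l) a) = C'"
      unfolding X
    proof
      have "W.subspace C'" using f_subspace[OF C_sub] f_image by simp
      moreover have "br' x y \<in> C'" if xy: "x \<in> C'" "y \<in> C'" for x y
      proof -
        obtain x' y' where "x' \<in> C" "y' \<in> C" "x = f x'" "y = f y'" using xy f_image by blast
        then show ?thesis using f_br[of x' y'] C_br[of x' y'] f_image by (metis imageI)
      qed
      ultimately have "lie_subalgebra s2 br' C'" by (simp add: lie_subalgebra_def)
      moreover have "f ` ?X \<subseteq> C'" using XC f_image by blast
      ultimately show "lie_generated s2 br' (f ` ?X) \<subseteq> C'" unfolding lie_generated_def by blast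
      show "C' \<subseteq> lie_generated s2 br' (f ` ?X)"
        unfolding lie_generated_def
      proof (rule Inter_greatest)
        fix T assume "T \<in> {S. lie_subalgebra s2 br' S \<and> f ` ?X \<subseteq> S}"
        then have Ts: "W.subspace T" and Tb: "\<And>x y. x \<in> T \<Longrightarrow> y \<in> T \<Longrightarrow> br' x y \<in> T" and XT: "f ` ?X \<subseteq> T"
          by (simp_all add: lie_subalgebra_def)
        \<comment> \<open>A subalgebra containing the images of the generators is pulled back to
          \<open>C\<close>, where the generation hypothesis forces it to be everything.\<close>
        define T0 where "T0 = {x \<in> C. f x \<in> T}"
        have "V.subspace T0"
          unfolding V.subspace_def T0_def
          using V.subspace_0[OF C_sub] V.subspace_add[OF C_sub] V.subspace_scale[OF C_sub]
            W.subspace_0[OF Ts] W.subspace_add[OF Ts] W.subspace_scale[OF Ts]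
          by (auto simp: f_zero f_add f_scale)
        then have "lie_subalgebra s1 br T0"
          using C_br Tb by (auto simp: lie_subalgebra_def T0_def f_br)
        moreover have "?X \<subseteq> T0" using XC XT by (auto simp: T0_def)
        ultimately have "lie_generated s1 br ?X \<subseteq> T0" unfolding lie_generated_def by blast
        then show "C' \<subseteq> T" using gen f_image by (auto simp: T0_def)
      qed
    qed
  next
    have "(\<exists>a\<in>?Q. f ` Lg a l \<noteq> {0}) \<longleftrightarrow> (\<exists>a\<in>?Q. Lg a l \<noteq> {0})" if "l \<in> lat m" for l
      using ne[OF _ that] by simp
    then have "{l \<in> lat m. \<exists>a\<in>?Q. f ` Lg a l \<noteq> {0}} = {l \<in> lat m. \<exists>a\<in>?Q. Lg a l \<noteq> {0}}"
      by (intro Collect_cong) (simp cong: conj_cong)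
    then show "zgen {l \<in> lat m. \<exists>a\<in>?Q. f ` Lg a l \<noteq> {0}} = lat m" using lat by simp
  qed
qed

end

section \<open>Recovering the coordinate torus\<close>

lemma mat_comm_triple:
  assumes "i \<le> r" "j \<le> r" "i \<noteq> j"
  shows "mat_comm r (mat_comm r (mat_unit i j x) (mat_unit j i y)) (mat_unit i j z)
    = mat_unit i j (x * y * z + z * y * x)"
  using assms by (simp add: mat_comm_unit mat_comm_diff_left mat_unit_add mult.assoc)

locale sl_torus_char_0 = sl_torus sc n u r
  for sc :: "'k::field_char_0 \<Rightarrow> 'a::ring_1 \<Rightarrow> 'a" and n u r
begin

lemma add_self_eq_0: "x + x = 0 \<Longrightarrow> x = (0 :: 'a)"
proof -
  assume "x + x = 0"
  moreover have "sc 2 x = x + x" using scale_left_distrib[of 1 1 x] by simp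
  ultimately have "sc 2 x = 0" by simp
  then show "x = 0" by (simp add: scale_eq_0_iff)
qed

text \<open>The entry at \<open>(k, l)\<close> is scaled by an integer \<open>N\<close> that equals
  2 at \<open>(i, j)\<close> only; characteristic 0 keeps 2 apart from the other values.\<close>

lemma coroot_eigen:
  assumes ij: "i \<le> r" "j \<le> r" "i \<noteq> j" and X: "X \<in> matn r"
    and eig: "br (mat_unit i i 1 - mat_unit j j 1) X = mat_scale sc 2 X"
  shows "X = mat_unit i j (X i j)"
proof (intro ext)
  fix k l
  show "X k l = mat_unit i j (X i j) k l"
  proof (cases "k = i \<and> l = j")
    case True
    then show ?thesis by simp
  next
    case False
    define N :: int where "N = of_bool (k = i) - of_bool (l = i) - (of_bool (k = j) - of_bool (l = j))"
    have "br (mat_unit i i 1 - mat_unit j j 1) X k l = sc (of_int N) (X k l)"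
      unfolding coroot_entry[OF ij X] N_def of_int_diff of_int_of_bool scale_left_diff_distrib
      by (auto simp: of_bool_def)
    then have "sc (of_int N) (X k l) = sc (of_int 2) (X k l)"
      using fun_cong[OF fun_cong[OF eig], of k l] by (simp add: mat_scale_def)
    then have "of_int N = (of_int 2 :: 'k) \<or> X k l = 0" using scale_cancel by blast
    moreover have "N \<noteq> 2" using False ij(3) by (auto simp: N_def)
    ultimately have "X k l = 0" by (simp only: of_int_eq_iff) blast
    then show ?thesis using False by (auto simp: mat_unit_def)
  qed
qed

lemma coroot_on_mat_unit:
  assumes ij: "i \<le> r" "j \<le> r" "i \<noteq> j"
  shows "br (mat_unit i i 1 - mat_unit j j 1) (mat_unit i j x) = mat_scale sc 2 (mat_unit i j x)"
proof (intro ext)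
  fix k l
  have "sc 2 x = x + x" using scale_left_distrib[of 1 1 x] by simp
  then show "br (mat_unit i i 1 - mat_unit j j 1) (mat_unit i j x) k l = mat_scale sc 2 (mat_unit i j x) k l"
    unfolding coroot_entry[OF ij mat_unit_matn[OF ij(1,2)]] using ij(3)
    by (auto simp: mat_scale_def mat_unit_def)
qed

lemma diag_br_mat_unit:
  assumes "\<forall>X\<in>matn r. \<forall>k l. br H X k l = sc (h k - h l) (X k l)" "i \<le> r" "j \<le> r"
  shows "br H (mat_unit i j x) = mat_scale sc (h i - h j) (mat_unit i j x)"
proof (intro ext)
  fix k l
  have "br H (mat_unit i j x) k l = sc (h k - h l) (mat_unit i j x k l)"
    using assms mat_unit_matn[of i r j x] by blast
  also have "\<dots> = sc (h i - h j) (mat_unit i j x k l)" by (simp add: mat_unit_def)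
  finally show "br H (mat_unit i j x) k l = mat_scale sc (h i - h j) (mat_unit i j x) k l"
    by (simp add: mat_scale_def)
qed

lemma mat_scale_unit_cancel:
  "mat_scale sc a (mat_unit i j 1) = mat_scale sc b (mat_unit i j 1) \<Longrightarrow> a = b"
  using M.scale_right_imp_eq[of "mat_unit i j 1" a b] mat_unit_eq_0_iff[of i j "1 :: 'a"] by simp

text \<open>In degree 0 the entries are scalar multiples of 1, and the root 0 leaves only the
  diagonal; \<open>h k\<close> is the scalar at \<open>(k, k)\<close>. From here on \<open>H\<close>
  enters only through the weights \<open>h k - h l\<close>.\<close>

lemma Lg_zero_diagonal:
  assumes "H \<in> Lg 0 0"
  shows "\<exists>h. \<forall>X\<in>matn r. \<forall>k l. br H X k l = sc (h k - h l) (X k l)"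
proof -
  have H: "H \<in> matn r" "H \<in> Mg 0 0" using assms sl_matn by (auto simp: Lg_def)
  have "\<exists>c. H k k = sc c 1" for k
  proof -
    have "H k k \<in> span {1}" using H(2) homog_span[OF one_homog lat_zero] by (auto simp: Mg_def)
    then show ?thesis by (auto simp: span_singleton)
  qed
  then obtain h where h: "\<And>k. H k k = sc (h k) 1" by metis
  have diag: "H k m = (if m = k then sc (h k) 1 else 0)" for k m
  proof (cases "m = k")
    case True
    then show ?thesis using h by simp
  next
    case False
    have "H k m = 0"
    proof (rule ccontr)
      assume nz: "H k m \<noteq> 0"
      then have "k \<le> r" "m \<le> r" using H(1) by (auto simp: matn_def not_less[symmetric])
      then show False using Mg_entry[OF H(2) nz] root_eq_zero_iff[OF r_pos, of k m] False by simp
    qed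
    then show ?thesis using False by simp
  qed
  have "br H X k l = sc (h k - h l) (X k l)" if X: "X \<in> matn r" for X k l
  proof (cases "k \<le> r \<and> l \<le> r")
    case True
    have "(\<Sum>m\<le>r. H k m * X m l) = (\<Sum>m\<le>r. if m = k then sc (h k) (X k l) else 0)"
      by (intro sum.cong refl) (auto simp: diag simp flip: scale_mult_left)
    moreover have "(\<Sum>m\<le>r. X k m * H m l) = (\<Sum>m\<le>r. if m = l then sc (h l) (X k l) else 0)"
      by (intro sum.cong refl) (auto simp: diag simp flip: scale_mult_right)
    ultimately show ?thesis
      using True by (simp add: mat_comm_def mat_mult_def scale_left_diff_distrib)
  next
    case False
    then show ?thesis using X mat_comm_matn[of r H X] by (auto simp: matn_def not_le)
  qed
  then show ?thesis by blast
qed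

end

section \<open>An isomorphism that matches the Cartan subalgebras\<close>

locale sl_iso = A: sl_torus_char_0 sc n u r + B: sl_torus_char_0 sc' n' u' r
  for sc :: "'k::field_char_0 \<Rightarrow> 'a::ring_1 \<Rightarrow> 'a" and n u
    and sc' :: "'k \<Rightarrow> 'b::ring_1 \<Rightarrow> 'b" and n' u' r +
  fixes F
  assumes F_iso: "lie_hom_iso (mat_scale sc) A.sl A.br (mat_scale sc') B.sl B.br F"
    and F_cartan: "F ` A.Lg 0 0 = B.Lg 0 0"
begin

sublocale lie_iso "mat_scale sc" "mat_scale sc'" A.sl A.br B.sl B.br F
  by unfold_locales (use A.sl_subspace A.br_sl F_iso in auto)

text \<open>Pulling the coroot of \<open>(i, j)\<close> back and pushing that of \<open>(p, q)\<close> forward identifies the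
  relevant root spaces as eigenspaces for the eigenvalues \<open>2\<close> and \<open>- 2\<close>; no root system
  automorphism has to be classified.\<close>

lemma F_mat_units:
  assumes r1: "p \<le> r" "q \<le> r" "p \<noteq> q" "q \<noteq> p"
  shows "\<exists>i j. i \<le> r \<and> j \<le> r \<and> i \<noteq> j \<and>
    (\<forall>x. F (mat_unit p q x) = mat_unit i j (F (mat_unit p q x) i j)) \<and>
    (\<forall>x. F (mat_unit q p x) = mat_unit j i (F (mat_unit q p x) j i)) \<and>
    (\<forall>y. \<exists>x. F (mat_unit p q x) = mat_unit i j y)"
proof -
  have E: "mat_unit p q x \<in> A.sl" "mat_unit q p x \<in> A.sl" for x
    using A.mat_unit_sl r1 by auto
  have FC: "F X \<in> B.sl" if "X \<in> A.sl" for X using f_image that by blast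
  have FM: "F X \<in> matn r" if "X \<in> A.sl" for X using FC[OF that] B.sl_matn by blast
  have "F (mat_unit p q 1) \<noteq> 0" using f_eq_zero[OF E(1), of 1] A.mat_unit_eq_0_iff[of p q "1 :: 'a"] by simp
  \<comment> \<open>Any nonzero entry of the image of one root vector. That it is off-diagonal
    follows from \<open>h1'_2\<close>, and that it is the only one from
    \<open>coroot_eigen\<close>.\<close>
  then obtain i j where ij: "F (mat_unit p q 1) i j \<noteq> 0" by (metis ext zero_fun_apply)
  then have le: "i \<le> r" "j \<le> r" using FM[OF E(1), of 1] by (auto simp: matn_def not_less[symmetric])
  \<comment> \<open>Both sides of the image of \<open>[H, e]\<close>, with \<open>e\<close> the
    matrix unit at \<open>(p, q)\<close>, are compared at the nonzero entry: the weight of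
    \<open>(p, q)\<close> on \<open>H\<close> is the weight of \<open>(i, j)\<close> on
    \<open>F H\<close>.\<close>
  have weight: "h p - h q = h' i - h' j"
    if H: "H \<in> A.Lg 0 0" and h: "\<forall>X\<in>matn r. \<forall>k l. A.br H X k l = sc (h k - h l) (X k l)"
      and h': "\<forall>X\<in>matn r. \<forall>k l. B.br (F H) X k l = sc' (h' k - h' l) (X k l)" for H h h'
  proof -
    have "A.br H (mat_unit p q 1) = mat_scale sc (h p - h q) (mat_unit p q 1)"
      by (rule A.diag_br_mat_unit[OF h r1(1,2)])
    moreover have "H \<in> A.sl" using H by (simp add: A.Lg_def)
    ultimately have "B.br (F H) (F (mat_unit p q 1)) = mat_scale sc' (h p - h q) (F (mat_unit p q 1))"
      using f_br[OF _ E(1), of H 1] f_scale[OF E(1), of _ 1] by metis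
    then have "sc' (h' i - h' j) (F (mat_unit p q 1) i j) = sc' (h p - h q) (F (mat_unit p q 1) i j)"
      using h' FM[OF E(1), of 1] by (metis mat_scale_def)
    then show ?thesis using B.scale_cancel[OF ij] by metis
  qed
  let ?H1 = "mat_unit p p 1 - mat_unit q q 1 :: nat \<Rightarrow> nat \<Rightarrow> 'a"
  have H1: "?H1 \<in> A.Lg 0 0" using A.diag_Lg_zero r1 by blast
  then have H1sl: "?H1 \<in> A.sl" by (simp add: A.Lg_def)
  obtain h1 where h1: "\<forall>X\<in>matn r. \<forall>k l. A.br ?H1 X k l = sc (h1 k - h1 l) (X k l)"
    using A.Lg_zero_diagonal[OF H1] by blast
  obtain h1' where h1': "\<forall>X\<in>matn r. \<forall>k l. B.br (F ?H1) X k l = sc' (h1' k - h1' l) (X k l)"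
    using B.Lg_zero_diagonal[of "F ?H1"] F_cartan H1 by blast
  have h1_2: "h1 p - h1 q = 2"
    using A.diag_br_mat_unit[OF h1 r1(1,2), of 1] A.coroot_on_mat_unit[OF r1(1-3), of 1]
    by (intro A.mat_scale_unit_cancel) simp
  then have h1'_2: "h1' i - h1' j = 2" using weight[OF H1 h1 h1'] by simp
  then have "i \<noteq> j" by auto
  let ?H2 = "mat_unit i i 1 - mat_unit j j 1 :: nat \<Rightarrow> nat \<Rightarrow> 'b"
  have H2: "?H2 \<in> B.Lg 0 0" using B.diag_Lg_zero le \<open>i \<noteq> j\<close> by blast
  \<comment> \<open>The shape of \<open>H0\<close> is left open. It acts with weight 2 on the
    entries at \<open>(p, q)\<close> and with weight \<open>- 2\<close> on those at
    \<open>(q, p)\<close>, which locates the images of both root spaces.\<close>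
  then obtain H0 where H0: "H0 \<in> A.Lg 0 0" "F H0 = ?H2" using F_cartan by (metis imageE)
  then have H0sl: "H0 \<in> A.sl" by (simp add: A.Lg_def)
  obtain h0 where h0: "\<forall>X\<in>matn r. \<forall>k l. A.br H0 X k l = sc (h0 k - h0 l) (X k l)"
    using A.Lg_zero_diagonal[OF H0(1)] by blast
  obtain h0' where h0': "\<forall>X\<in>matn r. \<forall>k l. B.br (F H0) X k l = sc' (h0' k - h0' l) (X k l)"
    using B.Lg_zero_diagonal[of "F H0"] F_cartan H0(1) by blast
  have "h0' i - h0' j = 2"
    using B.diag_br_mat_unit[OF h0' le, of 1] B.coroot_on_mat_unit[OF le \<open>i \<noteq> j\<close>, of 1] H0(2)
    by (intro B.mat_scale_unit_cancel) simp
  then have h0_2: "h0 p - h0 q = 2" using weight[OF H0(1) h0 h0'] by simp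
  have 1: "F (mat_unit p q x) = mat_unit i j (F (mat_unit p q x) i j)" for x
  proof (rule B.coroot_eigen[OF le \<open>i \<noteq> j\<close> FM[OF E(1)]])
    have "A.br H0 (mat_unit p q x) = mat_scale sc 2 (mat_unit p q x)"
      using A.diag_br_mat_unit[OF h0 r1(1,2)] h0_2 by simp
    then show "B.br ?H2 (F (mat_unit p q x)) = mat_scale sc' 2 (F (mat_unit p q x))"
      using f_br[OF H0sl E(1), of x] f_scale[OF E(1), of 2 x] H0(2) by simp
  qed
  have 2: "F (mat_unit q p x) = mat_unit j i (F (mat_unit q p x) j i)" for x
  proof (rule B.coroot_eigen[OF le(2,1) _ FM[OF E(2)]])
    show "j \<noteq> i" using \<open>i \<noteq> j\<close> by simp
    have "h0 q - h0 p = - 2" using h0_2 by (simp add: algebra_simps)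
    then have "A.br H0 (mat_unit q p x) = mat_scale sc (- 2) (mat_unit q p x)"
      using A.diag_br_mat_unit[OF h0 r1(2,1)] by simp
    then have e: "B.br ?H2 (F (mat_unit q p x)) = mat_scale sc' (- 2) (F (mat_unit q p x))"
      using f_br[OF H0sl E(2), of x] f_scale[OF E(2), of "- 2" x] H0(2) by simp
    have "B.br (mat_unit j j 1 - mat_unit i i 1) (F (mat_unit q p x)) = - B.br ?H2 (F (mat_unit q p x))"
      by (simp add: mat_comm_diff_left)
    also have "\<dots> = mat_scale sc' 2 (F (mat_unit q p x))"
      unfolding e by (intro ext) (simp add: mat_scale_def)
    finally show "B.br (mat_unit j j 1 - mat_unit i i 1) (F (mat_unit q p x)) = mat_scale sc' 2 (F (mat_unit q p x))" .
  qed
  \<comment> \<open>Surjectivity runs the other way: the preimage of a matrix unit at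
    \<open>(i, j)\<close> is an eigenvector of the coroot of \<open>(p, q)\<close> for the
    eigenvalue 2.\<close>
  have 3: "\<exists>x. F (mat_unit p q x) = mat_unit i j y" for y
  proof -
    have "mat_unit i j y \<in> B.sl" using B.mat_unit_sl le \<open>i \<noteq> j\<close> by blast
    then obtain X where X: "X \<in> A.sl" "F X = mat_unit i j y" using f_image by (metis imageE)
    have Xm: "X \<in> matn r" using X(1) A.sl_matn by blast
    have "B.br (F ?H1) (F X) = mat_scale sc' 2 (F X)"
      unfolding X(2) using B.diag_br_mat_unit[OF h1' le] h1'_2 by simp
    then have "F (A.br ?H1 X) = F (mat_scale sc 2 X)"
      using f_br[OF H1sl X(1)] f_scale[OF X(1)] by simp
    then have "A.br ?H1 X = mat_scale sc 2 X"
      using f_inj A.br_sl[OF H1sl X(1)] A.M.subspace_scale[OF A.sl_subspace X(1)]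
      by (simp add: inj_on_def)
    then have "X = mat_unit p q (X p q)" by (rule A.coroot_eigen[OF r1(1-3) Xm])
    then show ?thesis using X(2) by metis
  qed
  show ?thesis using le \<open>i \<noteq> j\<close> 1 2 3 by blast
qed

lemma coordinates_isomorphic:
  assumes "fgc_ring TYPE('b)"
  shows "alg_isomorphic sc sc'"
proof -
  obtain p q :: nat where r1: "p \<le> r" "q \<le> r" "p \<noteq> q" using A.r_pos by (metis le0 zero_neq_one)
  have E: "mat_unit p q x \<in> A.sl" "mat_unit q p x \<in> A.sl" for x
    using A.mat_unit_sl r1 by auto
  obtain i j where le: "i \<le> r" "j \<le> r" "i \<noteq> j"
    and F1: "\<And>x. F (mat_unit p q x) = mat_unit i j (F (mat_unit p q x) i j)"
    and F2: "\<And>x. F (mat_unit q p x) = mat_unit j i (F (mat_unit q p x) j i)"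
    and F3: "\<And>y. \<exists>x. F (mat_unit p q x) = mat_unit i j y"
    using F_mat_units[OF r1 r1(3)[symmetric]] by blast
  define gp where "gp x = F (mat_unit p q x) i j" for x
  define gm where "gm x = F (mat_unit q p x) j i" for x
  have Fp: "F (mat_unit p q x) = mat_unit i j (gp x)" and Fm: "F (mat_unit q p x) = mat_unit j i (gm x)" for x
    unfolding gp_def gm_def by (rule F1 F2)+
  have add: "gp (x + y) = gp x + gp y" for x y
    unfolding gp_def mat_unit_add f_add[OF E(1) E(1)] by simp
  have scale: "gp (sc c x) = sc' c (gp x)" for c x
    unfolding gp_def A.mat_unit_scale f_scale[OF E(1)] by (simp add: mat_scale_def)
  have bij: "bij gp"
  proof (rule bijI)
    show "inj gp"
    proof (rule injI)
      fix x y assume "gp x = gp y"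
      then have "F (mat_unit p q x) = F (mat_unit p q y)" by (simp add: Fp)
      then have "mat_unit p q x = mat_unit p q y" using f_inj E(1) by (simp add: inj_on_def)
      then show "x = y" by (metis mat_unit_same)
    qed
    show "surj gp" unfolding gp_def surj_def using F3 by (metis mat_unit_same)
  qed
  have triple: "gp (x * y * z + z * y * x) = gp x * gm y * gp z + gp z * gm y * gp x" for x y z
  proof -
    have "F (mat_unit p q (x * y * z + z * y * x))
        = F (A.br (A.br (mat_unit p q x) (mat_unit q p y)) (mat_unit p q z))"
      by (simp only: mat_comm_triple[OF r1])
    also have "\<dots> = B.br (B.br (mat_unit i j (gp x)) (mat_unit j i (gm y))) (mat_unit i j (gp z))"
      using E A.br_sl by (simp add: f_br Fp Fm)
    also have "\<dots> = mat_unit i j (gp x * gm y * gp z + gp z * gm y * gp x)"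
      by (rule mat_comm_triple[OF le])
    finally show ?thesis unfolding Fp by (metis mat_unit_same)
  qed
  obtain w where w: "bij (\<lambda>x. w * gp x)" "w * gp 1 = 1"
    "(\<forall>x y. w * gp (x * y) = (w * gp x) * (w * gp y)) \<or> (\<forall>x y. w * gp (x * y) = (w * gp y) * (w * gp x))"
    using jordan_pair_iso_hom_or_antihom[of gp gm, OF bij add triple B.torus_domain B.add_self_eq_0] by blast
  define h where "h x = w * gp x" for x
  have h: "bij h" "h 1 = 1" "\<And>x y. h (x + y) = h x + h y" "\<And>c x. h (sc c x) = sc' c (h x)"
    using w(1,2) by (simp_all add: h_def[abs_def] add scale distrib_left flip: B.scale_mult_right)
  consider "\<forall>x y. h (x * y) = h x * h y" | "\<forall>x y. h (x * y) = h y * h x"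
    using w(3) unfolding h_def by blast
  then show ?thesis
  proof cases
    case 1
    then have "alg_iso sc sc' h" using h by (simp add: alg_iso_def)
    then show ?thesis unfolding alg_isomorphic_def by blast
  next
    case 2
    obtain \<Phi> where \<Phi>: "bij \<Phi>" "\<And>x y. \<Phi> (x + y) = \<Phi> x + \<Phi> y" "\<And>c x. \<Phi> (sc' c x) = sc' c (\<Phi> x)"
      "\<And>x y. \<Phi> (x * y) = \<Phi> y * \<Phi> x" "\<Phi> 1 = 1"
      using B.ex_anti_automorphism[OF assms] by blast
    have "alg_iso sc sc' (\<Phi> \<circ> h)"
      using h 2 \<Phi> bij_comp[OF h(1) \<Phi>(1)] by (simp add: alg_iso_def)
    then show ?thesis unfolding alg_isomorphic_def by blast
  qed
qed

end

text \<open>Applying \<open>g\<close> to every entry respects commutators and maps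
  \<open>matn r\<close> onto \<open>matn r\<close>, so it carries the spanning set of one derived
  algebra onto that of the other.\<close>

lemma alg_iso_imp_lie_isomorphic:
  fixes sc :: "'k::field \<Rightarrow> 'a::ring_1 \<Rightarrow> 'a" and sc' :: "'k \<Rightarrow> 'b::ring_1 \<Rightarrow> 'b"
  assumes "k_algebra sc" "k_algebra sc'" "alg_iso sc sc' g"
  shows "lie_isomorphic (mat_scale sc) (sl_carrier sc r) (mat_comm r)
           (mat_scale sc') (sl_carrier sc' r) (mat_comm r)"
proof -
  have g: "bij g" "\<And>x y. g (x + y) = g x + g y" "\<And>c x. g (sc c x) = sc' c (g x)"
    "\<And>x y. g (x * y) = g x * g y"
    using assms(3) by (auto simp: alg_iso_def)
  have g0: "g 0 = 0" using g(2)[of 0 0] by simp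
  have gdiff: "g (x - y) = g x - g y" for x y using g(2)[of "x - y" y] by (simp add: algebra_simps)
  have gsum: "g (sum c S) = (\<Sum>i\<in>S. g (c i))" for c and S :: "nat set"
    by (induction S rule: infinite_finite_induct) (simp_all add: g0 g(2))
  interpret V: vector_space "mat_scale sc"
    by (rule vector_space_mat_scale) (use assms(1) in \<open>simp add: k_algebra_def\<close>)
  interpret W: vector_space "mat_scale sc'"
    by (rule vector_space_mat_scale) (use assms(2) in \<open>simp add: k_algebra_def\<close>)
  define f where "f X = (\<lambda>i j. g (X i j))" for X :: "nat \<Rightarrow> nat \<Rightarrow> 'a"
  interpret f: Vector_Spaces.linear "mat_scale sc" "mat_scale sc'" f
    by unfold_locales (auto simp: f_def mat_scale_def g fun_eq_iff)
  have comm: "f (mat_comm r X Y) = mat_comm r (f X) (f Y)" for X Y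
    by (intro ext) (simp add: f_def mat_comm_def mat_mult_def gdiff gsum g(4) g0)
  have inj: "inj f"
    using g(1) by (intro injI ext) (metis bij_pointE f_def)
  have image: "f ` matn r = matn r"
  proof
    show "f ` matn r \<subseteq> matn r" by (auto simp: matn_def f_def g0)
    show "matn r \<subseteq> f ` matn r"
    proof
      fix Y :: "nat \<Rightarrow> nat \<Rightarrow> 'b" assume Y: "Y \<in> matn r"
      have "inv g 0 = 0" using g(1) g0 by (metis bij_inv_eq_iff)
      then have "(\<lambda>i j. inv g (Y i j)) \<in> matn r" using Y by (auto simp: matn_def)
      moreover have "Y = f (\<lambda>i j. inv g (Y i j))"
        using g(1) by (simp add: f_def bij_def surj_f_inv_f)
      ultimately show "Y \<in> f ` matn r" by blast
    qed
  qed
  have "f ` {mat_comm r X Y | X Y. X \<in> matn r \<and> Y \<in> matn r} = {mat_comm r X Y | X Y. X \<in> matn r \<and> Y \<in> matn r}"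
  proof
    show "f ` {mat_comm r X Y | X Y. X \<in> matn r \<and> Y \<in> matn r} \<subseteq> {mat_comm r X Y | X Y. X \<in> matn r \<and> Y \<in> matn r}"
      using comm image by blast
    show "{mat_comm r X Y | X Y. X \<in> matn r \<and> Y \<in> matn r} \<subseteq> f ` {mat_comm r X Y | X Y. X \<in> matn r \<and> Y \<in> matn r}"
    proof
      fix Z assume "Z \<in> {mat_comm r X Y | X Y. X \<in> matn r \<and> Y \<in> (matn r :: (nat \<Rightarrow> nat \<Rightarrow> 'b) set)}"
      then obtain X Y where "X \<in> f ` matn r" "Y \<in> f ` matn r" "Z = mat_comm r X Y" unfolding image by blast
      then obtain X' Y' where "X' \<in> matn r" "Y' \<in> matn r" "Z = f (mat_comm r X' Y')" using comm by (metis imageE)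
      then show "Z \<in> f ` {mat_comm r X Y | X Y. X \<in> matn r \<and> Y \<in> matn r}" by blast
    qed
  qed
  then have "f ` sl_carrier sc r = sl_carrier sc' r"
    unfolding sl_carrier_def f.span_image[symmetric] by simp
  then have "bij_betw f (sl_carrier sc r) (sl_carrier sc' r)"
    using inj by (auto simp: bij_betw_def intro: inj_on_subset)
  then have "lie_hom_iso (mat_scale sc) (sl_carrier sc r) (mat_comm r)
      (mat_scale sc') (sl_carrier sc' r) (mat_comm r) f"
    using comm f.add f.scale by (simp add: lie_hom_iso_def)
  then show ?thesis unfolding lie_isomorphic_def by blast
qed

theorem theorem11p4:
  fixes sc :: "'k::field_char_0 \<Rightarrow> 'a::ring_1 \<Rightarrow> 'a"
    and sc' :: "'k \<Rightarrow> 'b::ring_1 \<Rightarrow> 'b"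
    and n r :: nat
  assumes "alg_closed TYPE('k)"
    and "assoc_torus sc n" and "fgc_ring TYPE('a)"
    and "assoc_torus sc' n" and "fgc_ring TYPE('b)"
    and "r \<ge> 1"
    and "assumption_C (mat_scale sc) (sl_carrier sc r) (mat_comm r)"
    and "assumption_C (mat_scale sc') (sl_carrier sc' r) (mat_comm r)"
  shows "lie_isomorphic (mat_scale sc) (sl_carrier sc r) (mat_comm r)
                        (mat_scale sc') (sl_carrier sc' r) (mat_comm r)
         \<longleftrightarrow> alg_isomorphic sc sc'"
proof
  obtain u where "torus_basis sc n u" using assoc_torus_has_basis[OF assms(2)] by blast
  then interpret A: sl_torus_char_0 sc n u r
    using \<open>r \<ge> 1\<close> by (simp add: sl_torus_char_0_def sl_torus_def sl_torus_axioms_def)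
  obtain u' where "torus_basis sc' n u'" using assoc_torus_has_basis[OF assms(4)] by blast
  then interpret B: sl_torus_char_0 sc' n u' r
    using \<open>r \<ge> 1\<close> by (simp add: sl_torus_char_0_def sl_torus_def sl_torus_axioms_def)
  assume "lie_isomorphic (mat_scale sc) (sl_carrier sc r) (mat_comm r)
                         (mat_scale sc') (sl_carrier sc' r) (mat_comm r)"
  then obtain f where f: "lie_hom_iso (mat_scale sc) A.sl A.br (mat_scale sc') B.sl B.br f"
    unfolding lie_isomorphic_def by blast
  interpret f: lie_iso "mat_scale sc" "mat_scale sc'" A.sl A.br B.sl B.br f
    by unfold_locales (use A.sl_subspace A.br_sl f in auto)
  obtain \<phi> where \<phi>: "lie_hom_iso (mat_scale sc') B.sl B.br (mat_scale sc') B.sl B.br \<phi>"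
    "\<phi> ` (f ` A.Lg 0 0) = B.Lg 0 0"
    using assms(8) f.lie_torus_transport[OF A.sl_lie_torus] B.sl_lie_torus
    unfolding assumption_C_def by blast
  interpret sl_iso sc n u sc' n u' r "\<phi> \<circ> f"
    by unfold_locales (use lie_hom_iso_trans[OF f \<phi>(1)] \<phi>(2) in \<open>auto simp: image_comp\<close>)
  show "alg_isomorphic sc sc'" by (rule coordinates_isomorphic[OF assms(5)])
next
  assume "alg_isomorphic sc sc'"
  then obtain g where "alg_iso sc sc' g" unfolding alg_isomorphic_def by blast
  then show "lie_isomorphic (mat_scale sc) (sl_carrier sc r) (mat_comm r)
                            (mat_scale sc') (sl_carrier sc' r) (mat_comm r)"
    using assms(2,4) by (intro alg_iso_imp_lie_isomorphic) (simp_all add: assoc_torus_def)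
qed

end
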